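(* Let $H$ be an infinite-dimensional separable real Hilbert space, let $A\colon D(A)\subset H\to H$ be a nonnegative self-adjoint operator with compact resolvent, and let $E=D(A^{1/2})$. Let $I\in C^1(E,\mathbb{R})$ satisfy $I(0)=0$, $I'(0)=0$ and: (i) $u_k\rightharpoonup u$ weakly in $E$ implies $I(u_k)\to I(u)$; (ii) $I(u)>0$ for $u\in E\setminus\{0\}$; (iii) for every $u\in E\setminus\{0\}$ the function $t\mapsto I(tu)/t^2$ is nondecreasing on $(0,\infty)$, with limit $0$ as $t\to0^+$ and limit $+\infty$ as $t\to+\infty$; (iv) for all $u\in E\setminus\{0\}$, $v\in E$ and $s\ge-1$, $I(u)-I((1+s)u+v)+I'(u)[s(s/2+1)u+(1+s)v]\le0$, with strict inequality if $v=0$ and $s\ne0$. Let $k$ be a positive integer, and let $J_1,\dots,J_k$ be disjoint spectral gaps of $A$. Then there exists $\mu_k>0$ such that, for all $\mu\in(0,\mu_k)$, there exist $\Lambda_1,\dots,\Lambda_k\in\mathbb{R}$ with $\Lambda_i\in J_i$ for $i=1,\dots,k$ and $u_1,\dots,u_k\in E$ with $$Au_i=\Lambda_iu_i+I'(u_i)\qquad\text{and}\qquad\|u_i\|_H=\mu.$$ In particular, the equation $Au=\lambda u+I'(u)$ has at least $k$ different solutions $(u,\lambda)$ satisfying $\|u\|_H=\mu$.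
   Context: $E$ is a Hilbert space with scalar product $\langle u,v\rangle_E=\langle u,v\rangle_H+\langle A^{1/2}u,A^{1/2}v\rangle_H$. The eigenvalues of $A$, counted with multiplicity, are $0\le\lambda_1\le\lambda_2\le\dots\to+\infty$. An interval $J\subset\mathbb{R}$ is called a spectral gap of $A$ if $J=(\lambda_n,\lambda_{n+1})$ for some integer $n\ge1$ with $\lambda_n<\lambda_{n+1}$. The equation $Au=\lambda u+I'(u)$ is understood in the weak sense in the dual $E'$ of $E$: $\langle A^{1/2}u,A^{1/2}v\rangle_H=\lambda\langle u,v\rangle_H+I'(u)v$ for all $v\in E$. *)

theory Defs
  imports "HOL-Analysis.Analysis"
begin

text \<open>
  An unbounded operator on a real Hilbert space is represented by its graph, a set of pairs
  \<open>(u, y)\<close> with \<open>u\<close> in the domain and \<open>y\<close> the image of \<open>u\<close>.  Its domain is \<^const>\<open>Domain\<close>, and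
  composition of operators, with its natural domain, is relational composition.
\<close>

definition linear_operator :: "('h::real_inner \<times> 'h) set \<Rightarrow> bool" where
  "linear_operator A \<longleftrightarrow> subspace A \<and> single_valued A"

definition op_app :: "('h::real_inner \<times> 'h) set \<Rightarrow> 'h \<Rightarrow> 'h" where
  "op_app A u = (THE y. (u, y) \<in> A)"

definition adjoint_op :: "('h::real_inner \<times> 'h) set \<Rightarrow> ('h \<times> 'h) set" where
  "adjoint_op A = {(v, w). \<forall>(u, y) \<in> A. y \<bullet> v = u \<bullet> w}"

definition self_adjoint_op :: "('h::real_inner \<times> 'h) set \<Rightarrow> bool" where
  "self_adjoint_op A \<longleftrightarrow>
     linear_operator A \<and> closure (Domain A) = UNIV \<and> adjoint_op A = A"

definition nonneg_op :: "('h::real_inner \<times> 'h) set \<Rightarrow> bool" where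
  "nonneg_op A \<longleftrightarrow> (\<forall>(u, y) \<in> A. 0 \<le> y \<bullet> u)"

definition compact_linear_map :: "('h::real_inner \<Rightarrow> 'h) \<Rightarrow> bool" where
  "compact_linear_map R \<longleftrightarrow> linear R \<and> (\<forall>B. bounded B \<longrightarrow> compact (closure (R ` B)))"

text \<open>\<open>R\<close> below is the everywhere defined inverse of \<open>A - z\<close>.  By the resolvent identity, if one
  resolvent is compact, then all are.\<close>

definition compact_resolvent :: "('h::real_inner \<times> 'h) set \<Rightarrow> bool" where
  "compact_resolvent A \<longleftrightarrow>
     (\<exists>(z::real) R. compact_linear_map R \<and> (\<forall>u f. (u, f + z *\<^sub>R u) \<in> A \<longleftrightarrow> u = R f))"

text \<open>The square root of a nonnegative self-adjoint operator is the unique nonnegative self-adjoint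
  operator whose square is \<open>A\<close>, domains included.\<close>

definition sqrt_op :: "('h::real_inner \<times> 'h) set \<Rightarrow> ('h \<times> 'h) set" where
  "sqrt_op A = (THE S. self_adjoint_op S \<and> nonneg_op S \<and> S O S = A)"

definition form_domain :: "('h::real_inner \<times> 'h) set \<Rightarrow> 'h set" where
  "form_domain A = Domain (sqrt_op A)"

definition inner_E :: "('h::real_inner \<times> 'h) set \<Rightarrow> 'h \<Rightarrow> 'h \<Rightarrow> real" where
  "inner_E A u v = u \<bullet> v + op_app (sqrt_op A) u \<bullet> op_app (sqrt_op A) v"

definition norm_E :: "('h::real_inner \<times> 'h) set \<Rightarrow> 'h \<Rightarrow> real" where
  "norm_E A u = sqrt (inner_E A u u)"

definition weakly_converges_E ::
    "('h::real_inner \<times> 'h) set \<Rightarrow> (nat \<Rightarrow> 'h) \<Rightarrow> 'h \<Rightarrow> bool" where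
  "weakly_converges_E A u w \<longleftrightarrow>
     (\<forall>k. u k \<in> form_domain A) \<and> w \<in> form_domain A \<and>
     (\<forall>v \<in> form_domain A. (\<lambda>k. inner_E A (u k) v) \<longlonglongrightarrow> inner_E A w v)"

definition dual_E :: "('h::real_inner \<times> 'h) set \<Rightarrow> ('h \<Rightarrow> real) \<Rightarrow> bool" where
  "dual_E A L \<longleftrightarrow>
     (\<forall>u \<in> form_domain A. \<forall>v \<in> form_domain A. L (u + v) = L u + L v) \<and>
     (\<forall>c. \<forall>u \<in> form_domain A. L (c *\<^sub>R u) = c * L u) \<and>
     (\<exists>K. \<forall>u \<in> form_domain A. \<bar>L u\<bar> \<le> K * norm_E A u)"

text \<open>Functions on \<open>E\<close> are represented by functions on the whole of \<open>H\<close>, whose values outside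
  \<open>E = form_domain A\<close> are irrelevant.  In the next definition, \<open>I'\<close> is the Frechet derivative of
  \<open>I\<close> with respect to the norm of \<open>E\<close>, and it is continuous for the operator norm of the dual.\<close>

definition frechet_deriv_E ::
    "('h::real_inner \<times> 'h) set \<Rightarrow> ('h \<Rightarrow> real) \<Rightarrow> ('h \<Rightarrow> real) \<Rightarrow> 'h \<Rightarrow> bool" where
  "frechet_deriv_E A I L u \<longleftrightarrow>
     dual_E A L \<and>
     (\<forall>\<epsilon>>0. \<exists>\<delta>>0. \<forall>v \<in> form_domain A. norm_E A v < \<delta> \<longrightarrow>
        \<bar>I (u + v) - I u - L v\<bar> \<le> \<epsilon> * norm_E A v)"

definition C1_E ::
    "('h::real_inner \<times> 'h) set \<Rightarrow> ('h \<Rightarrow> real) \<Rightarrow> ('h \<Rightarrow> 'h \<Rightarrow> real) \<Rightarrow> bool" where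
  "C1_E A I I' \<longleftrightarrow>
     (\<forall>u \<in> form_domain A. frechet_deriv_E A I (I' u) u) \<and>
     (\<forall>u \<in> form_domain A. \<forall>\<epsilon>>0. \<exists>\<delta>>0. \<forall>w \<in> form_domain A. norm_E A (w - u) < \<delta> \<longrightarrow>
        (\<forall>v \<in> form_domain A. \<bar>I' w v - I' u v\<bar> \<le> \<epsilon> * norm_E A v))"

definition eigenspace :: "('h::real_inner \<times> 'h) set \<Rightarrow> real \<Rightarrow> 'h set" where
  "eigenspace A t = {u. (u, t *\<^sub>R u) \<in> A}"

text \<open>Each real \<open>t\<close> occurs in the sequence as often as the dimension of its eigenspace, so not at
  all if it is not an eigenvalue.  A finite basis is named because \<^const>\<open>dim\<close> and \<^const>\<open>card\<close>
  are \<open>0\<close> in the infinite case.  Indices start at \<open>0\<close>: \<open>l n\<close> is \<open>\<lambda>\<^sub>n\<^sub>+\<^sub>1\<close>.\<close>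

definition eigenvalue_sequence :: "('h::real_inner \<times> 'h) set \<Rightarrow> (nat \<Rightarrow> real) \<Rightarrow> bool" where
  "eigenvalue_sequence A l \<longleftrightarrow>
     mono l \<and> filterlim l at_top sequentially \<and>
     (\<forall>t. \<exists>B. finite B \<and> independent B \<and> span B = eigenspace A t \<and> card B = card {n. l n = t})"

definition spectral_gap :: "('h::real_inner \<times> 'h) set \<Rightarrow> real set \<Rightarrow> bool" where
  "spectral_gap A J \<longleftrightarrow>
     (\<exists>l n. eigenvalue_sequence A l \<and> l n < l (Suc n) \<and> J = {l n <..< l (Suc n)})"

definition weak_solution ::
    "('h::real_inner \<times> 'h) set \<Rightarrow> ('h \<Rightarrow> 'h \<Rightarrow> real) \<Rightarrow> real \<Rightarrow> 'h \<Rightarrow> bool" where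
  "weak_solution A I' r u \<longleftrightarrow>
     u \<in> form_domain A \<and>
     (\<forall>v \<in> form_domain A.
        op_app (sqrt_op A) u \<bullet> op_app (sqrt_op A) v = r * (u \<bullet> v) + I' u v)"

end

theory Submission
  imports Defs "HOL-Library.Diagonal_Subsequence"
begin

text \<open>
Fix one gap \<open>(\<alpha>, \<beta>)\<close> and write \<open>S = A\<^bsup>1/2\<^esup>\<close>, so that \<open>E\<close> is the domain of \<open>S\<close>.  Let \<open>V\<close> be the (finite-dimensional)
span of the eigenvectors with eigenvalue at most \<open>\<alpha>\<close> and \<open>W\<close> its orthogonal complement in \<open>E\<close>.
For a parameter \<open>\<rho>\<close>, solutions of \<open>A u = \<rho> u + I'(u)\<close> are the critical points of
\<open>energy \<rho> u = (\<parallel>S u\<parallel>\<^sup>2 - \<rho> \<parallel>u\<parallel>\<^sup>2) / 2 - I u\<close>.  This functional is strongly indefinite, but on every half-space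
\<open>{t w + v. t \<ge> 0, v \<in> V}\<close> with \<open>w \<in> W\<close> nonzero it has a maximum, called \<open>minimax \<rho> w\<close>, because \<open>I\<close> grows faster
than quadratically.  The norm constraint is built in by penalization: the pair \<open>(\<rho>, w)\<close> is chosen to minimize
\<open>minimax \<rho> w + \<mu>\<^sup>2 \<rho> / 2\<close> over \<open>\<alpha> \<le> \<rho> \<le> \<beta>\<close> and \<open>w \<in> W\<close>, \<open>w \<noteq> 0\<close>.

A minimizer exists because \<open>minimax\<close> is lower semicontinuous along weakly convergent directions, and
because a minimizing sequence of normalized directions cannot tend weakly to \<open>0\<close>: on such a sequence
\<open>I\<close> disappears while the quadratic part does not (\<open>minimax_lsc\<close>, \<open>penalized_minimum\<close>).

The minimizing \<open>\<rho>\<close> lies strictly inside the gap when \<open>\<mu>\<close> is small.  At \<open>\<rho> = \<beta>\<close> the penalized value is at least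
\<open>\<mu>\<^sup>2 \<beta> / 2\<close>, while an eigenvector for \<open>\<beta>\<close> and a slightly smaller \<open>\<rho>\<close> give less, since \<open>I\<close> dominates a small
multiple of \<open>\<parallel>u\<parallel>\<^sup>2\<close> once \<open>\<parallel>u\<parallel> \<ge> \<mu>\<close> (\<open>right_endpoint\<close>).  The least value of \<open>minimax \<alpha>\<close> is attained and decreases
strictly when \<open>\<alpha>\<close> is replaced by the midpoint of the gap, and for small \<open>\<mu>\<close> this drop outweighs the
change of the penalty (\<open>left_endpoint\<close>).

Let \<open>u\<close> be the maximizer that belongs to the minimizing pair.  The inequalities \<open>iv\<close> and \<open>iv_strict\<close> make it the only
maximizer on its half-space (\<open>maximizer_unique\<close>), so maximizers for nearby data converge to \<open>u\<close>
(\<open>maximizers_converge\<close>).  This yields the derivative of the minimum value along perturbations: varying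
\<open>\<rho>\<close>, in which the energy is affine with slope \<open>- \<parallel>u\<parallel>\<^sup>2 / 2\<close>, gives \<open>\<parallel>u\<parallel> = \<mu>\<close>
(\<open>stationary_in_parameter\<close>); varying \<open>w\<close> gives that the derivative of the energy at \<open>u\<close> vanishes on \<open>W\<close>
(\<open>stationary_in_direction\<close>).  It vanishes on \<open>V\<close> because \<open>u\<close> is a maximizer, so \<open>u\<close> is a solution.

Several gaps are treated separately, with the smallest of the bounds on \<open>\<mu>\<close>; disjointness makes the
parameters different.

The preparation translates the operator language.  By the spectral theorem for a compact symmetric
resolvent, \<open>A\<close> is diagonal in an orthonormal basis that follows the given eigenvalue sequence
(\<open>eigenbasis_exists\<close>), and its square root is the diagonal operator with entries \<open>sqrt (l j)\<close>
(\<open>sqrt_diagonal_op\<close>).  Since the entries tend to infinity, \<open>E\<close> embeds compactly in \<open>H\<close>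
(\<open>compact_embedding_diagonal_op\<close>).
\<close>

section \<open>Orthonormal bases\<close>

locale hilbert_basis =
  fixes e :: "nat \<Rightarrow> 'h::{real_inner, complete_space}"
  assumes orthonormal: "\<And>i j. e i \<bullet> e j = (if i = j then 1 else 0)"
    and total: "\<And>u. (\<And>j. u \<bullet> e j = 0) \<Longrightarrow> u = 0"
begin

lemma basis_ext: "(\<And>j. u \<bullet> e j = v \<bullet> e j) \<Longrightarrow> u = v"
  using total[of "u - v"] by (simp add: inner_diff_left)

lemma inner_partial_sum:
  "finite F \<Longrightarrow> (\<Sum>j\<in>F. a j *\<^sub>R e j) \<bullet> e k = (if k \<in> F then a k else 0)"
  by (simp add: inner_sum_left orthonormal if_distrib cong: if_cong)

lemma inner_partial_sums:
  assumes "finite F"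
  shows "(\<Sum>j\<in>F. a j *\<^sub>R e j) \<bullet> (\<Sum>j\<in>F. b j *\<^sub>R e j) = (\<Sum>j\<in>F. a j * b j)"
  unfolding inner_sum_right[of _ "\<lambda>j. b j *\<^sub>R e j"] inner_scaleR_right inner_partial_sum[OF assms]
  by (intro sum.cong) (auto simp: mult.commute)

lemma norm_partial_sum: "finite F \<Longrightarrow> (norm (\<Sum>j\<in>F. a j *\<^sub>R e j))\<^sup>2 = (\<Sum>j\<in>F. (a j)\<^sup>2)"
  unfolding power2_norm_eq_inner inner_partial_sums by (simp add: power2_eq_square)

text \<open>The Riesz-Fischer theorem: the partial sums are a Cauchy sequence because the square of the norm of a
  block is a block of the series of squares.\<close>

lemma vector_with_coefficients:
  assumes "summable (\<lambda>j. (a j)\<^sup>2)"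
  obtains u where "\<forall>j. u \<bullet> e j = a j" "(\<lambda>n. \<Sum>j<n. a j *\<^sub>R e j) \<longlonglongrightarrow> u"
proof -
  define s where "s n = (\<Sum>j<n. a j *\<^sub>R e j)" for n
  have diff: "(norm (s m - s n))\<^sup>2 = (\<Sum>j\<in>{n..<m}. (a j)\<^sup>2)" if "n \<le> m" for m n
  proof -
    have "s m - s n = (\<Sum>j\<in>{n..<m}. a j *\<^sub>R e j)"
      using that by (simp add: s_def lessThan_atLeast0 sum_diff_nat_ivl)
    then show ?thesis by (simp add: norm_partial_sum)
  qed
  have "Cauchy s"
  proof (rule metric_CauchyI)
    fix \<epsilon> :: real assume \<epsilon>: "0 < \<epsilon>"
    then obtain N where N: "\<And>m n. N \<le> m \<Longrightarrow> norm (\<Sum>j\<in>{m..<n}. (a j)\<^sup>2) < \<epsilon>\<^sup>2"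
      using assms unfolding summable_Cauchy by (meson zero_less_power)
    have *: "dist (s m) (s n) < \<epsilon>" if "N \<le> n" "n \<le> m" for m n
    proof -
      have "(norm (s m - s n))\<^sup>2 < \<epsilon>\<^sup>2"
        using N[OF that(1), of m] diff[OF that(2)] by (metis abs_of_nonneg real_norm_def zero_le_power2)
      then show ?thesis using \<epsilon> by (simp add: dist_norm power2_less_imp_less)
    qed
    have "dist (s m) (s n) < \<epsilon>" if "N \<le> m" "N \<le> n" for m n
      using *[of n m] *[of m n] that by (metis dist_commute nle_le)
    then show "\<exists>M. \<forall>m\<ge>M. \<forall>n\<ge>M. dist (s m) (s n) < \<epsilon>" by blast
  qed
  then obtain u where u: "s \<longlonglongrightarrow> u" by (auto simp: Cauchy_convergent_iff convergent_def)
  have "u \<bullet> e j = a j" for j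
  proof -
    have "(\<lambda>n. s n \<bullet> e j) \<longlonglongrightarrow> u \<bullet> e j" by (intro tendsto_intros u)
    moreover have "(\<lambda>n. s n \<bullet> e j) \<longlonglongrightarrow> a j"
      by (rule tendsto_eventually, rule eventually_sequentiallyI[of "Suc j"])
        (simp add: s_def inner_partial_sum)
    ultimately show ?thesis by (rule LIMSEQ_unique)
  qed
  then have "\<forall>j. u \<bullet> e j = a j" by blast
  then show ?thesis
    by (rule that) (use u in \<open>simp add: s_def[abs_def]\<close>)
qed

lemma vector_with_coefficients_exists: "summable (\<lambda>j. (a j)\<^sup>2) \<Longrightarrow> \<exists>u. \<forall>j. u \<bullet> e j = a j"
  by (rule vector_with_coefficients[of a]) blast+

lemma bessel:
  assumes "finite F"
  shows "(\<Sum>j\<in>F. (u \<bullet> e j)\<^sup>2) \<le> (norm u)\<^sup>2"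
proof -
  define p where "p = (\<Sum>j\<in>F. (u \<bullet> e j) *\<^sub>R e j)"
  have pp: "p \<bullet> p = (\<Sum>j\<in>F. (u \<bullet> e j)\<^sup>2)"
    using norm_partial_sum[OF assms, of "\<lambda>j. u \<bullet> e j"] by (simp add: p_def power2_norm_eq_inner)
  moreover have up: "u \<bullet> p = (\<Sum>j\<in>F. (u \<bullet> e j)\<^sup>2)"
    by (simp add: p_def inner_sum_right power2_eq_square)
  moreover have "0 \<le> (u - p) \<bullet> (u - p)" by simp
  ultimately show ?thesis
    by (simp add: power2_norm_eq_inner inner_diff_left inner_diff_right inner_commute[of p u])
qed

lemma coefficients_summable: "summable (\<lambda>j. (u \<bullet> e j)\<^sup>2)"
  by (rule summableI_nonneg_bounded[of _ "(norm u)\<^sup>2"]) (simp_all add: bessel)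

lemma expansion: "(\<lambda>n. \<Sum>j<n. (u \<bullet> e j) *\<^sub>R e j) \<longlonglongrightarrow> u"
proof -
  obtain w where w: "\<forall>j. w \<bullet> e j = u \<bullet> e j" "(\<lambda>n. \<Sum>j<n. (u \<bullet> e j) *\<^sub>R e j) \<longlonglongrightarrow> w"
    by (rule vector_with_coefficients[OF coefficients_summable[of u]])
  then show ?thesis using basis_ext[of w u] by simp
qed

lemma parseval: "(\<lambda>j. (u \<bullet> e j) * (v \<bullet> e j)) sums (u \<bullet> v)"
proof -
  have "(\<lambda>n. (\<Sum>j<n. (u \<bullet> e j) *\<^sub>R e j) \<bullet> (\<Sum>j<n. (v \<bullet> e j) *\<^sub>R e j)) \<longlonglongrightarrow> u \<bullet> v"
    by (intro tendsto_inner expansion)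
  then show ?thesis by (simp add: sums_def inner_partial_sums)
qed

lemma inner_eq_zeroI:
  assumes "\<And>j. (u \<bullet> e j) * (v \<bullet> e j) = 0"
  shows "u \<bullet> v = 0"
proof -
  have "(\<lambda>j. 0) sums (u \<bullet> v)" using parseval[of u v] by (simp only: assms)
  then show ?thesis by (rule sums_unique2[OF _ sums_zero])
qed

lemma parseval_norm: "(\<lambda>j. (u \<bullet> e j)\<^sup>2) sums (norm u)\<^sup>2"
  using parseval[of u u] by (simp add: power2_eq_square power2_norm_eq_inner[symmetric])

text \<open>A diagonal subsequence makes every coefficient converge.  Bessel's inequality passes to the limit, so the
  limits are the coefficients of a vector \<open>u\<close>; convergence against a general \<open>v\<close> follows by approximating \<open>v\<close>
  with its partial sums, as \<open>x k - u\<close> stays bounded.\<close>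

lemma weakly_convergent_subsequence:
  fixes x :: "nat \<Rightarrow> 'h"
  assumes bounded: "\<And>k. norm (x k) \<le> C"
  obtains r u where "strict_mono (r :: nat \<Rightarrow> nat)" "\<And>v. (\<lambda>k. x (r k) \<bullet> v) \<longlonglongrightarrow> u \<bullet> v"
proof -
  have C: "0 \<le> C" using bounded[of 0] norm_ge_zero order_trans by blast
  define P where "P j s \<longleftrightarrow> convergent (\<lambda>k. x (s k) \<bullet> e j)" for j and s :: "nat \<Rightarrow> nat"
  have ne: "norm (e j) = 1" for j by (simp add: norm_eq_sqrt_inner orthonormal)
  interpret subseqs P
  proof
    fix j and s :: "nat \<Rightarrow> nat"
    have "norm (x (s k) \<bullet> e j) \<le> C" for k
      using Cauchy_Schwarz_ineq2[of "x (s k)" "e j"] bounded[of "s k"] by (simp add: ne)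
    then have "bounded (range (\<lambda>k. x (s k) \<bullet> e j))" by (auto intro!: boundedI)
    then obtain l r where "strict_mono (r :: nat \<Rightarrow> nat)" "((\<lambda>k. x (s k) \<bullet> e j) \<circ> r) \<longlonglongrightarrow> l"
      using bounded_imp_convergent_subsequence by blast
    then show "\<exists>r'. strict_mono r' \<and> P j (s \<circ> r')"
      by (auto simp: P_def convergent_def comp_def)
  qed
  define r where "r = diagseq"
  have r: "strict_mono r" by (simp add: r_def subseq_diagseq)
  have holds: "P j (diagseq \<circ> (+) (Suc j))" for j
  proof (rule diagseq_holds)
    fix r s :: "nat \<Rightarrow> nat" and n assume "strict_mono r" "P n s"
    then show "P n (s \<circ> r)"
      using LIMSEQ_subseq_LIMSEQ[of "\<lambda>k. x (s k) \<bullet> e n" _ r] by (auto simp: P_def comp_def convergent_def)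
  qed
  have "convergent (\<lambda>k. x (r (k + Suc j)) \<bullet> e j)" for j
    using holds[of j] by (simp add: P_def r_def comp_def add.commute)
  then have "convergent (\<lambda>k. x (r k) \<bullet> e j)" for j
    using convergent_ignore_initial_segment[of "\<lambda>k. x (r k) \<bullet> e j" "Suc j"] by blast
  then obtain a where a: "\<And>j. (\<lambda>k. x (r k) \<bullet> e j) \<longlonglongrightarrow> a j" unfolding convergent_def by metis
  have "summable (\<lambda>j. (a j)\<^sup>2)"
  proof (rule summableI_nonneg_bounded)
    fix n
    have "(\<lambda>k. \<Sum>j<n. (x (r k) \<bullet> e j)\<^sup>2) \<longlonglongrightarrow> (\<Sum>j<n. (a j)\<^sup>2)"
      by (intro tendsto_intros a)
    moreover have "(\<Sum>j<n. (x (r k) \<bullet> e j)\<^sup>2) \<le> C\<^sup>2" for k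
      using bessel[of "{..<n}" "x (r k)"] power_mono[OF bounded[of "r k"], of 2] by simp
    ultimately show "(\<Sum>j<n. (a j)\<^sup>2) \<le> C\<^sup>2" by (intro LIMSEQ_le_const2) auto
  qed simp
  then obtain u where u: "\<And>j. u \<bullet> e j = a j" using vector_with_coefficients_exists by metis
  have "(\<lambda>k. x (r k) \<bullet> v) \<longlonglongrightarrow> u \<bullet> v" for v
  proof (rule metric_LIMSEQ_I)
    fix \<epsilon> :: real assume \<epsilon>: "0 < \<epsilon>"
    define D where "D = C + norm u + 1"
    have D: "0 < D" using C by (simp add: D_def add_nonneg_pos)
    define vn where "vn n = (\<Sum>j<n. (v \<bullet> e j) *\<^sub>R e j)" for n
    have "vn \<longlonglongrightarrow> v" unfolding vn_def[abs_def] by (rule expansion)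
    then obtain n where n: "norm (vn n - v) < \<epsilon> / (2 * D)"
      using LIMSEQ_D[of vn v "\<epsilon> / (2 * D)"] \<epsilon> D by (metis divide_pos_pos mult_pos_pos order_refl zero_less_numeral)
    have "(\<lambda>k. x (r k) \<bullet> vn n) \<longlonglongrightarrow> u \<bullet> vn n"
      unfolding vn_def inner_sum_right inner_scaleR_right u by (intro tendsto_intros a)
    then obtain N where N: "\<And>k. N \<le> k \<Longrightarrow> norm (x (r k) \<bullet> vn n - u \<bullet> vn n) < \<epsilon> / 2"
      using LIMSEQ_D \<epsilon> by (metis half_gt_zero)
    have "dist (x (r k) \<bullet> v) (u \<bullet> v) < \<epsilon>" if "N \<le> k" for k
    proof -
      have "norm (x (r k) - u) \<le> D"
        using norm_triangle_ineq4[of "x (r k)" u] bounded[of "r k"] by (simp add: D_def)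
      then have "norm (x (r k) - u) * norm (vn n - v) \<le> D * norm (vn n - v)" by (intro mult_right_mono) auto
      also have "\<dots> < \<epsilon> / 2" using n D by (simp add: field_simps)
      finally have "\<bar>(x (r k) - u) \<bullet> (vn n - v)\<bar> < \<epsilon> / 2"
        using Cauchy_Schwarz_ineq2[of "x (r k) - u" "vn n - v"] by linarith
      moreover have "(x (r k) - u) \<bullet> (vn n - v) = (x (r k) \<bullet> vn n - u \<bullet> vn n) - (x (r k) \<bullet> v - u \<bullet> v)"
        by (simp add: inner_diff_left inner_diff_right)
      ultimately show ?thesis using N[OF that] unfolding dist_real_def real_norm_def by linarith
    qed
    then show "\<exists>N. \<forall>k\<ge>N. dist (x (r k) \<bullet> v) (u \<bullet> v) < \<epsilon>" by blast
  qed
  then show ?thesis using that r by blast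
qed

end

section \<open>Diagonal operators, their square roots and their form domains\<close>

context hilbert_basis
begin

text \<open>The maximal operator that multiplies the coefficient number \<open>j\<close> by \<open>m j\<close>: its domain is every \<open>u\<close> for which the
  products are square summable, since only then is there a \<open>y\<close>.\<close>

definition diagonal_op :: "(nat \<Rightarrow> real) \<Rightarrow> ('h \<times> 'h) set" where
  "diagonal_op m = {(u, y). \<forall>j. y \<bullet> e j = m j * (u \<bullet> e j)}"

lemma basis_in_diagonal_op: "(e j, m j *\<^sub>R e j) \<in> diagonal_op m"
  by (simp add: diagonal_op_def orthonormal)

lemma diagonal_op_symmetric:
  assumes "(u, y) \<in> diagonal_op m" "(v, w) \<in> diagonal_op m"
  shows "y \<bullet> v = u \<bullet> w"
proof -
  have "(y \<bullet> e j) * (v \<bullet> e j) = (u \<bullet> e j) * (w \<bullet> e j)" for j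
    using assms by (simp add: diagonal_op_def)
  then show ?thesis using parseval[of y v] parseval[of u w] sums_unique2 by simp
qed

lemma linear_diagonal_op: "linear_operator (diagonal_op m)"
proof -
  have "subspace (diagonal_op m)"
    by (auto simp: subspace_def diagonal_op_def inner_add_left algebra_simps zero_prod_def)
  moreover have "single_valued (diagonal_op m)"
    by (auto simp: single_valued_def diagonal_op_def intro: basis_ext)
  ultimately show ?thesis by (simp add: linear_operator_def)
qed

lemma self_adjoint_diagonal_op: "self_adjoint_op (diagonal_op m)"
proof -
  have "u \<in> closure (Domain (diagonal_op m))" for u
  proof -
    define s where "s n = (\<Sum>j<n. (u \<bullet> e j) *\<^sub>R e j)" for n
    have "(s n, \<Sum>j<n. (m j * (u \<bullet> e j)) *\<^sub>R e j) \<in> diagonal_op m" for n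
      by (simp add: diagonal_op_def s_def inner_partial_sum)
    then have "s n \<in> Domain (diagonal_op m)" for n by blast
    moreover have "s \<longlonglongrightarrow> u" unfolding s_def[abs_def] by (rule expansion)
    ultimately show ?thesis unfolding closure_sequential by blast
  qed
  moreover have "adjoint_op (diagonal_op m) = diagonal_op m"
  proof
    show "adjoint_op (diagonal_op m) \<subseteq> diagonal_op m"
    proof (rule subrelI)
      fix v w assume "(v, w) \<in> adjoint_op (diagonal_op m)"
      then have "\<forall>(u, y)\<in>diagonal_op m. y \<bullet> v = u \<bullet> w" by (simp add: adjoint_op_def)
      then have "(m j *\<^sub>R e j) \<bullet> v = e j \<bullet> w" for j using basis_in_diagonal_op[of j m] by blast
      then show "(v, w) \<in> diagonal_op m" by (simp add: diagonal_op_def inner_commute)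
    qed
    show "diagonal_op m \<subseteq> adjoint_op (diagonal_op m)"
      by (auto simp: adjoint_op_def intro: diagonal_op_symmetric)
  qed
  ultimately show ?thesis by (auto simp: self_adjoint_op_def linear_diagonal_op)
qed

lemma nonneg_diagonal_op:
  assumes "\<And>j. 0 \<le> m j"
  shows "nonneg_op (diagonal_op m)"
proof -
  have "0 \<le> y \<bullet> u" if "(u, y) \<in> diagonal_op m" for u y
  proof -
    have "(y \<bullet> e j) * (u \<bullet> e j) = m j * (u \<bullet> e j)\<^sup>2" for j
      using that by (simp add: diagonal_op_def power2_eq_square)
    then have sums: "(\<lambda>j. m j * (u \<bullet> e j)\<^sup>2) sums (y \<bullet> u)" using parseval[of y u] by simp
    have "0 \<le> (\<Sum>j. m j * (u \<bullet> e j)\<^sup>2)"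
      by (rule suminf_nonneg[OF sums_summable[OF sums]]) (simp add: assms)
    then show ?thesis using sums_unique[OF sums] by simp
  qed
  then show ?thesis by (auto simp: nonneg_op_def)
qed

text \<open>The inclusion from right to left is a statement about domains: with coefficients \<open>u\<^sub>j\<close>
  of \<open>u\<close>, if \<open>(m j)\<^sup>2 u\<^sub>j\<close> is square summable, then so is \<open>m j u\<^sub>j\<close>, because its square is the product of the two
  square summable sequences \<open>(m j)\<^sup>2 u\<^sub>j\<close> and \<open>u\<^sub>j\<close>.\<close>

lemma diagonal_op_square: "diagonal_op m O diagonal_op m = diagonal_op (\<lambda>j. (m j)\<^sup>2)"
proof
  show "diagonal_op m O diagonal_op m \<subseteq> diagonal_op (\<lambda>j. (m j)\<^sup>2)"
    by (auto simp: diagonal_op_def power2_eq_square)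
  show "diagonal_op (\<lambda>j. (m j)\<^sup>2) \<subseteq> diagonal_op m O diagonal_op m"
  proof clarify
    fix u z assume uz: "(u, z) \<in> diagonal_op (\<lambda>j. (m j)\<^sup>2)"
    then have "(z \<bullet> e j) * (u \<bullet> e j) = (m j * (u \<bullet> e j))\<^sup>2" for j
      by (simp add: diagonal_op_def power2_eq_square)
    then have "summable (\<lambda>j. (m j * (u \<bullet> e j))\<^sup>2)" using sums_summable[OF parseval[of z u]] by simp
    then obtain y where y: "\<And>j. y \<bullet> e j = m j * (u \<bullet> e j)" using vector_with_coefficients_exists by metis
    have "(u, y) \<in> diagonal_op m" using y by (simp add: diagonal_op_def)
    moreover have "(y, z) \<in> diagonal_op m" using y uz by (simp add: diagonal_op_def power2_eq_square)
    ultimately show "(u, z) \<in> diagonal_op m O diagonal_op m" by blast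
  qed
qed

text \<open>Symmetry against the eigenvectors puts \<open>B\<close> inside the diagonal operator.  Both are self-adjoint and taking
  adjoints reverses inclusions, so they agree.\<close>

lemma self_adjoint_eq_diagonal_op:
  assumes B: "self_adjoint_op B" and eig: "\<And>j. (e j, m j *\<^sub>R e j) \<in> B"
  shows "B = diagonal_op m"
proof
  have adj: "adjoint_op B = B" using B by (simp add: self_adjoint_op_def)
  show sub: "B \<subseteq> diagonal_op m"
  proof (clarify, unfold diagonal_op_def, clarify)
    fix u y j assume uy: "(u, y) \<in> B"
    have "(e j, m j *\<^sub>R e j) \<in> adjoint_op B" using adj eig by simp
    then have "y \<bullet> e j = u \<bullet> (m j *\<^sub>R e j)" using uy by (auto simp: adjoint_op_def)
    then show "y \<bullet> e j = m j * (u \<bullet> e j)" by simp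
  qed
  have "diagonal_op m \<subseteq> adjoint_op B"
    using sub diagonal_op_symmetric unfolding adjoint_op_def by blast
  then show "diagonal_op m \<subseteq> B" using adj by simp
qed

text \<open>With \<open>y = S f\<close> and \<open>g = y - sqrt t f\<close>, the factorization \<open>S\<^sup>2 - t = (S + sqrt t) (S - sqrt t)\<close> gives
  \<open>S g = - sqrt t g\<close>, which nonnegativity of \<open>S\<close> allows only for \<open>g = 0\<close>.  If \<open>t = 0\<close>, then
  \<open>\<parallel>S f\<parallel>\<^sup>2 = \<langle>f, S\<^sup>2 f\<rangle> = 0\<close>.\<close>

lemma square_root_eigenvector:
  assumes S: "self_adjoint_op S" "nonneg_op S" and SS: "(f, t *\<^sub>R f) \<in> S O S" and t: "0 \<le> t"
  shows "(f, sqrt t *\<^sub>R f) \<in> S"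
proof -
  have sub: "subspace S" and adj: "adjoint_op S = S"
    using S by (auto simp: self_adjoint_op_def linear_operator_def)
  obtain y where y: "(f, y) \<in> S" "(y, t *\<^sub>R f) \<in> S" using SS by blast
  have "y = sqrt t *\<^sub>R f"
  proof (cases "t = 0")
    case True
    have "(y, 0) \<in> adjoint_op S" using y True adj by simp
    then have "y \<bullet> y = f \<bullet> 0" using y(1) unfolding adjoint_op_def by blast
    then show ?thesis using True by simp
  next
    case False
    define g where "g = y - sqrt t *\<^sub>R f"
    have "(y, t *\<^sub>R f) - sqrt t *\<^sub>R (f, y) \<in> S" using sub y by (intro subspace_diff subspace_scale)
    moreover have "(y, t *\<^sub>R f) - sqrt t *\<^sub>R (f, y) = (g, - sqrt t *\<^sub>R g)"
      using t by (simp add: g_def algebra_simps)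
    ultimately have "0 \<le> (- sqrt t *\<^sub>R g) \<bullet> g" using S(2) by (auto simp: nonneg_op_def)
    then have "sqrt t * (g \<bullet> g) \<le> 0" by simp
    moreover have "0 < sqrt t" using False t by simp
    ultimately have "g \<bullet> g \<le> 0" by (simp add: mult_le_0_iff)
    then have "g = 0" by (metis inner_ge_zero inner_eq_zero_iff order_antisym)
    then show ?thesis by (simp add: g_def)
  qed
  then show ?thesis using y by simp
qed

text \<open>The root is unique because every nonnegative self-adjoint root has the basis vectors as eigenvectors, and
  these determine it.\<close>

lemma sqrt_diagonal_op:
  assumes "\<And>j. 0 \<le> l j"
  shows "sqrt_op (diagonal_op l) = diagonal_op (\<lambda>j. sqrt (l j))"
  unfolding sqrt_op_def
proof (rule the_equality)
  show "self_adjoint_op (diagonal_op (\<lambda>j. sqrt (l j))) \<and> nonneg_op (diagonal_op (\<lambda>j. sqrt (l j))) \<and>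
    diagonal_op (\<lambda>j. sqrt (l j)) O diagonal_op (\<lambda>j. sqrt (l j)) = diagonal_op l"
    using assms by (simp add: self_adjoint_diagonal_op nonneg_diagonal_op diagonal_op_square)
  fix S assume S: "self_adjoint_op S \<and> nonneg_op S \<and> S O S = diagonal_op l"
  then show "S = diagonal_op (\<lambda>j. sqrt (l j))"
    using assms basis_in_diagonal_op by (intro self_adjoint_eq_diagonal_op square_root_eigenvector) auto
qed

lemma op_app_diagonal_op: "(u, y) \<in> diagonal_op m \<Longrightarrow> op_app (diagonal_op m) u = y"
  unfolding op_app_def using linear_diagonal_op[of m]
  by (intro the_equality) (auto simp: linear_operator_def dest: single_valuedD)

lemma op_app_coefficient:
  "u \<in> Domain (diagonal_op m) \<Longrightarrow> op_app (diagonal_op m) u \<bullet> e j = m j * (u \<bullet> e j)"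
  using op_app_diagonal_op[of u _ m] by (auto simp: diagonal_op_def)

lemma subspace_Domain: "subspace (Domain (diagonal_op m))"
proof -
  have sub: "subspace (diagonal_op m)" using linear_diagonal_op by (simp add: linear_operator_def)
  show ?thesis
  proof (rule subspaceI)
    show "0 \<in> Domain (diagonal_op m)" using subspace_0[OF sub] by (auto simp: zero_prod_def)
    show "u + v \<in> Domain (diagonal_op m)" if uv: "u \<in> Domain (diagonal_op m)" "v \<in> Domain (diagonal_op m)" for u v
    proof -
      obtain y z where "(u, y) \<in> diagonal_op m" "(v, z) \<in> diagonal_op m" using uv by blast
      then show ?thesis using subspace_add[OF sub] by fastforce
    qed
    show "c *\<^sub>R u \<in> Domain (diagonal_op m)" if u: "u \<in> Domain (diagonal_op m)" for c u
    proof -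
      obtain y where "(u, y) \<in> diagonal_op m" using u by blast
      then show ?thesis using subspace_scale[OF sub, of "(u, y)" c] by auto
    qed
  qed
qed

lemma op_app_add:
  assumes "u \<in> Domain (diagonal_op m)" "v \<in> Domain (diagonal_op m)"
  shows "op_app (diagonal_op m) (u + v) = op_app (diagonal_op m) u + op_app (diagonal_op m) v"
  using assms subspace_add[OF subspace_Domain assms]
  by (intro basis_ext) (simp add: op_app_coefficient inner_add_left algebra_simps)

lemma op_app_scale:
  assumes "u \<in> Domain (diagonal_op m)"
  shows "op_app (diagonal_op m) (c *\<^sub>R u) = c *\<^sub>R op_app (diagonal_op m) u"
  using assms subspace_scale[OF subspace_Domain assms]
  by (intro basis_ext) (simp add: op_app_coefficient algebra_simps)

lemma op_app_norm_sums:
  "u \<in> Domain (diagonal_op m) \<Longrightarrow> (\<lambda>j. (m j)\<^sup>2 * (u \<bullet> e j)\<^sup>2) sums (norm (op_app (diagonal_op m) u))\<^sup>2"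
  using parseval_norm[of "op_app (diagonal_op m) u"] by (simp add: op_app_coefficient power_mult_distrib)

lemma finite_support_in_Domain:
  assumes "\<And>j. N \<le> j \<Longrightarrow> u \<bullet> e j = 0"
  shows "u \<in> Domain (diagonal_op m)"
proof -
  have "(u, \<Sum>j<N. (m j * (u \<bullet> e j)) *\<^sub>R e j) \<in> diagonal_op m"
    using assms by (auto simp: diagonal_op_def inner_partial_sum not_less)
  then show ?thesis by blast
qed

text \<open>Large entries of \<open>m\<close> control the tail of \<open>u\<close>; this is what makes the embedding of the domain compact.\<close>

lemma norm_le_head_plus_tail:
  assumes u: "u \<in> Domain (diagonal_op m)" and K: "0 < K" "\<And>j. N \<le> j \<Longrightarrow> K \<le> m j"
  shows "(norm u)\<^sup>2 \<le> (\<Sum>j<N. (u \<bullet> e j)\<^sup>2) + (norm (op_app (diagonal_op m) u))\<^sup>2 / K\<^sup>2"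
proof (rule sums_le[OF _ parseval_norm sums_add[OF sums_If_finite_set sums_divide[OF op_app_norm_sums[OF u]]]])
  show "(u \<bullet> e j)\<^sup>2 \<le> (if j \<in> {..<N} then (u \<bullet> e j)\<^sup>2 else 0) + (m j)\<^sup>2 * (u \<bullet> e j)\<^sup>2 / K\<^sup>2" for j
  proof (cases "j < N")
    case False
    then have "K\<^sup>2 \<le> (m j)\<^sup>2" using K by (intro power_mono) auto
    then have "K\<^sup>2 * (u \<bullet> e j)\<^sup>2 \<le> (m j)\<^sup>2 * (u \<bullet> e j)\<^sup>2" by (intro mult_right_mono) auto
    then show ?thesis using K False by (simp add: pos_le_divide_eq mult.commute)
  qed simp
qed simp

text \<open>Weak limits \<open>x\<close> of \<open>u\<close> and \<open>y\<close> of its image have matching coefficients, so \<open>x\<close> is in the domain with image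
  \<open>y\<close>.  The convergence of \<open>u\<close> is strong, because finitely many coefficients converge and the tails are uniformly small.\<close>

lemma compact_embedding_diagonal_op:
  fixes u :: "nat \<Rightarrow> 'h"
  assumes m: "filterlim m at_top sequentially"
    and u: "\<And>k. u k \<in> Domain (diagonal_op m)" "\<And>k. norm (u k) \<le> C"
      "\<And>k. norm (op_app (diagonal_op m) (u k)) \<le> C"
  shows "\<exists>r x. strict_mono (r :: nat \<Rightarrow> nat) \<and> x \<in> Domain (diagonal_op m) \<and> (u \<circ> r) \<longlonglongrightarrow> x \<and>
    (\<forall>v. (\<lambda>k. op_app (diagonal_op m) (u (r k)) \<bullet> v) \<longlonglongrightarrow> op_app (diagonal_op m) x \<bullet> v)"
proof -
  define S where "S = op_app (diagonal_op m)"
  obtain r1 x where r1: "strict_mono (r1 :: nat \<Rightarrow> nat)" "\<forall>v. (\<lambda>k. u (r1 k) \<bullet> v) \<longlonglongrightarrow> x \<bullet> v"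
    using weakly_convergent_subsequence[of u C] u(2) by metis
  have "norm (S (u (r1 k))) \<le> C" for k using u(3) by (simp add: S_def)
  then obtain r2 y where r2: "strict_mono (r2 :: nat \<Rightarrow> nat)" "\<forall>v. (\<lambda>k. S (u (r1 (r2 k))) \<bullet> v) \<longlonglongrightarrow> y \<bullet> v"
    using weakly_convergent_subsequence[of "\<lambda>k. S (u (r1 k))" C] by metis
  define r where "r = r1 \<circ> r2"
  have r: "strict_mono r" using r1 r2 by (simp add: r_def strict_mono_o)
  have ulim: "(\<lambda>k. u (r k) \<bullet> v) \<longlonglongrightarrow> x \<bullet> v" for v
    using LIMSEQ_subseq_LIMSEQ[OF r1(2)[rule_format] r2(1)] by (simp add: r_def comp_def)
  have Slim: "(\<lambda>k. S (u (r k)) \<bullet> v) \<longlonglongrightarrow> y \<bullet> v" for v using r2(2) by (simp add: r_def)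
  have "y \<bullet> e j = m j * (x \<bullet> e j)" for j
  proof (rule LIMSEQ_unique[OF Slim])
    show "(\<lambda>k. S (u (r k)) \<bullet> e j) \<longlonglongrightarrow> m j * (x \<bullet> e j)"
      unfolding S_def op_app_coefficient[OF u(1)] by (intro tendsto_intros ulim)
  qed
  then have xy: "(x, y) \<in> diagonal_op m" by (simp add: diagonal_op_def)
  then have x: "x \<in> Domain (diagonal_op m)" "S x = y" by (auto simp: S_def op_app_diagonal_op)
  define d where "d k = u (r k) - x" for k
  have dD: "d k \<in> Domain (diagonal_op m)" for k
    unfolding d_def using u x by (intro subspace_diff subspace_Domain)
  have Sd: "S (d k) = S (u (r k)) - S x" for k
    using op_app_add[OF dD x(1), of k] by (simp add: S_def d_def)
  define D where "D = C + norm y"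
  have SdD: "norm (S (d k)) \<le> D" for k
    using norm_triangle_ineq4[of "S (u (r k))" "S x"] u(3)[of "r k"] by (simp add: Sd x D_def S_def[symmetric])
  have "(\<lambda>k. (norm (d k))\<^sup>2) \<longlonglongrightarrow> 0"
  proof (rule LIMSEQ_I)
    fix \<epsilon> :: real assume \<epsilon>: "0 < \<epsilon>"
    \<comment> \<open>Chosen so that the tail bound \<open>D\<^sup>2 / K\<^sup>2\<close> is below \<open>\<epsilon> / 2\<close>.\<close>
    define K where "K = sqrt (2 * (D\<^sup>2 + 1) / \<epsilon>)"
    have K: "0 < K" using \<epsilon> by (simp add: K_def add_nonneg_pos)
    have "K\<^sup>2 = 2 * (D\<^sup>2 + 1) / \<epsilon>" using \<epsilon> by (simp add: K_def add_nonneg_nonneg)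
    then have "\<epsilon> * K\<^sup>2 = 2 * (D\<^sup>2 + 1)" using \<epsilon> by simp
    then have DK: "D\<^sup>2 / K\<^sup>2 < \<epsilon> / 2" using K by (simp add: pos_divide_less_eq)
    have "eventually (\<lambda>j. K \<le> m j) sequentially" using m by (simp add: filterlim_at_top)
    then obtain N where N: "\<And>j. N \<le> j \<Longrightarrow> K \<le> m j" by (auto simp: eventually_sequentially)
    have "(\<lambda>k. \<Sum>j<N. (u (r k) \<bullet> e j - x \<bullet> e j)\<^sup>2) \<longlonglongrightarrow> (\<Sum>j<N. (x \<bullet> e j - x \<bullet> e j)\<^sup>2)"
      by (intro tendsto_intros ulim)
    then have "(\<lambda>k. \<Sum>j<N. (d k \<bullet> e j)\<^sup>2) \<longlonglongrightarrow> 0" by (simp add: d_def inner_diff_left)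
    then obtain M where M: "\<And>k. M \<le> k \<Longrightarrow> norm ((\<Sum>j<N. (d k \<bullet> e j)\<^sup>2) - 0) < \<epsilon> / 2"
      using LIMSEQ_D \<epsilon> by (metis half_gt_zero)
    have "norm ((norm (d k))\<^sup>2 - 0) < \<epsilon>" if "M \<le> k" for k
    proof -
      have "(norm (S (d k)))\<^sup>2 / K\<^sup>2 \<le> D\<^sup>2 / K\<^sup>2"
        using SdD[of k] by (intro divide_right_mono power_mono) auto
      then have "(norm (d k))\<^sup>2 \<le> (\<Sum>j<N. (d k \<bullet> e j)\<^sup>2) + D\<^sup>2 / K\<^sup>2"
        using norm_le_head_plus_tail[OF dD K N, of N k] by (simp add: S_def)
      then show ?thesis using M[OF that] DK zero_le_power2[of "norm (d k)"]
        unfolding diff_zero real_norm_def by linarith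
    qed
    then show "\<exists>M. \<forall>k\<ge>M. norm ((norm (d k))\<^sup>2 - 0) < \<epsilon>" by blast
  qed
  then have "(\<lambda>k. sqrt ((norm (d k))\<^sup>2)) \<longlonglongrightarrow> sqrt 0" by (intro tendsto_real_sqrt)
  then have "(\<lambda>k. norm (u (r k) - x)) \<longlonglongrightarrow> 0" by (simp add: d_def)
  then have "(u \<circ> r) \<longlonglongrightarrow> x" by (simp add: comp_def tendsto_norm_zero_iff LIM_zero_iff)
  then show ?thesis using r x Slim by (auto simp: S_def intro!: exI[of _ r] exI[of _ x])
qed

end

section \<open>Eigenvector bases of self-adjoint operators with compact resolvent\<close>

lemma self_adjoint_symmetric:
  assumes "self_adjoint_op A" "(u, y) \<in> A" "(v, w) \<in> A"
  shows "y \<bullet> v = u \<bullet> w"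
proof -
  have "(v, w) \<in> adjoint_op A" using assms by (simp add: self_adjoint_op_def)
  then show ?thesis using assms(2) by (auto simp: adjoint_op_def)
qed

lemma eigenspaces_orthogonal:
  assumes "self_adjoint_op A" "u \<in> eigenspace A s" "v \<in> eigenspace A t" "s \<noteq> t"
  shows "u \<bullet> v = 0"
proof -
  have "(s *\<^sub>R u) \<bullet> v = u \<bullet> (t *\<^sub>R v)"
    using assms(2,3) by (intro self_adjoint_symmetric[OF assms(1)]) (auto simp: eigenspace_def)
  then show ?thesis using assms(4) by simp
qed

text \<open>Gram-Schmidt may produce \<open>0\<close>, which is removed before normalization; equality of the cardinalities then
  follows from independence.\<close>

lemma orthonormal_basis_of_span:
  fixes B :: "'a::real_inner set"
  assumes "finite B" "independent B"
  obtains C where "finite C" "card C = card B" "span C = span B" "pairwise orthogonal C" "\<And>x. x \<in> C \<Longrightarrow> norm x = 1"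
proof -
  obtain C0 where C0: "finite C0" "span C0 = span B" "pairwise orthogonal C0"
    using basis_orthogonal[OF assms(1)] by blast
  define C1 where "C1 = C0 - {0}"
  have C1: "finite C1" "span C1 = span B" "pairwise orthogonal C1" "0 \<notin> C1"
    using C0 by (auto simp: C1_def span_delete_0 intro: pairwise_subset)
  define C where "C = (\<lambda>x. x /\<^sub>R norm x) ` C1"
  have orth: "orthogonal (x /\<^sub>R norm x) (y /\<^sub>R norm y)" if "x \<in> C1" "y \<in> C1" "x \<noteq> y" for x y
    using C1(3) that by (simp add: pairwise_def orthogonal_clauses)
  have n1: "norm x = 1" if x: "x \<in> C" for x
  proof -
    obtain y where y: "y \<in> C1" "x = y /\<^sub>R norm y" using x by (auto simp: C_def)
    then have "y \<noteq> 0" using C1(4) by auto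
    then show ?thesis using y by simp
  qed
  have pw: "pairwise orthogonal C"
    unfolding C_def pairwise_def using orth by blast
  have "span C = span C1"
    unfolding C_def by (rule span_image_scale) (use C1 in auto)
  then have sp: "span C = span B" using C1 by simp
  have "0 \<notin> C" using n1 by fastforce
  then have ind: "independent C" using pw by (intro pairwise_orthogonal_independent)
  have "card C = card B"
    using dim_eq_card[OF sp ind] dim_eq_card[OF refl assms(2)] by simp
  moreover have "finite C" using C1(1) by (simp add: C_def)
  ultimately show ?thesis using that[OF _ _ sp pw n1] by simp
qed

text \<open>Let \<open>M\<close> be the norm of \<open>R\<close> on \<open>X\<close> and \<open>x\<^sub>k\<close> unit vectors with \<open>\<parallel>R x\<^sub>k\<parallel> \<rightarrow> M\<close>.  Symmetry gives
  \<open>\<parallel>R\<^sup>2 x\<^sub>k - M\<^sup>2 x\<^sub>k\<parallel>\<^sup>2 \<le> M\<^sup>2 (M\<^sup>2 - \<parallel>R x\<^sub>k\<parallel>\<^sup>2) \<rightarrow> 0\<close>, so a limit \<open>y\<close> of \<open>R x\<^sub>k\<close>, nonzero because of its norm \<open>M\<close>,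
  satisfies \<open>R\<^sup>2 y = M\<^sup>2 y\<close>.  Then \<open>(R - M) (R + M) y = 0\<close>, and one of the two factors has a kernel in \<open>X\<close>.\<close>

lemma compact_symmetric_eigenvector:
  fixes R :: "'h::real_inner \<Rightarrow> 'h"
  assumes R: "compact_linear_map R" and sym: "\<And>x y. R x \<bullet> y = x \<bullet> R y"
    and X: "subspace X" "closed X" and inv: "\<And>x. x \<in> X \<Longrightarrow> R x \<in> X"
    and nz: "\<exists>x\<in>X. R x \<noteq> 0"
  obtains \<kappa> f where "\<kappa> \<noteq> 0" "f \<in> X" "f \<noteq> 0" "R f = \<kappa> *\<^sub>R f"
proof -
  have lin: "linear R" using R by (simp add: compact_linear_map_def)
  have cpt: "compact (closure (R ` cball 0 1))" using R by (simp add: compact_linear_map_def)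
  define K where "K = {norm (R x) | x. x \<in> X \<and> norm x = 1}"
  define M where "M = Sup K"
  have "bounded (R ` cball 0 1)" using cpt by (meson bounded_closure_image compact_imp_bounded bounded_subset closure_subset)
  then obtain b where "\<forall>y\<in>R ` cball 0 1. norm y \<le> b" unfolding bounded_iff by blast
  then have b: "norm (R x) \<le> b" if "norm x \<le> 1" for x using that by simp
  have bdd: "bdd_above K" by (rule bdd_aboveI[of _ b]) (auto simp: K_def b)
  have RM: "norm (R x) \<le> M * norm x" if "x \<in> X" for x
  proof (cases "x = 0")
    case False
    have "norm (R (sgn x)) \<le> M" unfolding M_def
      using that X False by (intro cSup_upper bdd) (auto simp: K_def norm_sgn sgn_div_norm subspace_scale intro!: exI[of _ "x /\<^sub>R norm x"])
    moreover have "norm (R (sgn x)) = norm (R x) / norm x"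
      by (simp add: sgn_div_norm linear_cmul[OF lin] divide_inverse mult.commute)
    ultimately show ?thesis using False by (simp add: pos_divide_le_eq)
  qed (simp add: linear_0[OF lin])
  obtain x0 where x0: "x0 \<in> X" "R x0 \<noteq> 0" using nz by blast
  then have "x0 \<noteq> 0" using linear_0[OF lin] by auto
  have M: "0 < M"
  proof -
    have "0 < norm (R x0)" using x0 by simp
    also have "\<dots> \<le> M * norm x0" using x0 by (intro RM)
    finally show ?thesis using \<open>x0 \<noteq> 0\<close> by (simp add: zero_less_mult_iff)
  qed
  have "norm (R (sgn x0)) \<in> K"
    unfolding K_def using x0 X \<open>x0 \<noteq> 0\<close> by (auto simp: norm_sgn sgn_div_norm subspace_scale intro!: exI[of _ "x0 /\<^sub>R norm x0"])
  then have ne: "K \<noteq> {}" by blast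
  have "\<exists>a\<in>K. M - 1 / Suc k < a" for k :: nat
    using less_cSup_iff[OF ne bdd, of "M - 1 / Suc k"] by (simp add: M_def)
  then have "\<forall>k::nat. \<exists>x. x \<in> X \<and> norm x = 1 \<and> M - 1 / Suc k < norm (R x)" unfolding K_def by blast
  then obtain x where x: "\<And>k::nat. x k \<in> X" "\<And>k. norm (x k) = 1" "\<And>k. M - 1 / Suc k < norm (R (x k))" by metis
  have "seq_compact (closure (R ` cball 0 1))" using cpt by (simp add: compact_eq_seq_compact_metric)
  moreover have "R (x k) \<in> closure (R ` cball 0 1)" for k
    using closure_subset[of "R ` cball 0 1"] x(2)[of k] by auto
  ultimately obtain y r where r: "strict_mono (r :: nat \<Rightarrow> nat)" "((\<lambda>k. R (x k)) \<circ> r) \<longlonglongrightarrow> y"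
    unfolding seq_compact_def by metis
  define z where "z k = R (x (r k))" for k
  have zlim: "z \<longlonglongrightarrow> y" using r(2) by (simp add: z_def[abs_def] comp_def)
  have zX: "z k \<in> X" for k using inv x by (simp add: z_def)
  have yX: "y \<in> X" using closed_sequentially[OF X(2) zX zlim] .
  have zM: "norm (z k) \<le> M" for k using RM[OF x(1), of "r k"] x(2) by (simp add: z_def)
  have nlim: "(\<lambda>k. norm (z k)) \<longlonglongrightarrow> M"
  proof (rule tendsto_sandwich)
    show "(\<lambda>k. M - 1 / real (Suc (r k))) \<longlonglongrightarrow> M"
      using tendsto_diff[OF tendsto_const LIMSEQ_subseq_LIMSEQ[OF LIMSEQ_Suc[OF lim_1_over_n] r(1)], of M]
      by (simp add: comp_def)
    show "\<forall>\<^sub>F k in sequentially. M - 1 / real (Suc (r k)) \<le> norm (z k)"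
      using x(3) by (auto simp: z_def less_imp_le)
    show "\<forall>\<^sub>F k in sequentially. norm (z k) \<le> M" using zM by simp
  qed simp
  then have "norm y = M" using LIMSEQ_unique[OF tendsto_norm[OF zlim]] by simp
  then have y0: "y \<noteq> 0" using M by auto
  have R_lim: "(\<lambda>k. R (w k)) \<longlonglongrightarrow> R w0" if "\<And>k. w k \<in> X" "w0 \<in> X" "w \<longlonglongrightarrow> w0" for w w0
  proof (rule LIM_zero_cancel, rule Lim_null_comparison)
    show "\<forall>\<^sub>F k in sequentially. norm (R (w k) - R w0) \<le> M * norm (w k - w0)"
      using that X RM by (simp add: linear_diff[OF lin, symmetric] subspace_diff)
    show "(\<lambda>k. M * norm (w k - w0)) \<longlonglongrightarrow> 0"
      by (intro tendsto_mult_right_zero tendsto_norm_zero LIM_zero that(3))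
  qed
  have "(\<lambda>k. M\<^sup>2 * (M\<^sup>2 - (norm (z k))\<^sup>2)) \<longlonglongrightarrow> M\<^sup>2 * (M\<^sup>2 - M\<^sup>2)" by (intro tendsto_intros nlim)
  then have "(\<lambda>k. sqrt (M\<^sup>2 * (M\<^sup>2 - (norm (z k))\<^sup>2))) \<longlonglongrightarrow> sqrt 0" by (intro tendsto_real_sqrt) simp
  then have slim: "(\<lambda>k. sqrt (M\<^sup>2 * (M\<^sup>2 - (norm (z k))\<^sup>2))) \<longlonglongrightarrow> 0" by simp
  have "norm (R (z k) - M\<^sup>2 *\<^sub>R x (r k)) \<le> sqrt (M\<^sup>2 * (M\<^sup>2 - (norm (z k))\<^sup>2))" for k
  proof (rule real_le_rsqrt)
    have "norm (R (z k)) \<le> M * norm (z k)" by (intro RM zX)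
    then have "(norm (R (z k)))\<^sup>2 \<le> M\<^sup>2 * (norm (z k))\<^sup>2" by (metis norm_ge_zero power_mono power_mult_distrib)
    moreover have "R (z k) \<bullet> x (r k) = (norm (z k))\<^sup>2"
      by (simp add: sym z_def power2_norm_eq_inner)
    moreover have "x (r k) \<bullet> x (r k) = 1" using x(2) by (simp add: power2_norm_eq_inner[symmetric])
    moreover have "(norm (R (z k) - M\<^sup>2 *\<^sub>R x (r k)))\<^sup>2 =
      (norm (R (z k)))\<^sup>2 - 2 * M\<^sup>2 * (R (z k) \<bullet> x (r k)) + M\<^sup>2 * (M\<^sup>2 * (x (r k) \<bullet> x (r k)))"
      by (simp add: power2_norm_eq_inner inner_diff_left inner_diff_right inner_commute)
    ultimately show "(norm (R (z k) - M\<^sup>2 *\<^sub>R x (r k)))\<^sup>2 \<le> M\<^sup>2 * (M\<^sup>2 - (norm (z k))\<^sup>2)"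
      by (simp add: algebra_simps)
  qed
  then have "(\<lambda>k. R (z k) - M\<^sup>2 *\<^sub>R x (r k)) \<longlonglongrightarrow> 0"
    by (intro Lim_null_comparison[OF _ slim]) simp
  then have "(\<lambda>k. R (z k) - (R (z k) - M\<^sup>2 *\<^sub>R x (r k))) \<longlonglongrightarrow> R y - 0"
    by (intro tendsto_diff R_lim zX yX zlim)
  then have "(\<lambda>k. M\<^sup>2 *\<^sub>R x (r k)) \<longlonglongrightarrow> R y" by simp
  then have "(\<lambda>k. R (M\<^sup>2 *\<^sub>R x (r k))) \<longlonglongrightarrow> R (R y)"
    using x X inv yX by (intro R_lim subspace_scale) auto
  moreover have "(\<lambda>k. R (M\<^sup>2 *\<^sub>R x (r k))) \<longlonglongrightarrow> M\<^sup>2 *\<^sub>R y"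
    unfolding linear_cmul[OF lin] z_def[symmetric] by (intro tendsto_intros zlim)
  ultimately have RRy: "R (R y) = M\<^sup>2 *\<^sub>R y" by (rule LIMSEQ_unique)
  show ?thesis
  proof (cases "R y + M *\<^sub>R y = 0")
    case True
    then have "R y = (- M) *\<^sub>R y" by (simp add: add_eq_0_iff2)
    then show ?thesis using that[of "- M" y] M yX y0 by simp
  next
    case False
    have "R (R y + M *\<^sub>R y) = M *\<^sub>R (R y + M *\<^sub>R y)"
      by (simp add: linear_add[OF lin] linear_cmul[OF lin] RRy power2_eq_square algebra_simps)
    then show ?thesis using that[of M "R y + M *\<^sub>R y"] M yX inv X False
      by (simp add: subspace_add subspace_scale)
  qed
qed

text \<open>Each eigenspace has an orthonormal basis indexed by the places where its eigenvalue occurs in \<open>l\<close>, and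
  different eigenspaces are orthogonal.  If the resulting sequence were not total, its orthogonal complement
  would be a nonzero closed subspace invariant under the resolvent \<open>R\<close>, so it would contain an eigenvector of \<open>R\<close>.  That is
  also an eigenvector of \<open>A\<close>, hence in the span of the sequence to which it is orthogonal.\<close>

lemma eigenbasis_exists:
  fixes A :: "('h::{real_inner, complete_space} \<times> 'h) set"
  assumes A: "self_adjoint_op A" and cpt: "compact_resolvent A" and l: "eigenvalue_sequence A l"
  obtains e where "hilbert_basis e" "\<And>j. (e j, l j *\<^sub>R e j) \<in> A"
proof -
  have lim: "filterlim l at_top sequentially" using l by (simp add: eigenvalue_sequence_def)
  have fin: "finite {n. l n = t}" for t
  proof -
    have "eventually (\<lambda>n. t < l n) sequentially" using lim by (simp add: filterlim_at_top_dense)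
    then obtain N where "\<And>n. N \<le> n \<Longrightarrow> t < l n" by (auto simp: eventually_sequentially)
    then have "{n. l n = t} \<subseteq> {..<N}" by (metis (mono_tags, lifting) lessThan_iff less_irrefl mem_Collect_eq not_le subsetI)
    then show ?thesis by (rule finite_subset) simp
  qed
  have "\<forall>t. \<exists>g. inj_on g {n. l n = t} \<and> pairwise orthogonal (g ` {n. l n = t}) \<and>
     (\<forall>n. l n = t \<longrightarrow> norm (g n) = 1) \<and> span (g ` {n. l n = t}) = eigenspace A t"
  proof
    fix t
    obtain B where B: "finite B" "independent B" "span B = eigenspace A t" "card B = card {n. l n = t}"
      using l by (auto simp: eigenvalue_sequence_def)
    obtain C where C: "finite C" "card C = card B" "span C = span B" "pairwise orthogonal C" "\<And>x. x \<in> C \<Longrightarrow> norm x = 1"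
      using orthonormal_basis_of_span[OF B(1,2)] by metis
    have "card {n. l n = t} = card C" using B C by simp
    from finite_same_card_bij[OF fin C(1) this] obtain g where "bij_betw g {n. l n = t} C" by blast
    then have "inj_on g {n. l n = t}" "g ` {n. l n = t} = C" by (auto simp: bij_betw_def)
    then show "\<exists>g. inj_on g {n. l n = t} \<and> pairwise orthogonal (g ` {n. l n = t}) \<and>
     (\<forall>n. l n = t \<longrightarrow> norm (g n) = 1) \<and> span (g ` {n. l n = t}) = eigenspace A t"
      using B C by (intro exI[of _ g]) auto
  qed
  then obtain g where g: "\<And>t. inj_on (g t) {n. l n = t}" "\<And>t. pairwise orthogonal (g t ` {n. l n = t})"
    "\<And>t n. l n = t \<Longrightarrow> norm (g t n) = 1" "\<And>t. span (g t ` {n. l n = t}) = eigenspace A t"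
    by metis
  define e where "e n = g (l n) n" for n
  have eE: "e n \<in> eigenspace A (l n)" for n
    using span_base[of "g (l n) n" "g (l n) ` {k. l k = l n}"] g(4) by (auto simp: e_def)
  then have eA: "(e n, l n *\<^sub>R e n) \<in> A" for n by (simp add: eigenspace_def)
  have orth: "e i \<bullet> e j = (if i = j then 1 else 0)" for i j
  proof (cases "i = j")
    case True
    then show ?thesis using g(3)[of i "l i"] by (simp add: e_def power2_norm_eq_inner[symmetric])
  next
    case False
    show ?thesis
    proof (cases "l i = l j")
      case True
      have "g (l i) i \<noteq> g (l i) j" using inj_onD[OF g(1)[of "l i"], of i j] False True by auto
      then have "orthogonal (g (l i) i) (g (l i) j)"
        using g(2)[of "l i"] True by (intro pairwiseD[of orthogonal "g (l i) ` {n. l n = l i}"]) auto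
      then show ?thesis using False True by (simp add: e_def orthogonal_def)
    qed (use False eigenspaces_orthogonal[OF A eE eE] in auto)
  qed
  obtain z R where R: "compact_linear_map R" and res: "\<And>u f. (u, f + z *\<^sub>R u) \<in> A \<longleftrightarrow> u = R f"
    using cpt by (auto simp: compact_resolvent_def)
  have lin: "linear R" using R by (simp add: compact_linear_map_def)
  have RA: "(R f, f + z *\<^sub>R R f) \<in> A" for f using res by blast
  have subA: "subspace A" and sv: "single_valued A" using A by (auto simp: self_adjoint_op_def linear_operator_def)
  have sym: "R x \<bullet> y = x \<bullet> R y" for x y
    using self_adjoint_symmetric[OF A RA[of x] RA[of y]] by (simp add: inner_add_left inner_add_right)
  have inj: "f = 0" if "R f = 0" for f
  proof -
    have "(0, f) \<in> A" using RA[of f] that by simp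
    moreover have "(0, 0) \<in> A" using subspace_0[OF subA] by (simp add: zero_prod_def)
    ultimately show ?thesis using sv by (auto dest: single_valuedD)
  qed
  have Re: "R (e j) = (1 / (l j - z)) *\<^sub>R e j" for j
  proof -
    have "(e j, (l j - z) *\<^sub>R e j + z *\<^sub>R e j) \<in> A" using eA[of j] by (simp add: algebra_simps)
    then have *: "e j = R ((l j - z) *\<^sub>R e j)" using res by blast
    then have "e j = (l j - z) *\<^sub>R R (e j)" by (simp add: linear_cmul[OF lin])
    moreover have "l j - z \<noteq> 0" using * orth[of j j] linear_0[OF lin] by auto
    ultimately show ?thesis by (metis (no_types) divide_inverse mult_1 scaleR_one scaleR_scaleR left_inverse)
  qed
  define X where "X = {u. \<forall>j. u \<bullet> e j = 0}"
  have X: "subspace X" by (auto simp: X_def subspace_def inner_add_left)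
  have "X = (\<Inter>j. {u. u \<bullet> e j = 0})" by (auto simp: X_def)
  moreover have "closed {u. u \<bullet> e j = 0}" for j by (intro closed_Collect_eq continuous_intros)
  ultimately have clX: "closed X" by auto
  have invX: "R x \<in> X" if "x \<in> X" for x
    using that by (simp add: X_def sym Re)
  have "u = 0" if u: "\<And>j. u \<bullet> e j = 0" for u
  proof (rule ccontr)
    assume "u \<noteq> 0"
    then have nz: "\<exists>x\<in>X. R x \<noteq> 0" using u inj by (auto simp: X_def intro!: exI[of _ u])
    obtain \<kappa> f where f: "\<kappa> \<noteq> 0" "f \<in> X" "f \<noteq> 0" "R f = \<kappa> *\<^sub>R f"
      by (rule compact_symmetric_eigenvector[OF R sym X clX invX nz])
    have "(1 / \<kappa>) *\<^sub>R (R f, f + z *\<^sub>R R f) \<in> A" by (intro subspace_scale subA RA)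
    then have "f \<in> eigenspace A (1 / \<kappa> + z)" using f by (simp add: eigenspace_def algebra_simps)
    then have "f \<in> span (g (1 / \<kappa> + z) ` {n. l n = 1 / \<kappa> + z})" using g(4) by simp
    moreover have "span (g (1 / \<kappa> + z) ` {n. l n = 1 / \<kappa> + z}) \<subseteq> {h. f \<bullet> h = 0}"
    proof (rule span_minimal)
      show "g (1 / \<kappa> + z) ` {n. l n = 1 / \<kappa> + z} \<subseteq> {h. f \<bullet> h = 0}"
      proof clarify
        fix n assume "l n = 1 / \<kappa> + z"
        then have "g (1 / \<kappa> + z) n = e n" by (simp add: e_def)
        then show "f \<bullet> g (1 / \<kappa> + z) n = 0" using f(2) by (simp add: X_def)
      qed
      show "subspace {h. f \<bullet> h = 0}" by (auto simp: subspace_def inner_add_right)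
    qed
    ultimately show False using f(3) by auto
  qed
  then have "hilbert_basis e" using orth by unfold_locales auto
  then show ?thesis using that eA by blast
qed

section \<open>The minimax problem in one spectral gap\<close>

text \<open>What the variational argument uses of a gap \<open>(\<alpha>, \<beta>)\<close>.  Think of \<open>S\<close> as \<open>A\<^bsup>1/2\<^esup>\<close>, of \<open>E\<close> as its domain and of \<open>V\<close> as the span of
  the eigenvectors with eigenvalue at most \<open>\<alpha>\<close>.  Finite dimension of \<open>V\<close> enters only through \<open>V_form\<close>, by which
  the two norms are equivalent on \<open>V\<close>, together with the compact embedding.  Weak convergence in \<open>E\<close> appears as
  strong convergence in \<open>H\<close> with weak convergence of the images under \<open>S\<close>.\<close>

locale gap_problem =
  fixes E :: "'h::real_inner set" and S :: "'h \<Rightarrow> 'h" and V :: "'h set"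
    and I :: "'h \<Rightarrow> real" and I' :: "'h \<Rightarrow> 'h \<Rightarrow> real" and \<alpha> \<beta> :: real
  assumes subspace_E: "subspace E"
    and S_add: "\<And>u v. u \<in> E \<Longrightarrow> v \<in> E \<Longrightarrow> S (u + v) = S u + S v"
    and S_scale: "\<And>c u. u \<in> E \<Longrightarrow> S (c *\<^sub>R u) = c *\<^sub>R S u"
    and compact_embedding: "\<And>u C. (\<And>k. u k \<in> E) \<Longrightarrow> (\<And>k. norm (u k) \<le> C) \<Longrightarrow>
      (\<And>k. norm (S (u k)) \<le> C) \<Longrightarrow>
      \<exists>r x. strict_mono (r :: nat \<Rightarrow> nat) \<and> x \<in> E \<and> (u \<circ> r) \<longlonglongrightarrow> x \<and>
        (\<forall>v. (\<lambda>k. S (u (r k)) \<bullet> v) \<longlonglongrightarrow> S x \<bullet> v)"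
    and subspace_V: "subspace V" and V_E: "V \<subseteq> E" and closed_V: "closed V"
    and V_form: "\<And>v. v \<in> V \<Longrightarrow> (norm (S v))\<^sup>2 \<le> \<alpha> * (norm v)\<^sup>2"
    and W_form: "\<And>w. w \<in> E \<Longrightarrow> (\<And>v. v \<in> V \<Longrightarrow> w \<bullet> v = 0) \<Longrightarrow> \<beta> * (norm w)\<^sup>2 \<le> (norm (S w))\<^sup>2"
    and VW_form: "\<And>w v. w \<in> E \<Longrightarrow> (\<And>v. v \<in> V \<Longrightarrow> w \<bullet> v = 0) \<Longrightarrow> v \<in> V \<Longrightarrow> S w \<bullet> S v = 0"
    and splitting: "\<And>u. u \<in> E \<Longrightarrow> \<exists>v\<in>V. \<forall>v'\<in>V. (u - v) \<bullet> v' = 0"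
    and upper_eigenvector: "\<exists>w\<in>E. w \<noteq> 0 \<and> (\<forall>v\<in>V. w \<bullet> v = 0) \<and> (norm (S w))\<^sup>2 = \<beta> * (norm w)\<^sup>2"
    and \<alpha>_nonneg: "0 \<le> \<alpha>" and \<alpha>_less_\<beta>: "\<alpha> < \<beta>"
    and I_weak: "\<And>u x. (\<And>k. u k \<in> E) \<Longrightarrow> x \<in> E \<Longrightarrow> u \<longlonglongrightarrow> x \<Longrightarrow>
      (\<And>v. (\<lambda>k. S (u k) \<bullet> v) \<longlonglongrightarrow> S x \<bullet> v) \<Longrightarrow> (\<lambda>k. I (u k)) \<longlonglongrightarrow> I x"
    and I_zero: "I 0 = 0"
    and I_pos: "\<And>u. u \<in> E \<Longrightarrow> u \<noteq> 0 \<Longrightarrow> 0 < I u"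
    and I_mono: "\<And>u. u \<in> E \<Longrightarrow> u \<noteq> 0 \<Longrightarrow> mono_on {0<..} (\<lambda>t. I (t *\<^sub>R u) / t\<^sup>2)"
    and I_small: "\<And>u. u \<in> E \<Longrightarrow> u \<noteq> 0 \<Longrightarrow> ((\<lambda>t. I (t *\<^sub>R u) / t\<^sup>2) \<longlongrightarrow> 0) (at_right 0)"
    and I_large: "\<And>u. u \<in> E \<Longrightarrow> u \<noteq> 0 \<Longrightarrow> filterlim (\<lambda>t. I (t *\<^sub>R u) / t\<^sup>2) at_top at_top"
    and I'_add: "\<And>u v w. u \<in> E \<Longrightarrow> v \<in> E \<Longrightarrow> w \<in> E \<Longrightarrow> I' u (v + w) = I' u v + I' u w"
    and I'_scale: "\<And>u v c. u \<in> E \<Longrightarrow> v \<in> E \<Longrightarrow> I' u (c *\<^sub>R v) = c * I' u v"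
    and I_deriv: "\<And>u h t. u \<in> E \<Longrightarrow> h \<in> E \<Longrightarrow>
      ((\<lambda>t. I (u + t *\<^sub>R h)) has_real_derivative I' (u + t *\<^sub>R h) h) (at t)"
    and I'_cont: "\<And>u x h. (\<And>k. u k \<in> E) \<Longrightarrow> x \<in> E \<Longrightarrow> u \<longlonglongrightarrow> x \<Longrightarrow>
      (\<lambda>k. S (u k)) \<longlonglongrightarrow> S x \<Longrightarrow> h \<in> E \<Longrightarrow> (\<lambda>k. I' (u k) h) \<longlonglongrightarrow> I' x h"
    and convexity: "\<And>u v s. u \<in> E \<Longrightarrow> u \<noteq> 0 \<Longrightarrow> v \<in> E \<Longrightarrow> s \<ge> -1 \<Longrightarrow>
        I u - I ((1 + s) *\<^sub>R u + v) + I' u ((s * (s / 2 + 1)) *\<^sub>R u + (1 + s) *\<^sub>R v) \<le> 0"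
    and convexity_strict: "\<And>u s. u \<in> E \<Longrightarrow> u \<noteq> 0 \<Longrightarrow> s \<ge> -1 \<Longrightarrow> s \<noteq> 0 \<Longrightarrow>
        I u - I ((1 + s) *\<^sub>R u) + I' u ((s * (s / 2 + 1)) *\<^sub>R u) < 0"
begin

definition W :: "'h set" where "W = {w \<in> E. \<forall>v\<in>V. w \<bullet> v = 0}"

definition halfspace :: "'h \<Rightarrow> 'h set" where
  "halfspace w = {t *\<^sub>R w + v | t v. 0 \<le> t \<and> v \<in> V}"

definition energy :: "real \<Rightarrow> 'h \<Rightarrow> real" where
  "energy \<rho> u = ((norm (S u))\<^sup>2 - \<rho> * (norm u)\<^sup>2) / 2 - I u"

text \<open>The supremum is a maximum whenever \<open>w \<in> W\<close> is nonzero.\<close>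

definition minimax :: "real \<Rightarrow> 'h \<Rightarrow> real" where
  "minimax \<rho> w = Sup (energy \<rho> ` halfspace w)"

lemma E_add: "u \<in> E \<Longrightarrow> v \<in> E \<Longrightarrow> u + v \<in> E"
  and E_scale: "u \<in> E \<Longrightarrow> c *\<^sub>R u \<in> E"
  and E_zero: "0 \<in> E"
  and E_diff: "u \<in> E \<Longrightarrow> v \<in> E \<Longrightarrow> u - v \<in> E"
  using subspace_E by (auto simp: subspace_add subspace_scale subspace_0 subspace_diff)

lemma V_add: "u \<in> V \<Longrightarrow> v \<in> V \<Longrightarrow> u + v \<in> V"
  and V_scale: "u \<in> V \<Longrightarrow> c *\<^sub>R u \<in> V"
  and V_zero: "0 \<in> V"
  and V_diff: "u \<in> V \<Longrightarrow> v \<in> V \<Longrightarrow> u - v \<in> V"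
  and V_in_E: "u \<in> V \<Longrightarrow> u \<in> E"
  using subspace_V V_E by (auto simp: subspace_add subspace_scale subspace_0 subspace_diff)

lemma S_zero: "S 0 = 0"
  using S_scale[OF E_zero, of 0] by simp

lemma S_diff: "u \<in> E \<Longrightarrow> v \<in> E \<Longrightarrow> S (u - v) = S u - S v"
  using S_add[of u "(-1) *\<^sub>R v"] S_scale[of v "-1"] E_scale[of v "-1"] by simp

lemma W_E: "w \<in> W \<Longrightarrow> w \<in> E"
  and W_V: "w \<in> W \<Longrightarrow> v \<in> V \<Longrightarrow> w \<bullet> v = 0"
  and W_add: "w \<in> W \<Longrightarrow> w' \<in> W \<Longrightarrow> w + w' \<in> W"
  and W_scale: "w \<in> W \<Longrightarrow> c *\<^sub>R w \<in> W"
  by (auto simp: W_def E_add E_scale inner_add_left)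

lemma form_W: "w \<in> W \<Longrightarrow> \<beta> * (norm w)\<^sup>2 \<le> (norm (S w))\<^sup>2"
  using W_form by (auto simp: W_def)

lemma S_W_V: "w \<in> W \<Longrightarrow> v \<in> V \<Longrightarrow> S w \<bullet> S v = 0"
  using VW_form by (auto simp: W_def)

lemma halfspace_E: "w \<in> W \<Longrightarrow> p \<in> halfspace w \<Longrightarrow> p \<in> E"
  by (auto simp: halfspace_def E_add E_scale V_in_E W_E)

lemma V_halfspace: "v \<in> V \<Longrightarrow> v \<in> halfspace w"
  by (force simp: halfspace_def)

lemma ray_halfspace: "0 \<le> t \<Longrightarrow> t *\<^sub>R w \<in> halfspace w"
  unfolding halfspace_def using V_zero by force

lemma norm_split: "w \<in> W \<Longrightarrow> v \<in> V \<Longrightarrow> (norm (t *\<^sub>R w + v))\<^sup>2 = t\<^sup>2 * (norm w)\<^sup>2 + (norm v)\<^sup>2"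
  using W_V[of w v]
  by (simp only: power2_norm_eq_inner inner_add_left inner_add_right inner_commute[of v "t *\<^sub>R w"])
    (simp add: power2_eq_square)

lemma S_split: "w \<in> W \<Longrightarrow> v \<in> V \<Longrightarrow> S (t *\<^sub>R w + v) = t *\<^sub>R S w + S v"
  by (simp add: S_add S_scale W_E V_in_E E_scale)

lemma norm_S_split:
  "w \<in> W \<Longrightarrow> v \<in> V \<Longrightarrow> (norm (S (t *\<^sub>R w + v)))\<^sup>2 = t\<^sup>2 * (norm (S w))\<^sup>2 + (norm (S v))\<^sup>2"
  using S_W_V[of w v]
  by (simp only: S_split power2_norm_eq_inner inner_add_left inner_add_right inner_commute[of "S v" "t *\<^sub>R S w"])
    (simp add: power2_eq_square)

text \<open>On a half-space the form \<open>\<parallel>S p\<parallel>\<^sup>2\<close> is bounded by a multiple of \<open>\<parallel>p\<parallel>\<^sup>2\<close>.  The growth of \<open>I\<close> along rays is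
  uniform on every such cone, while on \<open>E\<close> it need not be.\<close>

lemma halfspace_cone:
  assumes "w \<in> W" "v \<in> V" "(norm (S w))\<^sup>2 \<le> C * (norm w)\<^sup>2" "\<alpha> \<le> C"
  shows "(norm (S (t *\<^sub>R w + v)))\<^sup>2 \<le> C * (norm (t *\<^sub>R w + v))\<^sup>2"
proof -
  have "(norm (S v))\<^sup>2 \<le> C * (norm v)\<^sup>2"
    using V_form[OF assms(2)] assms(4) by (meson mult_right_mono order_trans zero_le_power2)
  moreover have "t\<^sup>2 * (norm (S w))\<^sup>2 \<le> t\<^sup>2 * (C * (norm w)\<^sup>2)"
    using assms(3) by (simp add: mult_left_mono)
  ultimately show ?thesis
    unfolding norm_split[OF assms(1,2)] norm_S_split[OF assms(1,2)] by (simp add: algebra_simps)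
qed

text \<open>Monotonicity of the quotient, rescaled: lower bounds for \<open>I\<close> at radius \<open>T\<close> spread to all larger radii.\<close>

lemma I_normalized_ge:
  assumes "p \<in> E" "0 < T" "T \<le> norm p"
  shows "I (T *\<^sub>R sgn p) / T\<^sup>2 \<le> I p / (norm p)\<^sup>2"
proof -
  have p: "p \<noteq> 0" using assms by auto
  have "sgn p \<in> E" using assms(1) by (simp add: sgn_div_norm E_scale)
  moreover have "sgn p \<noteq> 0" using p by (simp add: sgn_zero_iff)
  ultimately have "I (T *\<^sub>R sgn p) / T\<^sup>2 \<le> I (norm p *\<^sub>R sgn p) / (norm p)\<^sup>2"
    using I_mono[of "sgn p"] assms p unfolding mono_on_def by simp
  also have "norm p *\<^sub>R sgn p = p" using p by (simp add: sgn_div_norm)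
  finally show ?thesis .
qed

text \<open>After normalization in \<open>H\<close> a sequence in the cone is bounded in \<open>E\<close>, and its weak limit is nonzero because
  convergence in \<open>H\<close> is strong.  This turns the pointwise conditions on \<open>I\<close> along rays into uniform ones.\<close>

lemma cone_compact:
  assumes p: "\<And>k. p k \<in> E" "\<And>k. p k \<noteq> 0" "\<And>k. (norm (S (p k)))\<^sup>2 \<le> C * (norm (p k))\<^sup>2"
  obtains r q where "strict_mono (r :: nat \<Rightarrow> nat)" "q \<in> E" "q \<noteq> 0"
    "\<forall>T. (\<lambda>k. I (T *\<^sub>R sgn (p (r k)))) \<longlonglongrightarrow> I (T *\<^sub>R q)"
proof -
  define u where "u k = sgn (p k)" for k
  have uE: "u k \<in> E" for k using p(1) by (simp add: u_def sgn_div_norm E_scale)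
  have n1: "norm (u k) = 1" for k using p(2) by (simp add: u_def norm_sgn)
  have "(norm (S (u k)))\<^sup>2 \<le> C" for k
  proof -
    have "(norm (S (u k)))\<^sup>2 = (norm (S (p k)))\<^sup>2 / (norm (p k))\<^sup>2"
      using p(1) by (simp add: u_def sgn_div_norm S_scale power_mult_distrib power_divide divide_inverse power_inverse)
    also have "\<dots> \<le> C" using p(2)[of k] p(3)[of k] by (simp add: pos_divide_le_eq)
    finally show ?thesis .
  qed
  then have nS: "norm (S (u k)) \<le> sqrt C" for k by (simp add: real_le_rsqrt)
  have "norm (u k) \<le> max 1 (sqrt C)" "norm (S (u k)) \<le> max 1 (sqrt C)" for k
    using n1[of k] nS[of k] by auto
  from compact_embedding[of u, OF uE this]
  obtain r q where r: "strict_mono (r :: nat \<Rightarrow> nat)" "q \<in> E" "(u \<circ> r) \<longlonglongrightarrow> q"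
    "\<forall>v. (\<lambda>k. S (u (r k)) \<bullet> v) \<longlonglongrightarrow> S q \<bullet> v"
    by blast
  have "(\<lambda>k. norm ((u \<circ> r) k)) \<longlonglongrightarrow> norm q" using r(3) by (rule tendsto_norm)
  then have "norm q = 1" by (simp add: n1 LIMSEQ_const_iff)
  then have q0: "q \<noteq> 0" by auto
  have "(\<lambda>k. I (T *\<^sub>R u (r k))) \<longlonglongrightarrow> I (T *\<^sub>R q)" for T
  proof (rule I_weak)
    show "(\<lambda>k. T *\<^sub>R u (r k)) \<longlonglongrightarrow> T *\<^sub>R q" using r(3) by (auto simp: comp_def intro!: tendsto_intros)
    show "(\<lambda>k. S (T *\<^sub>R u (r k)) \<bullet> v) \<longlonglongrightarrow> S (T *\<^sub>R q) \<bullet> v" for v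
      using r(4) by (auto simp: S_scale uE r(2) intro!: tendsto_mult_left)
  qed (auto simp: uE r E_scale)
  then show ?thesis using that[OF r(1,2) q0] by (simp add: u_def)
qed

text \<open>Otherwise \<open>I (T q) \<le> 0\<close> for the limit direction \<open>q\<close> of a sequence of counterexamples, although
  \<open>q \<noteq> 0\<close>.\<close>

lemma cone_positive:
  assumes "0 < T"
  shows "\<exists>c>0. \<forall>p\<in>E. (norm (S p))\<^sup>2 \<le> C * (norm p)\<^sup>2 \<and> T \<le> norm p \<longrightarrow> c * (norm p)\<^sup>2 \<le> I p"
proof (rule ccontr)
  assume *: "\<not> ?thesis"
  have "\<forall>k::nat. \<exists>p\<in>E. (norm (S p))\<^sup>2 \<le> C * (norm p)\<^sup>2 \<and> T \<le> norm p \<and> I p < 1 / Suc k * (norm p)\<^sup>2"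
  proof
    fix k :: nat
    have "(0::real) < 1 / Suc k" by simp
    then show "\<exists>p\<in>E. (norm (S p))\<^sup>2 \<le> C * (norm p)\<^sup>2 \<and> T \<le> norm p \<and> I p < 1 / Suc k * (norm p)\<^sup>2"
      using * not_le by metis
  qed
  then obtain p where p: "\<And>k::nat. p k \<in> E" "\<And>k. (norm (S (p k)))\<^sup>2 \<le> C * (norm (p k))\<^sup>2"
     "\<And>k. T \<le> norm (p k)" "\<And>k. I (p k) < 1 / Suc k * (norm (p k))\<^sup>2"
    by metis
  have p0: "p k \<noteq> 0" for k using p(3)[of k] assms by auto
  obtain r q where r: "strict_mono (r :: nat \<Rightarrow> nat)" "q \<in> E" "q \<noteq> 0"
    "\<forall>T. (\<lambda>k. I (T *\<^sub>R sgn (p (r k)))) \<longlonglongrightarrow> I (T *\<^sub>R q)"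
    by (rule cone_compact[of p C, OF p(1) p0 p(2)])
  have "I (T *\<^sub>R sgn (p k)) / T\<^sup>2 \<le> 1 / Suc k" for k
  proof -
    have "I (p k) / (norm (p k))\<^sup>2 \<le> 1 / Suc k"
      using p(4)[of k] p0[of k] by (simp add: divide_simps mult.commute)
    then show ?thesis using I_normalized_ge[OF p(1) assms p(3), of k] by linarith
  qed
  then have *: "I (T *\<^sub>R sgn (p (r k))) / T\<^sup>2 \<le> 1 / Suc (r k)" for k by blast
  have "(\<lambda>k. I (T *\<^sub>R sgn (p (r k))) / T\<^sup>2) \<longlonglongrightarrow> I (T *\<^sub>R q) / T\<^sup>2"
    using assms by (intro tendsto_intros r(4)[rule_format]) auto
  moreover have "(\<lambda>k. 1 / real (Suc (r k))) \<longlonglongrightarrow> 0"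
    using LIMSEQ_subseq_LIMSEQ[OF LIMSEQ_Suc[OF lim_1_over_n] r(1)] by (simp add: comp_def)
  ultimately have "I (T *\<^sub>R q) / T\<^sup>2 \<le> 0" using * by (meson LIMSEQ_le)
  moreover have "0 < I (T *\<^sub>R q)" using assms r by (intro I_pos E_scale) auto
  ultimately show False using assms by (simp add: divide_le_0_iff)
qed

text \<open>Otherwise \<open>I (T q) / T\<^sup>2 \<le> M\<close> for every \<open>T > 0\<close>, where the nonzero \<open>q\<close> is the limit direction of a
  sequence of counterexamples; this contradicts the growth of \<open>I\<close> along the ray of \<open>q\<close>.\<close>

lemma cone_superquadratic:
  "\<exists>R>0. \<forall>p\<in>E. (norm (S p))\<^sup>2 \<le> C * (norm p)\<^sup>2 \<and> R \<le> norm p \<longrightarrow> M * (norm p)\<^sup>2 \<le> I p"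
proof (rule ccontr)
  assume *: "\<not> ?thesis"
  have "\<forall>k::nat. \<exists>p\<in>E. (norm (S p))\<^sup>2 \<le> C * (norm p)\<^sup>2 \<and> Suc k \<le> norm p \<and> I p < M * (norm p)\<^sup>2"
  proof
    fix k :: nat
    have "(0::real) < Suc k" by simp
    then show "\<exists>p\<in>E. (norm (S p))\<^sup>2 \<le> C * (norm p)\<^sup>2 \<and> Suc k \<le> norm p \<and> I p < M * (norm p)\<^sup>2"
      using * not_le by metis
  qed
  then obtain p where p: "\<And>k::nat. p k \<in> E" "\<And>k. (norm (S (p k)))\<^sup>2 \<le> C * (norm (p k))\<^sup>2"
     "\<And>k. Suc k \<le> norm (p k)" "\<And>k. I (p k) < M * (norm (p k))\<^sup>2"
    by metis
  have p0: "p k \<noteq> 0" for k using p(3)[of k] by auto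
  obtain r q where r: "strict_mono (r :: nat \<Rightarrow> nat)" "q \<in> E" "q \<noteq> 0"
    "\<forall>T. (\<lambda>k. I (T *\<^sub>R sgn (p (r k)))) \<longlonglongrightarrow> I (T *\<^sub>R q)"
    by (rule cone_compact[of p C, OF p(1) p0 p(2)])
  have bound: "I (T *\<^sub>R q) / T\<^sup>2 \<le> M" if T: "0 < T" for T
  proof -
    have lim: "(\<lambda>k. I (T *\<^sub>R sgn (p (r k))) / T\<^sup>2) \<longlonglongrightarrow> I (T *\<^sub>R q) / T\<^sup>2"
      using T by (intro tendsto_intros r(4)[rule_format]) auto
    obtain N :: nat where N: "T \<le> real N" using real_arch_simple by blast
    have "I (T *\<^sub>R sgn (p (r k))) / T\<^sup>2 \<le> M" if "N \<le> k" for k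
    proof -
      have "k \<le> r k" using r(1) by (rule seq_suble)
      then have "T \<le> Suc (r k)" using N that by linarith
      then have "T \<le> norm (p (r k))" using p(3)[of "r k"] by linarith
      moreover have "I (p (r k)) / (norm (p (r k)))\<^sup>2 \<le> M"
        using p(4)[of "r k"] p0[of "r k"] by (simp add: divide_simps mult.commute)
      ultimately show ?thesis using I_normalized_ge[OF p(1) T, of "r k"] by linarith
    qed
    then show ?thesis using lim by (meson LIMSEQ_le_const2)
  qed
  have "eventually (\<lambda>t. M < I (t *\<^sub>R q) / t\<^sup>2) at_top"
    using I_large[OF r(2,3)] by (simp add: filterlim_at_top_dense)
  then have "eventually (\<lambda>t. M < I (t *\<^sub>R q) / t\<^sup>2 \<and> 0 < t) at_top"
    using eventually_gt_at_top[of "0::real"] by eventually_elim auto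
  then obtain t where "M < I (t *\<^sub>R q) / t\<^sup>2" "0 < t"
    by (auto simp: eventually_at_top_linorder)
  with bound[of t] show False by simp
qed

text \<open>Strong convergence in \<open>E\<close>.\<close>

definition E_lim :: "(nat \<Rightarrow> 'h) \<Rightarrow> 'h \<Rightarrow> bool" where
  "E_lim u x \<longleftrightarrow> (\<forall>k. u k \<in> E) \<and> x \<in> E \<and> u \<longlonglongrightarrow> x \<and> (\<lambda>k. S (u k)) \<longlonglongrightarrow> S x"

lemma E_lim_combination:
  assumes "E_lim u x" "E_lim v y" "a \<longlonglongrightarrow> b"
  shows "E_lim (\<lambda>k. a k *\<^sub>R u k + v k) (b *\<^sub>R x + y)"
proof -
  have "(\<lambda>k. a k *\<^sub>R S (u k) + S (v k)) \<longlonglongrightarrow> b *\<^sub>R S x + S y"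
    using assms by (auto simp: E_lim_def intro!: tendsto_intros)
  moreover have "(\<lambda>k. a k *\<^sub>R u k + v k) \<longlonglongrightarrow> b *\<^sub>R x + y"
    using assms by (auto simp: E_lim_def intro!: tendsto_intros)
  ultimately show ?thesis using assms by (simp add: E_lim_def S_add S_scale E_add E_scale)
qed

lemma E_lim_const: "x \<in> E \<Longrightarrow> E_lim (\<lambda>_. x) x"
  by (simp add: E_lim_def)

lemma E_lim_subseq: "E_lim u x \<Longrightarrow> strict_mono (r :: nat \<Rightarrow> nat) \<Longrightarrow> E_lim (\<lambda>k. u (r k)) x"
  unfolding E_lim_def
  by (auto dest: LIMSEQ_subseq_LIMSEQ[of _ _ r] simp: comp_def)

lemma energy_tendsto:
  assumes "E_lim u x" "\<rho>s \<longlonglongrightarrow> \<rho>"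
  shows "(\<lambda>k. energy (\<rho>s k) (u k)) \<longlonglongrightarrow> energy \<rho> x"
proof -
  have "(\<lambda>k. I (u k)) \<longlonglongrightarrow> I x"
    using assms by (intro I_weak) (auto simp: E_lim_def intro!: tendsto_intros)
  then show ?thesis
    using assms unfolding energy_def E_lim_def by (auto intro!: tendsto_intros)
qed

text \<open>A lower bound on the energy bounds the points in \<open>H\<close>, since \<open>I\<close> is superquadratic on a cone that contains all
  but finitely many of them.  By orthogonality both components are bounded; the scalars then have a
  convergent subsequence, and the components in \<open>V\<close> have one by the compact embedding.  Both existence and
  stability of maximizers come from this lemma.\<close>

lemma halfspace_compact:
  assumes \<rho>: "\<rho>s \<longlonglongrightarrow> \<rho>" and w: "\<And>k. w k \<in> W" "E_lim w w0" "w0 \<in> W" "w0 \<noteq> 0"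
    and t: "\<And>k. 0 \<le> t k" and v: "\<And>k. v k \<in> V"
    and lower: "\<And>k. - K \<le> energy (\<rho>s k) (t k *\<^sub>R w k + v k)"
  obtains r t0 v0 where "strict_mono (r :: nat \<Rightarrow> nat)" "0 \<le> t0" "v0 \<in> V"
    "(t \<circ> r) \<longlonglongrightarrow> t0" "E_lim (v \<circ> r) v0"
proof -
  define p where "p k = t k *\<^sub>R w k + v k" for k
  have pE: "p k \<in> E" for k using w v by (simp add: p_def E_add E_scale W_E V_in_E)
  \<comment> \<open>The summand \<open>1\<close> makes the bound strict at \<open>w0\<close>, so that it holds for all but finitely many \<open>w k\<close>.\<close>
  define C where "C = max \<alpha> ((norm (S w0))\<^sup>2 / (norm w0)\<^sup>2 + 1)"
  have C_gt: "(norm (S w0))\<^sup>2 < C * (norm w0)\<^sup>2"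
  proof -
    have "(norm (S w0))\<^sup>2 < ((norm (S w0))\<^sup>2 / (norm w0)\<^sup>2 + 1) * (norm w0)\<^sup>2"
      using w(4) by (simp add: field_simps)
    also have "\<dots> \<le> C * (norm w0)\<^sup>2" by (intro mult_right_mono) (auto simp: C_def)
    finally show ?thesis .
  qed
  have wlim: "w \<longlonglongrightarrow> w0" "(\<lambda>k. S (w k)) \<longlonglongrightarrow> S w0" using w(2) by (auto simp: E_lim_def)
  have "(\<lambda>k. C * (norm (w k))\<^sup>2 - (norm (S (w k)))\<^sup>2) \<longlonglongrightarrow> C * (norm w0)\<^sup>2 - (norm (S w0))\<^sup>2"
    by (intro tendsto_intros wlim)
  then have "eventually (\<lambda>k. 0 < C * (norm (w k))\<^sup>2 - (norm (S (w k)))\<^sup>2) sequentially"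
    by (rule order_tendstoD(1)) (use C_gt in simp)
  then have cone: "eventually (\<lambda>k. (norm (S (p k)))\<^sup>2 \<le> C * (norm (p k))\<^sup>2) sequentially"
  proof eventually_elim
    case (elim k)
    then show ?case unfolding p_def
      by (intro halfspace_cone w v) (auto simp: C_def)
  qed
  obtain L where L: "\<And>k. \<bar>\<rho>s k\<bar> \<le> L"
    using convergent_imp_Bseq[of \<rho>s] \<rho> by (auto simp: convergent_def Bseq_def)
  obtain R where R: "R > 0"
    "\<And>p. p \<in> E \<Longrightarrow> (norm (S p))\<^sup>2 \<le> C * (norm p)\<^sup>2 \<Longrightarrow> R \<le> norm p \<Longrightarrow> (C / 2 + L / 2 + 1) * (norm p)\<^sup>2 \<le> I p"
    using cone_superquadratic[of C "C / 2 + L / 2 + 1"] by blast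
  define D where "D = max R (sqrt K)"
  have p_bound: "eventually (\<lambda>k. norm (p k) \<le> D) sequentially"
    using cone
  proof eventually_elim
    case (elim k)
    show ?case
    proof (cases "R \<le> norm (p k)")
      case True
      have "(C / 2 + L / 2 + 1) * (norm (p k))\<^sup>2 \<le> I (p k)" using R(2)[OF pE elim True] .
      moreover have "- \<rho>s k * (norm (p k))\<^sup>2 \<le> L * (norm (p k))\<^sup>2"
        using L[of k] by (intro mult_right_mono) auto
      moreover have "- K \<le> ((norm (S (p k)))\<^sup>2 - \<rho>s k * (norm (p k))\<^sup>2) / 2 - I (p k)"
        using lower[of k] by (simp add: energy_def p_def)
      ultimately have "(norm (p k))\<^sup>2 \<le> K" using elim by (simp add: algebra_simps)
      then show ?thesis by (simp add: D_def le_max_iff_disj real_le_rsqrt)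
    qed (simp add: D_def)
  qed
  have "norm w0 / 2 < norm w0" using w(4) by simp
  then have w_lower: "eventually (\<lambda>k. norm w0 / 2 < norm (w k)) sequentially"
    using order_tendstoD(1)[OF tendsto_norm[OF wlim(1)]] by blast
  have "eventually (\<lambda>k. norm (t k) \<le> 2 * D / norm w0) sequentially"
    using p_bound w_lower
  proof eventually_elim
    case (elim k)
    have "(t k * norm (w k))\<^sup>2 \<le> (norm (p k))\<^sup>2"
      unfolding p_def norm_split[OF w(1) v] by (simp add: power_mult_distrib)
    then have "t k * norm (w k) \<le> norm (p k)" by (rule power2_le_imp_le) simp
    moreover have "t k * (norm w0 / 2) \<le> t k * norm (w k)" using elim t by (intro mult_left_mono) auto
    ultimately have "t k * (norm w0 / 2) \<le> D" using elim by linarith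
    then show ?case using w(4) t[of k] by (simp add: field_simps)
  qed
  then have "Bseq t" by (rule BfunI)
  then have "bounded (range t)" by (simp add: Bseq_eq_bounded)
  then obtain r1 t0 where r1: "strict_mono (r1 :: nat \<Rightarrow> nat)" "(t \<circ> r1) \<longlonglongrightarrow> t0"
    using bounded_imp_convergent_subsequence by blast
  have "eventually (\<lambda>k. norm (v k) \<le> D) sequentially"
    using p_bound
  proof eventually_elim
    case (elim k)
    have "(norm (v k))\<^sup>2 \<le> (norm (p k))\<^sup>2"
      unfolding p_def norm_split[OF w(1) v] by simp
    then have "norm (v k) \<le> norm (p k)" by (rule power2_le_imp_le) simp
    with elim show ?case by linarith
  qed
  then have "Bseq v" by (rule BfunI)
  then obtain B where B: "B > 0" "\<And>k. norm (v k) \<le> B" by (auto simp: Bseq_def)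
  have S_bound: "norm (S x) \<le> sqrt \<alpha> * norm x" if "x \<in> V" for x
    using real_le_rsqrt[OF V_form[OF that]] by (simp add: real_sqrt_mult)
  define C' where "C' = max B (sqrt \<alpha> * B)"
  have "norm (S (v (r1 k))) \<le> C'" "norm (v (r1 k)) \<le> C'" for k
  proof -
    have "norm (S (v (r1 k))) \<le> sqrt \<alpha> * B"
      using S_bound[OF v, of "r1 k"] B(2)[of "r1 k"] \<alpha>_nonneg
      by (meson mult_left_mono order_trans real_sqrt_ge_zero)
    then show "norm (S (v (r1 k))) \<le> C'" by (simp add: C'_def)
    show "norm (v (r1 k)) \<le> C'" using B(2)[of "r1 k"] by (simp add: C'_def)
  qed
  from compact_embedding[of "\<lambda>k. v (r1 k)", OF V_in_E[OF v] this(2,1)]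
  obtain r2 v0 where r2: "strict_mono (r2 :: nat \<Rightarrow> nat)" "((\<lambda>k. v (r1 k)) \<circ> r2) \<longlonglongrightarrow> v0"
    by blast
  have v0: "v0 \<in> V"
    using closed_sequentially[OF closed_V _ r2(2)] v by simp
  define r where "r = r1 \<circ> r2"
  have r: "strict_mono r" using r1 r2 by (simp add: r_def strict_mono_o)
  have tlim: "(t \<circ> r) \<longlonglongrightarrow> t0" using LIMSEQ_subseq_LIMSEQ[OF r1(2) r2(1)] by (simp add: r_def o_assoc)
  have vlim: "(v \<circ> r) \<longlonglongrightarrow> v0" using r2(2) by (simp add: r_def comp_def)
  have "(\<lambda>k. S ((v \<circ> r) k) - S v0) \<longlonglongrightarrow> 0"
  proof (rule Lim_null_comparison)
    show "eventually (\<lambda>k. norm (S ((v \<circ> r) k) - S v0) \<le> sqrt \<alpha> * norm ((v \<circ> r) k - v0)) sequentially"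
      using S_bound[OF V_diff[OF v v0]] by (simp add: S_diff V_in_E v v0)
    have "(\<lambda>k. norm ((v \<circ> r) k - v0)) \<longlonglongrightarrow> 0" using tendsto_norm_zero[OF LIM_zero[OF vlim]] .
    then show "(\<lambda>k. sqrt \<alpha> * norm ((v \<circ> r) k - v0)) \<longlonglongrightarrow> 0" by (rule tendsto_mult_right_zero)
  qed
  then have "(\<lambda>k. S ((v \<circ> r) k)) \<longlonglongrightarrow> S v0" by (rule LIM_zero_cancel)
  then have "E_lim (v \<circ> r) v0" using vlim v v0 by (auto simp: E_lim_def V_in_E)
  moreover have "0 \<le> t0" using tlim t by (intro LIMSEQ_le_const[OF tlim]) auto
  ultimately show ?thesis using that r v0 tlim by blast
qed


lemma energy_ray_tendsto:
  assumes "\<rho>s \<longlonglongrightarrow> \<rho>" "E_lim w w0" "E_lim v v0" "t \<longlonglongrightarrow> t0"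
  shows "(\<lambda>k. energy (\<rho>s k) (t k *\<^sub>R w k + v k)) \<longlonglongrightarrow> energy \<rho> (t0 *\<^sub>R w0 + v0)"
  using assms by (intro energy_tendsto E_lim_combination)

text \<open>A sequence of points whose energies are unbounded, or approach the supremum, has by compactness a
  subsequence that converges in \<open>E\<close>, and the energy is continuous there.\<close>

lemma halfspace_maximizer:
  assumes "w \<in> W" "w \<noteq> 0"
  shows "bdd_above (energy \<rho> ` halfspace w)" "\<exists>p\<in>halfspace w. energy \<rho> p = minimax \<rho> w"
proof -
  have wlim: "E_lim (\<lambda>_. w) w" using assms by (simp add: E_lim_const W_E)
  show bdd: "bdd_above (energy \<rho> ` halfspace w)"
  proof (rule ccontr)
    assume "\<not> ?thesis"
    then have "\<exists>p\<in>halfspace w. real k < energy \<rho> p" for k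
      unfolding bdd_above_def by (auto simp: not_le)
    then have "\<forall>k::nat. \<exists>t v. 0 \<le> t \<and> v \<in> V \<and> real k < energy \<rho> (t *\<^sub>R w + v)"
      unfolding halfspace_def by blast
    then obtain t v where tv: "\<And>k::nat. 0 \<le> t k" "\<And>k. v k \<in> V" "\<And>k. real k < energy \<rho> (t k *\<^sub>R w + v k)"
      by metis
    have low: "- 0 \<le> energy \<rho> (t k *\<^sub>R w + v k)" for k
      using tv(3)[of k] by linarith
    obtain r t0 v0 where r: "strict_mono (r :: nat \<Rightarrow> nat)" "0 \<le> t0" "v0 \<in> V"
      "(t \<circ> r) \<longlonglongrightarrow> t0" "E_lim (v \<circ> r) v0"
      by (rule halfspace_compact[OF tendsto_const assms(1) wlim assms tv(1,2) low])
    have lim: "(\<lambda>k. energy \<rho> ((t \<circ> r) k *\<^sub>R w + (v \<circ> r) k)) \<longlonglongrightarrow> energy \<rho> (t0 *\<^sub>R w + v0)"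
      by (rule energy_ray_tendsto[OF tendsto_const wlim r(5,4)])
    obtain N :: nat where N: "energy \<rho> (t0 *\<^sub>R w + v0) + 1 \<le> real N" using real_arch_simple by blast
    have "energy \<rho> (t0 *\<^sub>R w + v0) + 1 \<le> energy \<rho> ((t \<circ> r) k *\<^sub>R w + (v \<circ> r) k)" if "N \<le> k" for k
    proof -
      have "real N \<le> real (r k)" using seq_suble[OF r(1), of k] that by simp
      then show ?thesis using N tv(3)[of "r k"] by simp
    qed
    then have "energy \<rho> (t0 *\<^sub>R w + v0) + 1 \<le> energy \<rho> (t0 *\<^sub>R w + v0)"
      using LIMSEQ_le_const[OF lim] by blast
    then show False by simp
  qed
  have ne: "energy \<rho> ` halfspace w \<noteq> {}" using V_halfspace[OF V_zero] by auto
  have "\<exists>p\<in>halfspace w. minimax \<rho> w - 1 / Suc k < energy \<rho> p" for k :: nat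
    using less_cSup_iff[OF ne bdd, of "minimax \<rho> w - 1 / Suc k"] by (simp add: minimax_def)
  then have "\<forall>k::nat. \<exists>t v. 0 \<le> t \<and> v \<in> V \<and> minimax \<rho> w - 1 / Suc k < energy \<rho> (t *\<^sub>R w + v)"
    unfolding halfspace_def by blast
  then obtain t v where tv: "\<And>k::nat. 0 \<le> t k" "\<And>k. v k \<in> V"
    "\<And>k. minimax \<rho> w - 1 / Suc k < energy \<rho> (t k *\<^sub>R w + v k)"
    by metis
  have low: "- (1 - minimax \<rho> w) \<le> energy \<rho> (t k *\<^sub>R w + v k)" for k
  proof -
    have "1 / real (Suc k) \<le> 1" by simp
    then show ?thesis using tv(3)[of k] by linarith
  qed
  obtain r t0 v0 where r: "strict_mono (r :: nat \<Rightarrow> nat)" "0 \<le> t0" "v0 \<in> V"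
    "(t \<circ> r) \<longlonglongrightarrow> t0" "E_lim (v \<circ> r) v0"
    by (rule halfspace_compact[OF tendsto_const assms(1) wlim assms tv(1,2) low])
  have lim: "(\<lambda>k. energy \<rho> ((t \<circ> r) k *\<^sub>R w + (v \<circ> r) k)) \<longlonglongrightarrow> energy \<rho> (t0 *\<^sub>R w + v0)"
    by (rule energy_ray_tendsto[OF tendsto_const wlim r(5,4)])
  have "(\<lambda>k. minimax \<rho> w - 1 / real (Suc (r k))) \<longlonglongrightarrow> minimax \<rho> w - 0"
    using LIMSEQ_subseq_LIMSEQ[OF LIMSEQ_Suc[OF lim_1_over_n] r(1)]
    by (intro tendsto_diff tendsto_const) (simp add: comp_def)
  then have "minimax \<rho> w - 0 \<le> energy \<rho> (t0 *\<^sub>R w + v0)"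
    by (rule LIMSEQ_le[OF _ lim]) (use tv(3) in \<open>auto intro: less_imp_le\<close>)
  moreover have mem: "t0 *\<^sub>R w + v0 \<in> halfspace w" using r by (auto simp: halfspace_def)
  then have "energy \<rho> (t0 *\<^sub>R w + v0) \<le> minimax \<rho> w"
    unfolding minimax_def by (intro cSup_upper bdd imageI)
  ultimately show "\<exists>p\<in>halfspace w. energy \<rho> p = minimax \<rho> w" using mem by force
qed

lemma energy_le_minimax:
  assumes "w \<in> W" "w \<noteq> 0" "p \<in> halfspace w"
  shows "energy \<rho> p \<le> minimax \<rho> w"
  unfolding minimax_def using assms by (intro cSup_upper imageI halfspace_maximizer)

lemma halfspace_scale:
  assumes "0 < c"
  shows "halfspace (c *\<^sub>R w) = halfspace w"
proof (intro equalityI subsetI)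
  fix p assume "p \<in> halfspace w"
  then obtain t v where "p = t *\<^sub>R w + v" "0 \<le> t" "v \<in> V" by (auto simp: halfspace_def)
  then have "p = (t / c) *\<^sub>R c *\<^sub>R w + v" "0 \<le> t / c" using assms by auto
  with \<open>v \<in> V\<close> show "p \<in> halfspace (c *\<^sub>R w)" unfolding halfspace_def by blast
next
  fix p assume "p \<in> halfspace (c *\<^sub>R w)"
  then obtain t v where "p = t *\<^sub>R c *\<^sub>R w + v" "0 \<le> t" "v \<in> V" by (auto simp: halfspace_def)
  then have "p = (t * c) *\<^sub>R w + v" "0 \<le> t * c" using assms by auto
  with \<open>v \<in> V\<close> show "p \<in> halfspace w" unfolding halfspace_def by blast
qed

lemma minimax_scale: "0 < c \<Longrightarrow> minimax \<rho> (c *\<^sub>R w) = minimax \<rho> w"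
  by (simp add: minimax_def halfspace_scale)

lemma I_small_on_ray: "w \<in> E \<Longrightarrow> w \<noteq> 0 \<Longrightarrow> 0 < \<epsilon> \<Longrightarrow> \<exists>t>0. I (t *\<^sub>R w) < \<epsilon> * t\<^sup>2"
proof -
  assume a: "w \<in> E" "w \<noteq> 0" "0 < \<epsilon>"
  have "eventually (\<lambda>t. I (t *\<^sub>R w) / t\<^sup>2 < \<epsilon>) (at_right 0)"
    using order_tendstoD(2)[OF I_small[OF a(1,2)] a(3)] .
  then have "eventually (\<lambda>t. I (t *\<^sub>R w) / t\<^sup>2 < \<epsilon> \<and> 0 < t) (at_right 0)"
    using eventually_at_right_less[of "0::real"] by eventually_elim auto
  then obtain t where "I (t *\<^sub>R w) / t\<^sup>2 < \<epsilon>" "0 < t"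
    using eventually_happens by fastforce
  then show ?thesis by (auto simp: field_simps intro!: exI[of _ t])
qed

text \<open>Along the ray of \<open>w\<close> the quadratic part is positive, and \<open>I\<close> is negligible against it near \<open>0\<close>.\<close>

lemma minimax_pos:
  assumes "w \<in> W" "w \<noteq> 0" "\<rho> < \<beta>"
  shows "0 < minimax \<rho> w"
proof -
  define \<epsilon> where "\<epsilon> = ((norm (S w))\<^sup>2 - \<rho> * (norm w)\<^sup>2) / 2"
  have "\<rho> * (norm w)\<^sup>2 < \<beta> * (norm w)\<^sup>2" using assms by simp
  then have "0 < \<epsilon>" using form_W[OF assms(1)] by (simp add: \<epsilon>_def)
  then obtain t where t: "0 < t" "I (t *\<^sub>R w) < \<epsilon> * t\<^sup>2"
    using I_small_on_ray[of w \<epsilon>] assms W_E by blast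
  have "energy \<rho> (t *\<^sub>R w) = \<epsilon> * t\<^sup>2 - I (t *\<^sub>R w)"
    using assms by (simp add: energy_def S_scale W_E \<epsilon>_def power_mult_distrib algebra_simps diff_divide_distrib)
  then have "0 < energy \<rho> (t *\<^sub>R w)" using t by simp
  also have "\<dots> \<le> minimax \<rho> w" using assms t by (intro energy_le_minimax ray_halfspace) auto
  finally show ?thesis .
qed

lemma energy_zero: "energy \<rho> 0 = 0"
  by (simp add: energy_def S_zero I_zero)

lemma minimax_nonneg: "w \<in> W \<Longrightarrow> w \<noteq> 0 \<Longrightarrow> 0 \<le> minimax \<rho> w"
  using energy_le_minimax[OF _ _ V_halfspace[OF V_zero], of w \<rho>] by (simp add: energy_zero)

lemma energy_V_nonpos:
  assumes "v \<in> V" "\<alpha> \<le> \<rho>"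
  shows "energy \<rho> v \<le> 0"
proof -
  have "(norm (S v))\<^sup>2 \<le> \<rho> * (norm v)\<^sup>2"
    using V_form[OF assms(1)] assms(2) by (meson mult_right_mono order_trans zero_le_power2)
  moreover have "0 \<le> I v" using I_pos[of v] I_zero V_in_E assms by (cases "v = 0") (auto intro: less_imp_le)
  ultimately show ?thesis by (simp add: energy_def)
qed

end

section \<open>Minimization of the penalized minimax value\<close>

context gap_problem
begin

text \<open>The directions are normalized in \<open>E\<close>, which does not change their half-spaces, and a weak limit \<open>x\<close> is taken.
  If \<open>x = 0\<close>, the energy at \<open>t w\<^sub>k\<close> tends to \<open>t\<^sup>2 / 2\<close> for every \<open>t\<close>, which contradicts the upper bound.  So \<open>x \<noteq> 0\<close>, and
  the maximizer \<open>p\<close> for the limit is compared with the points of the other half-spaces that have the same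
  coordinates as \<open>p\<close>: only \<open>\<parallel>S p\<parallel>\<^sup>2\<close> can drop in the limit.\<close>

lemma minimax_lsc:
  assumes w: "\<And>k. w k \<in> W" "\<And>k. w k \<noteq> 0" and \<rho>: "\<rho>s \<longlonglongrightarrow> \<rho>"
    and bound: "\<And>k. minimax (\<rho>s k) (w k) \<le> a k" and a: "a \<longlonglongrightarrow> a0"
  shows "\<exists>w0\<in>W. w0 \<noteq> 0 \<and> minimax \<rho> w0 \<le> a0"
proof -
  define n where "n k = sqrt ((norm (w k))\<^sup>2 + (norm (S (w k)))\<^sup>2)" for k
  have n: "0 < n k" for k using w(2)[of k] unfolding n_def by (simp add: add_pos_nonneg)
  define u where "u k = (1 / n k) *\<^sub>R w k" for k
  have uW: "u k \<in> W" and u0: "u k \<noteq> 0" for k using w[of k] n[of k] by (auto simp: u_def W_scale)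
  have n_sq: "(n k)\<^sup>2 = (norm (w k))\<^sup>2 + (norm (S (w k)))\<^sup>2" for k by (simp add: n_def)
  have u1: "(norm (u k))\<^sup>2 + (norm (S (u k)))\<^sup>2 = 1" for k
    using n[of k] by (simp add: u_def S_scale W_E w power_mult_distrib power_divide n_sq
        add_divide_distrib[symmetric])
  have minu: "minimax (\<rho>s k) (u k) \<le> a k" for k
    using bound[of k] n[of k] by (simp add: u_def minimax_scale)
  have bnd: "norm (u k) \<le> 1" "norm (S (u k)) \<le> 1" for k
    using u1[of k] by (smt (verit) zero_le_power2 power2_le_imp_le one_power2)+
  from compact_embedding[of u, OF W_E[OF uW] bnd]
  obtain r x where r: "strict_mono (r :: nat \<Rightarrow> nat)" "x \<in> E" "(u \<circ> r) \<longlonglongrightarrow> x"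
    "\<forall>v. (\<lambda>k. S (u (r k)) \<bullet> v) \<longlonglongrightarrow> S x \<bullet> v" by blast
  have ulim: "(\<lambda>k. u (r k)) \<longlonglongrightarrow> x" using r(3) by (simp add: comp_def)
  have \<rho>lim: "(\<lambda>k. \<rho>s (r k)) \<longlonglongrightarrow> \<rho>" using LIMSEQ_subseq_LIMSEQ[OF \<rho> r(1)] by (simp add: comp_def)
  have alim: "(\<lambda>k. a (r k)) \<longlonglongrightarrow> a0" using LIMSEQ_subseq_LIMSEQ[OF a r(1)] by (simp add: comp_def)
  have xW: "x \<in> W"
  proof -
    have "x \<bullet> v = 0" if "v \<in> V" for v
    proof -
      have "(\<lambda>k. u (r k) \<bullet> v) \<longlonglongrightarrow> x \<bullet> v" by (intro tendsto_intros ulim)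
      then show ?thesis using W_V[OF uW that] by (simp add: LIMSEQ_const_iff)
    qed
    then show ?thesis using r(2) by (simp add: W_def)
  qed
  have Ilim: "(\<lambda>k. I (t *\<^sub>R u (r k) + v)) \<longlonglongrightarrow> I (t *\<^sub>R x + v)" if "v \<in> V" for t v
  proof (rule I_weak)
    show "(\<lambda>k. t *\<^sub>R u (r k) + v) \<longlonglongrightarrow> t *\<^sub>R x + v" by (intro tendsto_intros ulim)
    show "(\<lambda>k. S (t *\<^sub>R u (r k) + v) \<bullet> z) \<longlonglongrightarrow> S (t *\<^sub>R x + v) \<bullet> z" for z
      unfolding S_split[OF uW that] S_split[OF xW that] inner_add_left inner_scaleR_left
      by (intro tendsto_add tendsto_mult tendsto_const r(4)[rule_format])
  qed (use r(2) that uW in \<open>auto simp: E_add E_scale V_in_E W_E\<close>)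
  have x0: "x \<noteq> 0"
  proof
    assume x: "x = 0"
    have lim: "(\<lambda>k. t\<^sup>2 * (1 - (norm (u (r k)))\<^sup>2 - \<rho>s (r k) * (norm (u (r k)))\<^sup>2) / 2 - I (t *\<^sub>R u (r k) + 0))
       \<longlonglongrightarrow> t\<^sup>2 * (1 - (norm x)\<^sup>2 - \<rho> * (norm x)\<^sup>2) / 2 - I (t *\<^sub>R x + 0)" for t
      by (intro tendsto_intros ulim \<rho>lim Ilim V_zero) auto
    have "t\<^sup>2 / 2 \<le> a0" if "0 \<le> t" for t
    proof -
      have "t\<^sup>2 * (1 - (norm (u (r k)))\<^sup>2 - \<rho>s (r k) * (norm (u (r k)))\<^sup>2) / 2 - I (t *\<^sub>R u (r k) + 0) \<le> a (r k)" for k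
      proof -
        have "energy (\<rho>s (r k)) (t *\<^sub>R u (r k)) \<le> minimax (\<rho>s (r k)) (u (r k))"
          using that by (intro energy_le_minimax ray_halfspace uW u0)
        moreover have "energy (\<rho>s (r k)) (t *\<^sub>R u (r k)) = 
           t\<^sup>2 * (1 - (norm (u (r k)))\<^sup>2 - \<rho>s (r k) * (norm (u (r k)))\<^sup>2) / 2 - I (t *\<^sub>R u (r k) + 0)"
        proof -
          have e1: "(norm (S (u (r k))))\<^sup>2 = 1 - (norm (u (r k)))\<^sup>2" using u1[of "r k"] by linarith
          show ?thesis using uW by (simp add: energy_def S_scale W_E power_mult_distrib e1 algebra_simps)
        qed
        ultimately show ?thesis using minu[of "r k"] by linarith
      qed
      then have "t\<^sup>2 * (1 - (norm x)\<^sup>2 - \<rho> * (norm x)\<^sup>2) / 2 - I (t *\<^sub>R x + 0) \<le> a0"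
        by (intro LIMSEQ_le[OF lim alim]) auto
      then show ?thesis by (simp add: x I_zero)
    qed
    \<comment> \<open>Any \<open>t\<close> with \<open>t\<^sup>2 / 2 > a0\<close> does.\<close>
    from this[of "2 * (\<bar>a0\<bar> + 1)"] have "2 * (\<bar>a0\<bar> + 1)\<^sup>2 \<le> a0" unfolding power_mult_distrib by simp
    moreover have "\<bar>a0\<bar> + 1 \<le> (\<bar>a0\<bar> + 1)\<^sup>2" by (intro self_le_power) auto
    ultimately show False by linarith
  qed
  obtain p where p: "p \<in> halfspace x" "energy \<rho> p = minimax \<rho> x"
    using halfspace_maximizer(2)[OF xW x0] by blast
  then obtain t v where tv: "p = t *\<^sub>R x + v" "0 \<le> t" "v \<in> V" by (auto simp: halfspace_def)
  define q where "q k = t *\<^sub>R u (r k) + v" for k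
  have qE: "q k \<in> E" for k using uW tv by (simp add: q_def E_add E_scale W_E V_in_E)
  have qlim: "q \<longlonglongrightarrow> p" unfolding q_def tv by (intro tendsto_intros ulim)
  have Sqlim: "(\<lambda>k. S (q k) \<bullet> S p) \<longlonglongrightarrow> S p \<bullet> S p"
    unfolding q_def tv(1) S_split[OF uW tv(3)] S_split[OF xW tv(3)] inner_add_left inner_scaleR_left
    by (intro tendsto_add tendsto_mult tendsto_const r(4)[rule_format])
  have Iq: "(\<lambda>k. I (q k)) \<longlonglongrightarrow> I p" unfolding q_def tv using Ilim tv by blast
  have "(2 * (S (q k) \<bullet> S p) - S p \<bullet> S p - \<rho>s (r k) * (norm (q k))\<^sup>2) / 2 - I (q k) \<le> a (r k)" for k
  proof -
    \<comment> \<open>Weak lower semicontinuity of the norm: the bound is linear in \<open>S (q k)\<close>, so it passes to the weak limit.\<close>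
    have "0 \<le> (norm (S (q k) - S p))\<^sup>2" by simp
    then have "2 * (S (q k) \<bullet> S p) - S p \<bullet> S p \<le> (norm (S (q k)))\<^sup>2"
      by (simp add: power2_norm_eq_inner inner_diff_left inner_diff_right inner_commute)
    then have "(2 * (S (q k) \<bullet> S p) - S p \<bullet> S p - \<rho>s (r k) * (norm (q k))\<^sup>2) / 2 - I (q k) \<le> energy (\<rho>s (r k)) (q k)"
      by (simp add: energy_def)
    also have "\<dots> \<le> minimax (\<rho>s (r k)) (u (r k))"
      using tv by (intro energy_le_minimax uW u0) (auto simp: q_def halfspace_def)
    finally show ?thesis using minu[of "r k"] by linarith
  qed
  moreover have "(\<lambda>k. (2 * (S (q k) \<bullet> S p) - S p \<bullet> S p - \<rho>s (r k) * (norm (q k))\<^sup>2) / 2 - I (q k))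
     \<longlonglongrightarrow> (2 * (S p \<bullet> S p) - S p \<bullet> S p - \<rho> * (norm p)\<^sup>2) / 2 - I p"
    by (intro tendsto_intros Sqlim qlim \<rho>lim Iq) auto
  ultimately have "(2 * (S p \<bullet> S p) - S p \<bullet> S p - \<rho> * (norm p)\<^sup>2) / 2 - I p \<le> a0"
    using LIMSEQ_le alim by blast
  then have "energy \<rho> p \<le> a0" by (simp add: energy_def power2_norm_eq_inner)
  then show ?thesis using p(2) xW x0 by auto
qed

text \<open>The direct method: parameters of a minimizing sequence accumulate in \<open>L\<close>, and \<open>minimax_lsc\<close> provides the
  direction.  A singleton \<open>L\<close> gives the least minimax value for a fixed parameter.\<close>

lemma penalized_minimum:
  assumes "closed L" "bounded L" "L \<noteq> {}" "\<And>\<rho>. \<rho> \<in> L \<Longrightarrow> 0 \<le> \<rho>" "0 \<le> c"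
  shows "\<exists>\<rho>\<in>L. \<exists>w\<in>W. w \<noteq> 0 \<and> (\<forall>\<rho>'\<in>L. \<forall>w'\<in>W. w' \<noteq> 0 \<longrightarrow>
     minimax \<rho> w + c * \<rho> \<le> minimax \<rho>' w' + c * \<rho>')"
proof -
  define G where "G = {minimax \<rho> w + c * \<rho> | \<rho> w. \<rho> \<in> L \<and> w \<in> W \<and> w \<noteq> 0}"
  define m where "m = Inf G"
  have bdd: "bdd_below G"
    unfolding G_def using assms(4,5) minimax_nonneg by (intro bdd_belowI[of _ 0]) (auto intro!: add_nonneg_nonneg)
  have ne: "G \<noteq> {}"
  proof -
    obtain w where "w \<in> W" "w \<noteq> 0" using upper_eigenvector by (auto simp: W_def)
    then show ?thesis using assms(3) by (auto simp: G_def)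
  qed
  have "\<exists>g\<in>G. g < m + 1 / Suc k" for k :: nat
    using cInf_less_iff[OF ne bdd, of "m + 1 / Suc k"] by (simp add: m_def)
  then have "\<forall>k::nat. \<exists>\<rho> w. \<rho> \<in> L \<and> w \<in> W \<and> w \<noteq> 0 \<and> minimax \<rho> w + c * \<rho> < m + 1 / Suc k"
    unfolding G_def by blast
  then obtain \<rho>s w where s: "\<And>k::nat. \<rho>s k \<in> L" "\<And>k. w k \<in> W" "\<And>k. w k \<noteq> 0"
    "\<And>k. minimax (\<rho>s k) (w k) + c * \<rho>s k < m + 1 / Suc k" by metis
  have "compact L" using assms by (simp add: compact_eq_bounded_closed)
  then obtain \<rho> r where r: "\<rho> \<in> L" "strict_mono (r :: nat \<Rightarrow> nat)" "(\<rho>s \<circ> r) \<longlonglongrightarrow> \<rho>"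
    using s(1) unfolding compact_def by blast
  have lim: "(\<lambda>k. m + 1 / Suc (r k) - c * (\<rho>s \<circ> r) k) \<longlonglongrightarrow> m + 0 - c * \<rho>"
    using LIMSEQ_subseq_LIMSEQ[OF LIMSEQ_Suc[OF lim_1_over_n] r(2)]
    by (intro tendsto_diff tendsto_add tendsto_const tendsto_mult r(3)) (simp add: comp_def)
  have "\<exists>w0\<in>W. w0 \<noteq> 0 \<and> minimax \<rho> w0 \<le> m + 0 - c * \<rho>"
  proof (rule minimax_lsc[OF _ _ r(3) _ lim])
    show "minimax ((\<rho>s \<circ> r) k) (w (r k)) \<le> m + 1 / Suc (r k) - c * (\<rho>s \<circ> r) k" for k
      using s(4)[of "r k"] by simp
  qed (use s in auto)
  then obtain w0 where w0: "w0 \<in> W" "w0 \<noteq> 0" "minimax \<rho> w0 + c * \<rho> \<le> m" by auto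
  have "m \<le> minimax \<rho>' w' + c * \<rho>'" if "\<rho>' \<in> L" "w' \<in> W" "w' \<noteq> 0" for \<rho>' w'
    unfolding m_def using that by (intro cInf_lower bdd) (auto simp: G_def)
  then show ?thesis using w0 r(1) by (meson order_trans)
qed

lemma energy_shift: "energy \<rho>' p = energy \<rho> p - (\<rho>' - \<rho>) / 2 * (norm p)\<^sup>2"
  by (simp add: energy_def field_simps)

text \<open>Take \<open>w\<close> minimizing \<open>minimax \<alpha>\<close> and let \<open>\<rho>\<close> be the midpoint of the gap.  The maximizer \<open>p\<close> for \<open>(\<rho>, w)\<close> is nonzero, and
  its energy drops by \<open>(\<rho> - \<alpha>) / 2 * \<parallel>p\<parallel>\<^sup>2\<close> between \<open>\<alpha>\<close> and \<open>\<rho>\<close>; hence \<open>minimax \<rho> w < minimax \<alpha> w\<close>, and a small penalty cannot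
  compensate for the difference.\<close>

lemma left_endpoint:
  "\<exists>\<mu>\<^sub>0>0. \<forall>\<mu>. 0 < \<mu> \<and> \<mu> < \<mu>\<^sub>0 \<longrightarrow> (\<exists>\<rho>\<in>{\<alpha>..\<beta>}. \<exists>w\<in>W. w \<noteq> 0 \<and>
     (\<forall>w'\<in>W. w' \<noteq> 0 \<longrightarrow> minimax \<rho> w + \<mu>\<^sup>2 / 2 * \<rho> < minimax \<alpha> w' + \<mu>\<^sup>2 / 2 * \<alpha>))"
proof -
  obtain w where w: "w \<in> W" "w \<noteq> 0" "\<And>w'. w' \<in> W \<Longrightarrow> w' \<noteq> 0 \<Longrightarrow> minimax \<alpha> w \<le> minimax \<alpha> w'"
    using penalized_minimum[of "{\<alpha>}" 0] \<alpha>_nonneg by auto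
  define \<rho> where "\<rho> = (\<alpha> + \<beta>) / 2"
  have \<rho>: "\<alpha> < \<rho>" "\<rho> < \<beta>" using \<alpha>_less_\<beta> by (auto simp: \<rho>_def)
  obtain p where p: "p \<in> halfspace w" "energy \<rho> p = minimax \<rho> w"
    using halfspace_maximizer(2)[OF w(1,2)] by blast
  have "p \<noteq> 0" using minimax_pos[OF w(1,2) \<rho>(2)] p(2) energy_zero[of \<rho>] by auto
  define d where "d = minimax \<alpha> w - minimax \<rho> w"
  have "energy \<alpha> p \<le> minimax \<alpha> w" using w p by (intro energy_le_minimax)
  moreover have "0 < (\<rho> - \<alpha>) / 2 * (norm p)\<^sup>2" using \<rho> \<open>p \<noteq> 0\<close> by simp
  ultimately have d: "0 < d" using energy_shift[of \<rho> p \<alpha>] p(2) by (simp add: d_def)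
  show ?thesis
  proof (intro exI[of _ "sqrt (2 * d / (\<rho> - \<alpha>))"] conjI allI impI)
    show "0 < sqrt (2 * d / (\<rho> - \<alpha>))" using d \<rho> by simp
    fix \<mu> assume "0 < \<mu> \<and> \<mu> < sqrt (2 * d / (\<rho> - \<alpha>))"
    then have "\<mu>\<^sup>2 < (sqrt (2 * d / (\<rho> - \<alpha>)))\<^sup>2" by (intro power_strict_mono) auto
    also have "\<dots> = 2 * d / (\<rho> - \<alpha>)" using d \<rho> by simp
    finally have "\<mu>\<^sup>2 * (\<rho> - \<alpha>) < 2 * d" using \<rho> by (simp add: pos_less_divide_eq)
    then have "minimax \<rho> w + \<mu>\<^sup>2 / 2 * \<rho> < minimax \<alpha> w + \<mu>\<^sup>2 / 2 * \<alpha>"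
      by (simp add: d_def field_simps)
    then have "\<forall>w'\<in>W. w' \<noteq> 0 \<longrightarrow> minimax \<rho> w + \<mu>\<^sup>2 / 2 * \<rho> < minimax \<alpha> w' + \<mu>\<^sup>2 / 2 * \<alpha>"
      using w(3) by fastforce
    then show "\<exists>\<rho>\<in>{\<alpha>..\<beta>}. \<exists>w\<in>W. w \<noteq> 0 \<and>
     (\<forall>w'\<in>W. w' \<noteq> 0 \<longrightarrow> minimax \<rho> w + \<mu>\<^sup>2 / 2 * \<rho> < minimax \<alpha> w' + \<mu>\<^sup>2 / 2 * \<alpha>)"
      using w(1,2) \<rho> by (intro bexI[of _ \<rho>] bexI[of _ w]) auto
  qed
qed

text \<open>For the eigenvector \<open>w\<close> and \<open>\<rho> = \<beta> - \<delta>\<close>, the energy on the half-space is at most \<open>\<delta> / 2 * \<parallel>p\<parallel>\<^sup>2 - I p\<close>.  For small \<open>\<delta>\<close> this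
  is below \<open>\<delta> / 2 * \<mu>\<^sup>2\<close>: it is not positive if \<open>\<parallel>p\<parallel> \<ge> \<mu>\<close>, and if \<open>\<parallel>p\<parallel> < \<mu>\<close> then \<open>I p > 0\<close> suffices,
  the maximizer \<open>p\<close> being nonzero.\<close>

lemma right_endpoint:
  assumes "0 < \<mu>"
  shows "\<exists>\<rho>\<in>{\<alpha>..\<beta>}. \<exists>w\<in>W. w \<noteq> 0 \<and> minimax \<rho> w + \<mu>\<^sup>2 / 2 * \<rho> < \<mu>\<^sup>2 / 2 * \<beta>"
proof -
  obtain w where w: "w \<in> W" "w \<noteq> 0" "(norm (S w))\<^sup>2 = \<beta> * (norm w)\<^sup>2"
    using upper_eigenvector by (auto simp: W_def)
  obtain c where c: "0 < c" "\<And>p. p \<in> E \<Longrightarrow> (norm (S p))\<^sup>2 \<le> \<beta> * (norm p)\<^sup>2 \<Longrightarrow> \<mu> \<le> norm p \<Longrightarrow> c * (norm p)\<^sup>2 \<le> I p"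
    using cone_positive[OF assms, of \<beta>] by blast
  define \<delta> where "\<delta> = min (\<beta> - \<alpha>) c"
  define \<rho> where "\<rho> = \<beta> - \<delta>"
  have \<delta>: "0 < \<delta>" "\<delta> \<le> c" "\<delta> \<le> \<beta> - \<alpha>" using c \<alpha>_less_\<beta> by (auto simp: \<delta>_def)
  obtain p where p: "p \<in> halfspace w" "energy \<rho> p = minimax \<rho> w"
    using halfspace_maximizer(2)[OF w(1,2)] by blast
  then obtain t v where tv: "p = t *\<^sub>R w + v" "v \<in> V" by (auto simp: halfspace_def)
  have pE: "p \<in> E" using p w halfspace_E by blast
  have cone: "(norm (S p))\<^sup>2 \<le> \<beta> * (norm p)\<^sup>2"
    unfolding tv(1) using w tv \<alpha>_less_\<beta> by (intro halfspace_cone) auto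
  have E: "energy \<rho> p \<le> \<delta> / 2 * (norm p)\<^sup>2 - I p"
    using cone by (simp add: energy_def \<rho>_def field_simps)
  have pos: "0 < minimax \<rho> w" using minimax_pos[OF w(1,2)] \<delta> by (simp add: \<rho>_def)
  have "energy \<rho> p < \<delta> / 2 * \<mu>\<^sup>2"
  proof (cases "\<mu> \<le> norm p")
    case True
    have "c * (norm p)\<^sup>2 \<le> I p" using c(2)[OF pE cone True] .
    moreover have "\<delta> / 2 * (norm p)\<^sup>2 \<le> c * (norm p)\<^sup>2" using \<delta> by (intro mult_right_mono) auto
    ultimately have "energy \<rho> p \<le> 0" using E by linarith
    then show ?thesis using pos p(2) by simp
  next
    case False
    have "p \<noteq> 0" using pos p(2) energy_zero[of \<rho>] by auto
    then have "0 < I p" using I_pos pE by blast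
    moreover have "(norm p)\<^sup>2 \<le> \<mu>\<^sup>2" using False by (intro power_mono) auto
    then have "\<delta> / 2 * (norm p)\<^sup>2 \<le> \<delta> / 2 * \<mu>\<^sup>2" using \<delta> by (intro mult_left_mono) auto
    ultimately show ?thesis using E by linarith
  qed
  then have "minimax \<rho> w + \<mu>\<^sup>2 / 2 * \<rho> < \<mu>\<^sup>2 / 2 * \<beta>"
    using p(2) by (simp add: \<rho>_def field_simps)
  then show ?thesis using w \<delta> by (intro bexI[of _ \<rho>] bexI[of _ w]) (auto simp: \<rho>_def)
qed

end

section \<open>Uniqueness and stability of maximizers, and the critical point\<close>

context gap_problem
begin

text \<open>The derivative of \<open>energy \<rho>\<close> at \<open>u\<close> in the direction \<open>h\<close>.\<close>

definition slope :: "real \<Rightarrow> 'h \<Rightarrow> 'h \<Rightarrow> real" where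
  "slope \<rho> u h = S u \<bullet> S h - \<rho> * (u \<bullet> h) - I' u h"

lemma slope_add: "u \<in> E \<Longrightarrow> h \<in> E \<Longrightarrow> h' \<in> E \<Longrightarrow> slope \<rho> u (h + h') = slope \<rho> u h + slope \<rho> u h'"
  by (simp add: slope_def S_add I'_add inner_add_right algebra_simps)

lemma slope_scale: "u \<in> E \<Longrightarrow> h \<in> E \<Longrightarrow> slope \<rho> u (c *\<^sub>R h) = c * slope \<rho> u h"
  by (simp add: slope_def S_scale I'_scale algebra_simps)

lemma slope_tendsto:
  assumes "E_lim u x" "h \<in> E"
  shows "(\<lambda>k. slope \<rho> (u k) h) \<longlonglongrightarrow> slope \<rho> x h"
  unfolding slope_def using assms by (intro tendsto_intros I'_cont) (auto simp: E_lim_def)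

lemma energy_has_derivative:
  assumes "u \<in> E" "h \<in> E"
  shows "((\<lambda>t. energy \<rho> (u + t *\<^sub>R h)) has_real_derivative slope \<rho> (u + t *\<^sub>R h) h) (at t)"
proof -
  have sq: "((\<lambda>t. (norm (a + t *\<^sub>R b))\<^sup>2) has_real_derivative 2 * ((a + t *\<^sub>R b) \<bullet> b)) (at t)" for a b :: 'h
  proof -
    have eq: "(norm (a + t *\<^sub>R b))\<^sup>2 = a \<bullet> a + 2 * t * (a \<bullet> b) + t\<^sup>2 * (b \<bullet> b)" for t
      by (simp only: power2_norm_eq_inner inner_add_left inner_add_right inner_scaleR_left inner_scaleR_right inner_commute[of b a])
        (simp add: power2_eq_square algebra_simps)
    show ?thesis unfolding eq
      by (auto intro!: derivative_eq_intros simp: inner_add_left algebra_simps)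
  qed
  have eq: "energy \<rho> (u + t *\<^sub>R h) = ((norm (S u + t *\<^sub>R S h))\<^sup>2 - \<rho> * (norm (u + t *\<^sub>R h))\<^sup>2) / 2 - I (u + t *\<^sub>R h)" for t
    using assms by (simp add: energy_def S_add S_scale E_scale)
  have eq': "slope \<rho> (u + t *\<^sub>R h) h = (2 * ((S u + t *\<^sub>R S h) \<bullet> S h) - \<rho> * (2 * ((u + t *\<^sub>R h) \<bullet> h))) / 2 - I' (u + t *\<^sub>R h) h"
    using assms by (simp add: slope_def S_add S_scale E_scale)
  show ?thesis unfolding eq eq'
    by (intro DERIV_diff DERIV_cdivide DERIV_cmult sq I_deriv assms)
qed

text \<open>This identity explains the direction of \<open>I'\<close> in \<open>convexity\<close>: along it the linear term of a quadratic form
  accounts for the exact increment, up to the form at \<open>b\<close>.\<close>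

lemma half_norm_identity:
  fixes a b :: 'h
  shows "(norm ((1 + s) *\<^sub>R a + b))\<^sup>2 / 2 =
    (norm a)\<^sup>2 / 2 + a \<bullet> ((s * (s / 2 + 1)) *\<^sub>R a + (1 + s) *\<^sub>R b) + (norm b)\<^sup>2 / 2"
  by (simp only: power2_norm_eq_inner inner_add_left inner_add_right inner_scaleR_left inner_scaleR_right inner_commute[of b a])
    (simp add: field_simps power2_eq_square)

text \<open>The quadratic part follows the identity above, and by \<open>convexity\<close> the contribution of \<open>I\<close> has the
  right sign.  At a point where the
  slope vanishes, this compares the energy with its value at all points of the half-space.\<close>

lemma energy_comparison:
  assumes "u \<in> E" "u \<noteq> 0" "v \<in> E" "-1 \<le> s"
  defines "z \<equiv> (s * (s / 2 + 1)) *\<^sub>R u + (1 + s) *\<^sub>R v"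
  shows "energy \<rho> ((1 + s) *\<^sub>R u + v) \<le> energy \<rho> u + slope \<rho> u z + ((norm (S v))\<^sup>2 - \<rho> * (norm v)\<^sup>2) / 2"
    and "v = 0 \<Longrightarrow> s \<noteq> 0 \<Longrightarrow> energy \<rho> ((1 + s) *\<^sub>R u) < energy \<rho> u + slope \<rho> u z"
proof -
  have S1: "S ((1 + s) *\<^sub>R u + v) = (1 + s) *\<^sub>R S u + S v"
    and S2: "S z = (s * (s / 2 + 1)) *\<^sub>R S u + (1 + s) *\<^sub>R S v"
    using assms by (simp_all add: z_def S_add S_scale E_scale)
  have h1: "(norm (S ((1 + s) *\<^sub>R u + v)))\<^sup>2 / 2 = (norm (S u))\<^sup>2 / 2 + S u \<bullet> S z + (norm (S v))\<^sup>2 / 2"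
    unfolding S1 S2 by (rule half_norm_identity)
  have h2: "(norm ((1 + s) *\<^sub>R u + v))\<^sup>2 / 2 = (norm u)\<^sup>2 / 2 + u \<bullet> z + (norm v)\<^sup>2 / 2"
    unfolding z_def by (rule half_norm_identity)
  have en: "energy \<rho> p = (norm (S p))\<^sup>2 / 2 - \<rho> * ((norm p)\<^sup>2 / 2) - I p" for p
    by (simp add: energy_def diff_divide_distrib)
  have eq: "energy \<rho> ((1 + s) *\<^sub>R u + v) - (energy \<rho> u + slope \<rho> u z + ((norm (S v))\<^sup>2 - \<rho> * (norm v)\<^sup>2) / 2) =
     I u - I ((1 + s) *\<^sub>R u + v) + I' u z"
    unfolding en h1 h2 slope_def by (simp add: field_simps)
  show "energy \<rho> ((1 + s) *\<^sub>R u + v) \<le> energy \<rho> u + slope \<rho> u z + ((norm (S v))\<^sup>2 - \<rho> * (norm v)\<^sup>2) / 2"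
    using convexity[OF assms(1-4)] eq by (simp add: z_def)
  show "energy \<rho> ((1 + s) *\<^sub>R u) < energy \<rho> u + slope \<rho> u z" if "v = 0" "s \<noteq> 0"
    using convexity_strict[OF assms(1,2,4) that(2)] eq that by (simp add: z_def S_zero)
qed

text \<open>As \<open>t > 0\<close>, the maximizer is an interior point of the half-space in the subspace spanned by \<open>w\<close> and \<open>V\<close>.\<close>

lemma slope_halfspace_zero:
  assumes w: "w \<in> W" "w \<noteq> 0" and t: "0 < t" "v \<in> V"
    and max: "energy \<rho> (t *\<^sub>R w + v) = minimax \<rho> w" and v': "v' \<in> V"
  shows "slope \<rho> (t *\<^sub>R w + v) (a *\<^sub>R w + v') = 0"
proof -
  define p where "p = t *\<^sub>R w + v"
  define h where "h = a *\<^sub>R w + v'"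
  have E: "p \<in> E" "h \<in> E" using w t v' by (auto simp: p_def h_def E_add E_scale W_E V_in_E)
  have "((\<lambda>\<tau>. energy \<rho> (p + \<tau> *\<^sub>R h)) has_real_derivative slope \<rho> (p + 0 *\<^sub>R h) h) (at 0)"
    using E by (rule energy_has_derivative)
  then have D: "((\<lambda>\<tau>. energy \<rho> (p + \<tau> *\<^sub>R h)) has_real_derivative slope \<rho> p h) (at 0)" by simp
  have "slope \<rho> p h = 0"
  proof (rule DERIV_local_max[OF D])
    show "0 < t / (\<bar>a\<bar> + 1)" using t by simp
    show "\<forall>\<tau>. \<bar>0 - \<tau>\<bar> < t / (\<bar>a\<bar> + 1) \<longrightarrow> energy \<rho> (p + \<tau> *\<^sub>R h) \<le> energy \<rho> (p + 0 *\<^sub>R h)"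
    proof (intro allI impI)
      fix \<tau> assume "\<bar>0 - \<tau>\<bar> < t / (\<bar>a\<bar> + 1)"
      then have "\<bar>\<tau>\<bar> * (\<bar>a\<bar> + 1) < t" by (simp add: pos_less_divide_eq)
      moreover have "\<bar>\<tau> * a\<bar> \<le> \<bar>\<tau>\<bar> * (\<bar>a\<bar> + 1)" by (simp add: abs_mult mult_left_mono)
      ultimately have "0 \<le> t + \<tau> * a" by linarith
      moreover have "p + \<tau> *\<^sub>R h = (t + \<tau> * a) *\<^sub>R w + (v + \<tau> *\<^sub>R v')"
        by (simp add: p_def h_def algebra_simps)
      moreover have "v + \<tau> *\<^sub>R v' \<in> V" using t v' by (simp add: V_add V_scale)
      ultimately have "p + \<tau> *\<^sub>R h \<in> halfspace w" unfolding halfspace_def by blast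
      then have "energy \<rho> (p + \<tau> *\<^sub>R h) \<le> minimax \<rho> w" by (rule energy_le_minimax[OF w])
      then show "energy \<rho> (p + \<tau> *\<^sub>R h) \<le> energy \<rho> (p + 0 *\<^sub>R h)" using max by (simp add: p_def)
    qed
  qed
  then show ?thesis by (simp add: p_def h_def)
qed

lemma maximizer_off_V:
  assumes w: "w \<in> W" "w \<noteq> 0" and \<rho>: "\<alpha> \<le> \<rho>" "\<rho> < \<beta>" and t: "0 \<le> t" "v \<in> V"
    and max: "energy \<rho> (t *\<^sub>R w + v) = minimax \<rho> w"
  shows "0 < t"
proof (rule ccontr)
  assume "\<not> 0 < t"
  then have "t = 0" using t by simp
  then have "minimax \<rho> w \<le> 0" using energy_V_nonpos[OF t(2) \<rho>(1)] max by simp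
  then show False using minimax_pos[OF w \<rho>(2)] by simp
qed

text \<open>Any point of the half-space is \<open>(1 + s) p + v'\<close> with \<open>s \<ge> -1\<close> and \<open>v' \<in> V\<close>, where \<open>p\<close> is the maximizer.  The slope at \<open>p\<close> drops out of
  the comparison, and what remains is negative unless \<open>v' = 0\<close>, because \<open>\<rho> > \<alpha>\<close>, and then unless \<open>s = 0\<close>, by
  \<open>convexity_strict\<close>.\<close>

lemma maximizer_unique:
  assumes w: "w \<in> W" "w \<noteq> 0" and \<rho>: "\<alpha> < \<rho>" "\<rho> < \<beta>" and t: "0 \<le> t" "v \<in> V"
    and max: "energy \<rho> (t *\<^sub>R w + v) = minimax \<rho> w"
    and t1: "0 \<le> t1" "v1 \<in> V" and max1: "minimax \<rho> w \<le> energy \<rho> (t1 *\<^sub>R w + v1)"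
  shows "t1 = t \<and> v1 = v"
proof -
  have t0: "0 < t" using maximizer_off_V[OF w _ \<rho>(2) t max] \<rho> by simp
  define p where "p = t *\<^sub>R w + v"
  define s where "s = t1 / t - 1"
  \<comment> \<open>\<open>s\<close> and \<open>v'\<close> are the coordinates of the other point relative to \<open>p\<close>.\<close>
  define v' where "v' = v1 - (1 + s) *\<^sub>R v"
  define z where "z = (s * (s / 2 + 1)) *\<^sub>R p + (1 + s) *\<^sub>R v'"
  have pE: "p \<in> E" using w t by (simp add: p_def E_add E_scale W_E V_in_E)
  have p0: "p \<noteq> 0" using minimax_pos[OF w \<rho>(2)] max energy_zero[of \<rho>] by (auto simp: p_def)
  have v'V: "v' \<in> V" using t t1 by (simp add: v'_def V_diff V_scale)
  have s: "-1 \<le> s" using t0 t1 by (simp add: s_def)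
  have q: "t1 *\<^sub>R w + v1 = (1 + s) *\<^sub>R p + v'"
    using t0 by (simp add: p_def v'_def s_def scaleR_add_right)
  have "z = (s * (s / 2 + 1) * t) *\<^sub>R w + ((s * (s / 2 + 1)) *\<^sub>R v + (1 + s) *\<^sub>R v')"
    by (simp add: z_def p_def scaleR_add_right)
  then have z0: "slope \<rho> p z = 0"
    unfolding p_def using t v'V by (simp add: slope_halfspace_zero[OF w t0 t(2) max] V_add V_scale)
  have ge: "energy \<rho> p \<le> energy \<rho> ((1 + s) *\<^sub>R p + v')" using max max1 q by (simp add: p_def)
  have "0 \<le> ((norm (S v'))\<^sup>2 - \<rho> * (norm v')\<^sup>2) / 2"
    using energy_comparison(1)[OF pE p0 V_in_E[OF v'V] s, of \<rho>, folded z_def] ge z0 by linarith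
  then have "\<rho> * (norm v')\<^sup>2 \<le> (norm (S v'))\<^sup>2" by simp
  then have "\<rho> * (norm v')\<^sup>2 \<le> \<alpha> * (norm v')\<^sup>2" using V_form[OF v'V] by linarith
  then have v'0: "v' = 0" using \<rho>(1) by (cases "v' = 0") auto
  have "s = 0"
  proof (rule ccontr)
    assume "s \<noteq> 0"
    then show False
      using energy_comparison(2)[OF pE p0 V_in_E[OF v'V] s v'0, of \<rho>, folded z_def] ge z0 v'0 by simp
  qed
  then show ?thesis using v'0 t0 by (simp add: v'_def s_def)
qed

text \<open>By compactness a subsequence converges to a point of the limit half-space, which is again a
  maximizer; by uniqueness it is the given one.\<close>

lemma maximizers_converge:
  assumes w: "w \<in> W" "w \<noteq> 0" and \<rho>: "\<alpha> < \<rho>" "\<rho> < \<beta>" and t: "0 \<le> t" "v \<in> V"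
    and max: "energy \<rho> (t *\<^sub>R w + v) = minimax \<rho> w"
    and \<rho>s: "\<rho>s \<longlonglongrightarrow> \<rho>" and ws: "\<And>k. ws k \<in> W" "\<And>k. ws k \<noteq> 0" "E_lim ws w"
    and ts: "\<And>k. 0 \<le> ts k" "\<And>k. vs k \<in> V"
    and maxs: "\<And>k. energy (\<rho>s k) (ts k *\<^sub>R ws k + vs k) = minimax (\<rho>s k) (ws k)"
  shows "\<exists>r. strict_mono (r :: nat \<Rightarrow> nat) \<and> (ts \<circ> r) \<longlonglongrightarrow> t \<and> E_lim (vs \<circ> r) v"
proof -
  have low: "- 0 \<le> energy (\<rho>s k) (ts k *\<^sub>R ws k + vs k)" for k
    using maxs[of k] minimax_nonneg[OF ws(1,2), of "\<rho>s k" k] by simp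
  obtain r t0 v0 where r: "strict_mono (r :: nat \<Rightarrow> nat)" "0 \<le> t0" "v0 \<in> V"
    "(ts \<circ> r) \<longlonglongrightarrow> t0" "E_lim (vs \<circ> r) v0"
    by (rule halfspace_compact[OF \<rho>s ws(1,3) w ts low])
  have \<rho>r: "(\<lambda>k. \<rho>s (r k)) \<longlonglongrightarrow> \<rho>" using LIMSEQ_subseq_LIMSEQ[OF \<rho>s r(1)] by (simp add: comp_def)
  have wr: "E_lim (\<lambda>k. ws (r k)) w" using ws(3) r(1) by (rule E_lim_subseq)
  have lim: "(\<lambda>k. energy (\<rho>s (r k)) ((ts \<circ> r) k *\<^sub>R ws (r k) + (vs \<circ> r) k)) \<longlonglongrightarrow> energy \<rho> (t0 *\<^sub>R w + v0)"
    by (rule energy_ray_tendsto[OF \<rho>r wr r(5,4)])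
  have lim': "(\<lambda>k. energy (\<rho>s (r k)) (t *\<^sub>R ws (r k) + v)) \<longlonglongrightarrow> energy \<rho> (t *\<^sub>R w + v)"
    by (rule energy_ray_tendsto[OF \<rho>r wr E_lim_const[OF V_in_E[OF t(2)]] tendsto_const])
  have "energy (\<rho>s (r k)) (t *\<^sub>R ws (r k) + v) \<le> energy (\<rho>s (r k)) ((ts \<circ> r) k *\<^sub>R ws (r k) + (vs \<circ> r) k)" for k
    unfolding comp_def maxs using t by (intro energy_le_minimax ws) (auto simp: halfspace_def)
  then have "energy \<rho> (t *\<^sub>R w + v) \<le> energy \<rho> (t0 *\<^sub>R w + v0)"
    using LIMSEQ_le[OF lim' lim] by blast
  then have "t0 = t \<and> v0 = v"
    using maximizer_unique[OF w \<rho> t max r(2,3)] max by simp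
  then show ?thesis using r by blast
qed

lemma maximizer_exists:
  assumes "w \<in> W" "w \<noteq> 0"
  shows "\<exists>t v. 0 \<le> t \<and> v \<in> V \<and> energy \<rho> (t *\<^sub>R w + v) = minimax \<rho> w"
  using halfspace_maximizer(2)[OF assms, of \<rho>] unfolding halfspace_def by blast

text \<open>Let \<open>p\<^sub>k\<close> be maximizers for the parameters \<open>\<rho> + \<epsilon> / (k + 1)\<close>.  Minimality at \<open>\<rho>\<close>, maximality of the given point at \<open>\<rho>\<close> and the affine dependence of the
  energy on the parameter give the inequality with \<open>p\<^sub>k\<close> in place of the maximizer for \<open>\<rho>\<close>, and \<open>p\<^sub>k\<close> converges
  to it along a subsequence.\<close>

lemma stationary_in_parameter:
  assumes w: "w \<in> W" "w \<noteq> 0" and \<rho>: "\<alpha> < \<rho>" "\<rho> < \<beta>" and t: "0 \<le> t" "v \<in> V"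
    and max: "energy \<rho> (t *\<^sub>R w + v) = minimax \<rho> w"
    and min: "\<And>\<rho>'. \<rho>' \<in> {\<alpha>..\<beta>} \<Longrightarrow> minimax \<rho> w + \<mu>\<^sup>2 / 2 * \<rho> \<le> minimax \<rho>' w + \<mu>\<^sup>2 / 2 * \<rho>'"
    and \<epsilon>: "\<rho> + \<epsilon> \<in> {\<alpha>..\<beta>}"
  shows "0 \<le> \<epsilon> * (\<mu>\<^sup>2 - (norm (t *\<^sub>R w + v))\<^sup>2)"
proof -
  define \<rho>s where "\<rho>s k = \<rho> + \<epsilon> * (1 / real (Suc k))" for k
  have "(\<lambda>k. \<rho> + \<epsilon> * (1 / real (Suc k))) \<longlonglongrightarrow> \<rho> + \<epsilon> * 0"
    by (intro tendsto_intros LIMSEQ_Suc[OF lim_1_over_n])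
  then have \<rho>s: "\<rho>s \<longlonglongrightarrow> \<rho>" by (simp add: \<rho>s_def[abs_def])
  have "\<rho>s k \<in> {\<alpha>..\<beta>}" for k
  proof -
    define e where "e = 1 / real (Suc k)"
    have "0 \<le> e" "e \<le> 1" by (auto simp: e_def)
    then have "(1 - e) *\<^sub>R \<rho> + e *\<^sub>R (\<rho> + \<epsilon>) \<in> {\<alpha>..\<beta>}"
      using \<rho> \<epsilon> by (intro convexD convex_real_interval) auto
    moreover have "\<rho>s k = (1 - e) *\<^sub>R \<rho> + e *\<^sub>R (\<rho> + \<epsilon>)"
      unfolding \<rho>s_def e_def[symmetric] by (simp add: algebra_simps)
    ultimately show ?thesis by simp
  qed
  note \<rho>s_in = this
  have "\<forall>k. \<exists>t v. 0 \<le> t \<and> v \<in> V \<and> energy (\<rho>s k) (t *\<^sub>R w + v) = minimax (\<rho>s k) w"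
    using maximizer_exists[OF w] by blast
  then obtain ts vs where ts: "\<And>k. 0 \<le> ts k" "\<And>k. vs k \<in> V"
    "\<And>k. energy (\<rho>s k) (ts k *\<^sub>R w + vs k) = minimax (\<rho>s k) w" by metis
  obtain r where r: "strict_mono (r :: nat \<Rightarrow> nat)" "(ts \<circ> r) \<longlonglongrightarrow> t" "E_lim (vs \<circ> r) v"
    using maximizers_converge[OF w \<rho> t max \<rho>s w E_lim_const[OF W_E[OF w(1)]] ts] by blast
  define p where "p k = (ts \<circ> r) k *\<^sub>R w + (vs \<circ> r) k" for k
  have plim: "p \<longlonglongrightarrow> t *\<^sub>R w + v"
    unfolding p_def using r by (intro tendsto_intros) (auto simp: E_lim_def comp_def)
  have "0 \<le> \<epsilon> * (\<mu>\<^sup>2 - (norm (p k))\<^sup>2)" for k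
  proof -
    define \<eta> where "\<eta> = 1 / real (Suc (r k))"
    have \<eta>: "0 < \<eta>" by (simp add: \<eta>_def)
    have \<rho>k: "\<rho>s (r k) = \<rho> + \<epsilon> * \<eta>" by (simp add: \<rho>s_def \<eta>_def)
    have "energy \<rho> (p k) \<le> minimax \<rho> w"
      unfolding p_def using ts by (intro energy_le_minimax w) (auto simp: halfspace_def)
    moreover have "minimax \<rho> w + \<mu>\<^sup>2 / 2 * \<rho> \<le> minimax (\<rho>s (r k)) w + \<mu>\<^sup>2 / 2 * \<rho>s (r k)"
      using min \<rho>s_in by blast
    moreover have "minimax (\<rho>s (r k)) w = energy \<rho> (p k) - (\<rho>s (r k) - \<rho>) / 2 * (norm (p k))\<^sup>2"
      using ts(3)[of "r k"] energy_shift[of "\<rho>s (r k)" "p k" \<rho>] by (simp add: p_def)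
    ultimately have "0 \<le> (\<mu>\<^sup>2 / 2 * (\<rho> + \<epsilon> * \<eta>) - \<mu>\<^sup>2 / 2 * \<rho>) - (\<rho> + \<epsilon> * \<eta> - \<rho>) / 2 * (norm (p k))\<^sup>2"
      unfolding \<rho>k by linarith
    then have "0 \<le> \<eta> * (\<epsilon> * (\<mu>\<^sup>2 - (norm (p k))\<^sup>2))" by (simp add: algebra_simps)
    then show ?thesis using \<eta> by (simp add: zero_le_mult_iff)
  qed
  moreover have "(\<lambda>k. \<epsilon> * (\<mu>\<^sup>2 - (norm (p k))\<^sup>2)) \<longlonglongrightarrow> \<epsilon> * (\<mu>\<^sup>2 - (norm (t *\<^sub>R w + v))\<^sup>2)"
    by (intro tendsto_intros plim)
  ultimately show ?thesis by (intro LIMSEQ_le_const) auto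
qed

text \<open>Let \<open>w\<^sub>k = w + \<tau>\<^sub>k h\<close> with \<open>\<tau>\<^sub>k \<down> 0\<close> have the maximizers \<open>s\<^sub>k w\<^sub>k + v\<^sub>k\<close>.  Their energies are at least \<open>minimax \<rho> w\<close> by
  minimality, whereas the points \<open>s\<^sub>k w + v\<^sub>k\<close> of the half-space of \<open>w\<close> have at most this energy.  For large \<open>k\<close> the two points differ by a positive
  multiple of \<open>h\<close>, so the mean value theorem gives a point between them where the slope in the direction \<open>h\<close> is
  nonnegative; along a subsequence these points converge to the maximizer for \<open>w\<close>.\<close>

lemma stationary_in_direction:
  assumes w: "w \<in> W" "w \<noteq> 0" and \<rho>: "\<alpha> < \<rho>" "\<rho> < \<beta>" and t: "0 \<le> t" "v \<in> V"
    and max: "energy \<rho> (t *\<^sub>R w + v) = minimax \<rho> w"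
    and min: "\<And>w'. w' \<in> W \<Longrightarrow> w' \<noteq> 0 \<Longrightarrow> minimax \<rho> w \<le> minimax \<rho> w'"
    and h: "h \<in> W"
  shows "0 \<le> slope \<rho> (t *\<^sub>R w + v) h"
proof -
  have t0: "0 < t" using maximizer_off_V[OF w _ \<rho>(2) t max] \<rho> by simp
  \<comment> \<open>So small that no perturbed direction \<open>w + \<tau> h\<close> with \<open>\<tau> \<le> \<epsilon>\<close> vanishes.\<close>
  define \<epsilon> where "\<epsilon> = norm w / (2 * (norm h + 1))"
  have \<epsilon>: "0 < \<epsilon>" "\<epsilon> * norm h < norm w"
  proof -
    have h1: "0 < 2 * (norm h + 1)" by (simp add: add_nonneg_pos)
    then show "0 < \<epsilon>" using w by (simp add: \<epsilon>_def)
    have "x < 2 * (x + 1)" if "0 \<le> x" for x :: real using that by simp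
    from this[OF norm_ge_zero] have "norm h < 2 * (norm h + 1)" .
    then have "norm w * norm h < norm w * (2 * (norm h + 1))" using w by simp
    then show "\<epsilon> * norm h < norm w" using h1 by (simp add: \<epsilon>_def pos_divide_less_eq)
  qed
  define \<tau> where "\<tau> k = \<epsilon> * (1 / real (Suc k))" for k
  have "(\<lambda>k. \<epsilon> * (1 / real (Suc k))) \<longlonglongrightarrow> \<epsilon> * 0" by (intro tendsto_intros LIMSEQ_Suc[OF lim_1_over_n])
  then have \<tau>lim: "\<tau> \<longlonglongrightarrow> 0" by (simp add: \<tau>_def[abs_def])
  have \<tau>: "0 < \<tau> k" "\<tau> k \<le> \<epsilon>" for k using \<epsilon> by (auto simp: \<tau>_def field_simps)
  define ws where "ws k = \<tau> k *\<^sub>R h + w" for k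
  have ws: "ws k \<in> W" "ws k \<noteq> 0" for k
  proof -
    show "ws k \<in> W" using w h by (simp add: ws_def W_add W_scale)
    have "norm (\<tau> k *\<^sub>R h) \<le> \<epsilon> * norm h" using \<tau>[of k] by (simp add: mult_right_mono)
    then have "norm (\<tau> k *\<^sub>R h) \<noteq> norm w" using \<epsilon> by linarith
    then show "ws k \<noteq> 0" unfolding ws_def by (metis add_eq_0_iff norm_minus_cancel)
  qed
  have "E_lim (\<lambda>k. \<tau> k *\<^sub>R h + w) (0 *\<^sub>R h + w)"
    using w h by (intro E_lim_combination E_lim_const W_E \<tau>lim)
  then have wslim: "E_lim ws w" by (simp add: ws_def[abs_def])
  have "\<forall>k. \<exists>t v. 0 \<le> t \<and> v \<in> V \<and> energy \<rho> (t *\<^sub>R ws k + v) = minimax \<rho> (ws k)"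
    using maximizer_exists[OF ws] by blast
  then obtain ts vs where ts: "\<And>k. 0 \<le> ts k" "\<And>k. vs k \<in> V"
    "\<And>k. energy \<rho> (ts k *\<^sub>R ws k + vs k) = minimax \<rho> (ws k)" by metis
  have "\<exists>r. strict_mono (r :: nat \<Rightarrow> nat) \<and> (ts \<circ> r) \<longlonglongrightarrow> t \<and> E_lim (vs \<circ> r) v"
    by (rule maximizers_converge[OF w \<rho> t max _ ws wslim ts]) auto
  then obtain r where r: "strict_mono (r :: nat \<Rightarrow> nat)" "(ts \<circ> r) \<longlonglongrightarrow> t" "E_lim (vs \<circ> r) v" by blast
  have hE: "h \<in> E" using h W_E by blast
  define a where "a k = (ts \<circ> r) k *\<^sub>R w + (vs \<circ> r) k" for k
  have aE: "a k \<in> E" for k using w ts by (simp add: a_def E_add E_scale W_E V_in_E)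
  have alim: "E_lim a (t *\<^sub>R w + v)"
    unfolding a_def[abs_def] by (intro E_lim_combination r E_lim_const W_E w)
  have t_pos: "eventually (\<lambda>k. 0 < (ts \<circ> r) k) sequentially"
    using order_tendstoD(1)[OF r(2) t0] .
  define \<sigma> where "\<sigma> k = (ts \<circ> r) k * \<tau> (r k)" for k
  \<comment> \<open>The indices with \<open>ts (r k) = 0\<close> are finitely many; there \<open>\<theta> = 0\<close> will do.\<close>
  have step: "\<exists>\<theta>. \<bar>\<theta>\<bar> \<le> \<bar>\<sigma> k\<bar> \<and> (0 < (ts \<circ> r) k \<longrightarrow> 0 \<le> slope \<rho> (a k + \<theta> *\<^sub>R h) h)" for k
  proof (cases "0 < (ts \<circ> r) k")
    case True
    then have \<sigma>: "0 < \<sigma> k" using \<tau>(1) by (simp add: \<sigma>_def)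
    have "\<exists>\<theta>. 0 < \<theta> \<and> \<theta> < \<sigma> k \<and> energy \<rho> (a k + \<sigma> k *\<^sub>R h) - energy \<rho> (a k + 0 *\<^sub>R h)
       = (\<sigma> k - 0) * slope \<rho> (a k + \<theta> *\<^sub>R h) h"
      by (rule MVT2[OF \<sigma>]) (rule energy_has_derivative[OF aE hE])
    then obtain \<theta> where \<theta>: "0 < \<theta>" "\<theta> < \<sigma> k"
      "energy \<rho> (a k + \<sigma> k *\<^sub>R h) - energy \<rho> (a k) = \<sigma> k * slope \<rho> (a k + \<theta> *\<^sub>R h) h" by auto
    have "a k + \<sigma> k *\<^sub>R h = ts (r k) *\<^sub>R ws (r k) + vs (r k)"
      by (simp add: a_def \<sigma>_def ws_def scaleR_add_right)
    then have "energy \<rho> (a k + \<sigma> k *\<^sub>R h) = minimax \<rho> (ws (r k))" using ts(3) by simp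
    then have "minimax \<rho> w \<le> energy \<rho> (a k + \<sigma> k *\<^sub>R h)" using min[OF ws] by simp
    moreover have "energy \<rho> (a k) \<le> minimax \<rho> w"
      unfolding a_def using ts by (intro energy_le_minimax w) (auto simp: halfspace_def)
    ultimately have "0 \<le> \<sigma> k * slope \<rho> (a k + \<theta> *\<^sub>R h) h" using \<theta>(3) by linarith
    then have "0 \<le> slope \<rho> (a k + \<theta> *\<^sub>R h) h" using \<sigma> by (simp add: zero_le_mult_iff)
    then show ?thesis using \<theta> \<sigma> by (intro exI[of _ \<theta>]) auto
  qed auto
  then obtain \<theta> where \<theta>: "\<And>k. \<bar>\<theta> k\<bar> \<le> \<bar>\<sigma> k\<bar>" "\<And>k. 0 < (ts \<circ> r) k \<Longrightarrow> 0 \<le> slope \<rho> (a k + \<theta> k *\<^sub>R h) h"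
    by metis
  have "(\<lambda>k. \<tau> (r k)) \<longlonglongrightarrow> 0" using LIMSEQ_subseq_LIMSEQ[OF \<tau>lim r(1)] by (simp add: comp_def)
  then have "\<sigma> \<longlonglongrightarrow> t * 0" unfolding \<sigma>_def[abs_def] by (intro tendsto_mult r(2))
  then have "\<sigma> \<longlonglongrightarrow> 0" by simp
  then have "\<theta> \<longlonglongrightarrow> 0" by (rule Lim_null_comparison[rotated, OF tendsto_rabs_zero]) (use \<theta>(1) in auto)
  then have "E_lim (\<lambda>k. \<theta> k *\<^sub>R h + a k) (0 *\<^sub>R h + (t *\<^sub>R w + v))"
    by (intro E_lim_combination E_lim_const hE alim)
  then have lim: "E_lim (\<lambda>k. a k + \<theta> k *\<^sub>R h) (t *\<^sub>R w + v)" by (simp add: add.commute)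
  show ?thesis
  proof (rule tendsto_lowerbound[OF slope_tendsto[OF lim hE]])
    show "eventually (\<lambda>k. 0 \<le> slope \<rho> (a k + \<theta> k *\<^sub>R h) h) sequentially"
      using t_pos by eventually_elim (rule \<theta>(2))
  qed simp
qed

text \<open>Inside the gap the parameter can be varied in both directions, and so can \<open>w\<close>, so both one-sided
  conditions become equalities.\<close>

theorem normalized_solution_in_gap:
  "\<exists>\<mu>\<^sub>0>0. \<forall>\<mu>. 0 < \<mu> \<and> \<mu> < \<mu>\<^sub>0 \<longrightarrow> (\<exists>\<rho> u. \<alpha> < \<rho> \<and> \<rho> < \<beta> \<and> u \<in> E \<and> norm u = \<mu> \<and>
     (\<forall>v\<in>E. S u \<bullet> S v = \<rho> * (u \<bullet> v) + I' u v))"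
proof -
  obtain \<mu>\<^sub>0 where \<mu>\<^sub>0: "0 < \<mu>\<^sub>0" "\<forall>\<mu>. 0 < \<mu> \<and> \<mu> < \<mu>\<^sub>0 \<longrightarrow> (\<exists>\<rho>\<in>{\<alpha>..\<beta>}. \<exists>w\<in>W. w \<noteq> 0 \<and>
     (\<forall>w'\<in>W. w' \<noteq> 0 \<longrightarrow> minimax \<rho> w + \<mu>\<^sup>2 / 2 * \<rho> < minimax \<alpha> w' + \<mu>\<^sup>2 / 2 * \<alpha>))"
    using left_endpoint by (elim exE conjE) (rule that; assumption)
  show ?thesis
  proof (rule exI[of _ "\<mu>\<^sub>0"], intro conjI allI impI \<mu>\<^sub>0(1))
    fix \<mu> assume "0 < \<mu> \<and> \<mu> < \<mu>\<^sub>0"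
    then have \<mu>: "0 < \<mu>" "\<mu> < \<mu>\<^sub>0" by auto
    obtain \<rho> w where m: "\<rho> \<in> {\<alpha>..\<beta>}" "w \<in> W" "w \<noteq> 0"
      "\<And>\<rho>' w'. \<rho>' \<in> {\<alpha>..\<beta>} \<Longrightarrow> w' \<in> W \<Longrightarrow> w' \<noteq> 0 \<Longrightarrow> minimax \<rho> w + \<mu>\<^sup>2 / 2 * \<rho> \<le> minimax \<rho>' w' + \<mu>\<^sup>2 / 2 * \<rho>'"
      using penalized_minimum[of "{\<alpha>..\<beta>}" "\<mu>\<^sup>2 / 2"] \<alpha>_nonneg \<alpha>_less_\<beta> by auto
    obtain \<rho>0 w0 where "\<rho>0 \<in> {\<alpha>..\<beta>}" "w0 \<in> W" "w0 \<noteq> 0"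
      "minimax \<rho>0 w0 + \<mu>\<^sup>2 / 2 * \<rho>0 < minimax \<alpha> w + \<mu>\<^sup>2 / 2 * \<alpha>"
      using \<mu>\<^sub>0(2) \<mu> m(2,3) by blast
    then have "\<rho> \<noteq> \<alpha>" using m(4)[of \<rho>0 w0] by auto
    moreover have "\<rho> \<noteq> \<beta>"
    proof
      assume \<rho>: "\<rho> = \<beta>"
      obtain \<rho>1 w1 where "\<rho>1 \<in> {\<alpha>..\<beta>}" "w1 \<in> W" "w1 \<noteq> 0" "minimax \<rho>1 w1 + \<mu>\<^sup>2 / 2 * \<rho>1 < \<mu>\<^sup>2 / 2 * \<beta>"
        using right_endpoint[OF \<mu>(1)] by blast
      then show False using m(4)[of \<rho>1 w1] minimax_nonneg[OF m(2,3), of \<rho>] \<rho> by simp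
    qed
    ultimately have \<rho>: "\<alpha> < \<rho>" "\<rho> < \<beta>" using m(1) by auto
    obtain t v where t: "0 \<le> t" "v \<in> V" and max: "energy \<rho> (t *\<^sub>R w + v) = minimax \<rho> w"
      using maximizer_exists[OF m(2,3)] by blast
    define u where "u = t *\<^sub>R w + v"
    have uE: "u \<in> E" using m t by (simp add: u_def E_add E_scale W_E V_in_E)
    have st: "0 \<le> \<epsilon> * (\<mu>\<^sup>2 - (norm u)\<^sup>2)" if "\<rho> + \<epsilon> \<in> {\<alpha>..\<beta>}" for \<epsilon>
      unfolding u_def by (rule stationary_in_parameter[OF m(2,3) \<rho> t max m(4)[OF _ m(2,3)] that])
    have "0 \<le> (\<beta> - \<rho>) * (\<mu>\<^sup>2 - (norm u)\<^sup>2)" "0 \<le> (\<alpha> - \<rho>) * (\<mu>\<^sup>2 - (norm u)\<^sup>2)"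
      using \<rho> by (intro st; simp)+
    then have "(norm u)\<^sup>2 = \<mu>\<^sup>2" using \<rho> by (simp add: zero_le_mult_iff)
    then have nu: "norm u = \<mu>" using \<mu> by (simp add: power2_eq_iff_nonneg)
    have W_pos: "0 \<le> slope \<rho> u h" if "h \<in> W" for h
      unfolding u_def
    proof (rule stationary_in_direction[OF m(2,3) \<rho> t max _ that])
      show "minimax \<rho> w \<le> minimax \<rho> w'" if "w' \<in> W" "w' \<noteq> 0" for w'
        using m(4)[OF m(1) that] by simp
    qed
    have W0: "slope \<rho> u h = 0" if "h \<in> W" for h
    proof -
      have "0 \<le> slope \<rho> u ((-1) *\<^sub>R h)" using that by (intro W_pos W_scale)
      also have "\<dots> = - slope \<rho> u h" using slope_scale[OF uE W_E[OF that], of \<rho> "-1"] by simp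
      finally show ?thesis using W_pos[OF that] by simp
    qed
    have t0: "0 < t" using maximizer_off_V[OF m(2,3) _ \<rho>(2) t max] \<rho> by simp
    have V0: "slope \<rho> u h = 0" if "h \<in> V" for h
      using slope_halfspace_zero[OF m(2,3) t0 t(2) max that, of 0] by (simp add: u_def)
    have "slope \<rho> u h = 0" if hE: "h \<in> E" for h
    proof -
      obtain x where x: "x \<in> V" "\<forall>v'\<in>V. (h - x) \<bullet> v' = 0" using splitting[OF hE] by blast
      then have hx: "h - x \<in> W" using hE by (simp add: W_def E_diff V_in_E)
      have "slope \<rho> u (x + (h - x)) = slope \<rho> u x + slope \<rho> u (h - x)"
        using x hx by (intro slope_add uE V_in_E W_E)
      then show ?thesis using V0[OF x(1)] W0[OF hx] by simp
    qed
    then have "\<forall>h\<in>E. S u \<bullet> S h = \<rho> * (u \<bullet> h) + I' u h" by (simp add: slope_def algebra_simps)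
    then show "\<exists>\<rho> u. \<alpha> < \<rho> \<and> \<rho> < \<beta> \<and> u \<in> E \<and> norm u = \<mu> \<and> (\<forall>v\<in>E. S u \<bullet> S v = \<rho> * (u \<bullet> v) + I' u v)"
      using \<rho> uE nu by blast
  qed
qed

end

section \<open>Solutions in spectral gaps\<close>

lemma frechet_deriv_E_directional:
  fixes A :: "('h::real_inner \<times> 'h) set"
  assumes F: "frechet_deriv_E A I L w" and h: "h \<in> form_domain A"
    and scale: "\<And>c. c *\<^sub>R h \<in> form_domain A" "\<And>c. norm_E A (c *\<^sub>R h) = \<bar>c\<bar> * norm_E A h"
  shows "((\<lambda>\<eta>. (I (w + \<eta> *\<^sub>R h) - I w) / \<eta>) \<longlongrightarrow> L h) (at 0)"
proof (rule LIM_I)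
  fix \<epsilon> :: real assume \<epsilon>: "0 < \<epsilon>"
  define q where "q = \<bar>norm_E A h\<bar> + 1"
  have q: "0 < q" "norm_E A h < q" by (auto simp: q_def)
  obtain \<delta> where \<delta>: "0 < \<delta>" "\<And>v. v \<in> form_domain A \<Longrightarrow> norm_E A v < \<delta> \<Longrightarrow> \<bar>I (w + v) - I w - L v\<bar> \<le> \<epsilon> / q * norm_E A v"
    using F \<epsilon> q unfolding frechet_deriv_E_def by (meson divide_pos_pos)
  have "norm ((I (w + \<eta> *\<^sub>R h) - I w) / \<eta> - L h) < \<epsilon>" if "\<eta> \<noteq> 0" "norm (\<eta> - 0) < \<delta> / q" for \<eta>
  proof -
    have "\<bar>\<eta>\<bar> * norm_E A h \<le> \<bar>\<eta>\<bar> * q" using q by (intro mult_left_mono) auto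
    also have "\<dots> < \<delta>" using that q by (simp add: pos_less_divide_eq)
    finally have "\<bar>I (w + \<eta> *\<^sub>R h) - I w - L (\<eta> *\<^sub>R h)\<bar> \<le> \<epsilon> / q * (\<bar>\<eta>\<bar> * norm_E A h)"
      using \<delta>(2)[OF scale(1)] scale(2) by metis
    also have "\<dots> < \<epsilon> / q * (\<bar>\<eta>\<bar> * q)" using \<epsilon> q that by (intro mult_strict_left_mono) auto
    also have "\<dots> = \<epsilon> * \<bar>\<eta>\<bar>" using q by simp
    also have "L (\<eta> *\<^sub>R h) = \<eta> * L h" using F h by (auto simp: frechet_deriv_E_def dual_E_def)
    finally have "\<bar>I (w + \<eta> *\<^sub>R h) - I w - \<eta> * L h\<bar> / \<bar>\<eta>\<bar> < \<epsilon>" using that by (simp add: pos_divide_less_eq)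
    moreover have "(I (w + \<eta> *\<^sub>R h) - I w) / \<eta> - L h = (I (w + \<eta> *\<^sub>R h) - I w - \<eta> * L h) / \<eta>"
      using that by (simp add: field_simps)
    ultimately show ?thesis by (simp add: abs_divide)
  qed
  then show "\<exists>s>0. \<forall>\<eta>. \<eta> \<noteq> 0 \<and> norm (\<eta> - 0) < s \<longrightarrow> norm ((I (w + \<eta> *\<^sub>R h) - I w) / \<eta> - L h) < \<epsilon>"
    using \<delta>(1) q by (intro exI[of _ "\<delta> / q"]) auto
qed

text \<open>The hypotheses of the abstract problem are checked in an eigenbasis, where \<open>V\<close> is described by the vanishing of
  all coefficients after number \<open>n\<close>.\<close>

lemma normalized_solution_in_spectral_gap:
  fixes A :: "('h::{real_inner, complete_space} \<times> 'h) set"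
    and I :: "'h \<Rightarrow> real"
    and I' :: "'h \<Rightarrow> 'h \<Rightarrow> real"
  assumes self_adjoint: "self_adjoint_op A"
    and nonneg: "nonneg_op A"
    and compact_res: "compact_resolvent A"
    and C1: "C1_E A I I'"
    and I_0: "I 0 = 0"
    and i: "\<And>u w. weakly_converges_E A u w \<Longrightarrow> (\<lambda>n. I (u n)) \<longlonglongrightarrow> I w"
    and ii: "\<And>u. u \<in> form_domain A - {0} \<Longrightarrow> I u > 0"
    and iii: "\<And>u. u \<in> form_domain A - {0} \<Longrightarrow>
        mono_on {0<..} (\<lambda>t::real. I (t *\<^sub>R u) / t\<^sup>2) \<and>
        ((\<lambda>t::real. I (t *\<^sub>R u) / t\<^sup>2) \<longlongrightarrow> 0) (at_right 0) \<and>
        filterlim (\<lambda>t::real. I (t *\<^sub>R u) / t\<^sup>2) at_top at_top"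
    and iv: "\<And>u v (s::real). u \<in> form_domain A - {0} \<Longrightarrow> v \<in> form_domain A \<Longrightarrow> s \<ge> -1 \<Longrightarrow>
        I u - I ((1 + s) *\<^sub>R u + v) + I' u ((s * (s / 2 + 1)) *\<^sub>R u + (1 + s) *\<^sub>R v) \<le> 0"
    and iv_strict: "\<And>u (s::real). u \<in> form_domain A - {0} \<Longrightarrow> s \<ge> -1 \<Longrightarrow> s \<noteq> 0 \<Longrightarrow>
        I u - I ((1 + s) *\<^sub>R u) + I' u ((s * (s / 2 + 1)) *\<^sub>R u) < 0"
    and gap: "spectral_gap A J"
  shows "\<exists>\<mu>\<^sub>0>0. \<forall>\<mu>. 0 < \<mu> \<and> \<mu> < \<mu>\<^sub>0 \<longrightarrow> (\<exists>\<rho>\<in>J. \<exists>u. weak_solution A I' \<rho> u \<and> norm u = \<mu>)"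
proof -
  obtain l n where l: "eigenvalue_sequence A l" and ln: "l n < l (Suc n)" and J: "J = {l n <..< l (Suc n)}"
    using gap by (auto simp: spectral_gap_def)
  obtain e where "hilbert_basis e" and eA: "\<And>j. (e j, l j *\<^sub>R e j) \<in> A"
    by (rule eigenbasis_exists[OF self_adjoint compact_res l]) blast
  interpret hilbert_basis e by fact
  have mono: "mono l" and l_lim: "filterlim l at_top sequentially"
    using l by (auto simp: eigenvalue_sequence_def)
  have l0: "0 \<le> l j" for j
  proof -
    have "0 \<le> (l j *\<^sub>R e j) \<bullet> e j" using nonneg eA[of j] by (auto simp: nonneg_op_def)
    then show ?thesis by (simp add: orthonormal)
  qed
  define m where "m j = sqrt (l j)" for j
  have m2: "(m j)\<^sup>2 = l j" for j using l0 by (simp add: m_def)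
  have m_lim: "filterlim m at_top sequentially"
    unfolding m_def[abs_def] by (rule filterlim_compose[OF sqrt_at_top l_lim])
  have sqrtA: "sqrt_op A = diagonal_op m"
    using sqrt_diagonal_op[of l, OF l0] self_adjoint_eq_diagonal_op[OF self_adjoint eA] by (simp add: m_def[abs_def])
  define E where "E = Domain (diagonal_op m)"
  define S where "S = op_app (diagonal_op m)"
  define V where "V = {v. \<forall>j>n. v \<bullet> e j = 0}"
  have fE: "form_domain A = E" by (simp add: form_domain_def sqrtA E_def)
  have inner_E: "inner_E A u v = u \<bullet> v + S u \<bullet> S v" for u v by (simp add: inner_E_def sqrtA S_def)
  have norm_E: "norm_E A u = sqrt ((norm u)\<^sup>2 + (norm (S u))\<^sup>2)" for u
    by (simp add: norm_E_def inner_E power2_norm_eq_inner)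
  have subE: "subspace E" by (simp add: E_def subspace_Domain)
  have S_add: "S (u + v) = S u + S v" if "u \<in> E" "v \<in> E" for u v
    using that by (simp add: S_def E_def op_app_add)
  have S_scale: "S (c *\<^sub>R u) = c *\<^sub>R S u" if "u \<in> E" for c u
    using that by (simp add: S_def E_def op_app_scale)
  have S_coeff: "S u \<bullet> e j = m j * (u \<bullet> e j)" if "u \<in> E" for u j
    using that by (simp add: S_def E_def op_app_coefficient)
  have S_norm: "(\<lambda>j. l j * (u \<bullet> e j)\<^sup>2) sums (norm (S u))\<^sup>2" if "u \<in> E" for u
    using op_app_norm_sums[of u m] that by (simp add: S_def E_def m2)
  have scale_norm: "norm_E A (c *\<^sub>R h) = \<bar>c\<bar> * norm_E A h" if "h \<in> E" for c h
    by (simp add: norm_E S_scale[OF that] power_mult_distrib distrib_left[symmetric] real_sqrt_mult)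
  have eV: "e j \<in> V" if "j \<le> n" for j using that by (auto simp: V_def orthonormal)
  have VE: "V \<subseteq> E"
    unfolding E_def V_def by (auto intro!: finite_support_in_Domain[of "Suc n"])
  have perp: "w \<bullet> e j = 0" if "\<And>v. v \<in> V \<Longrightarrow> w \<bullet> v = 0" "j \<le> n" for w j
    using that eV by blast
  have "V = (\<Inter>j\<in>{n<..}. {v. v \<bullet> e j = 0})" by (auto simp: V_def)
  moreover have "closed {v. v \<bullet> e j = 0}" for j by (intro closed_Collect_eq continuous_intros)
  ultimately have closedV: "closed V" by auto
  have dual: "dual_E A (I' u)" if "u \<in> E" for u
    using C1 that by (auto simp: C1_E_def frechet_deriv_E_def fE)
  interpret gap_problem E S V I I' "l n" "l (Suc n)"
  proof
    show "subspace E" by (rule subE)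
    show "S (u + v) = S u + S v" if "u \<in> E" "v \<in> E" for u v using that by (rule S_add)
    show "S (c *\<^sub>R u) = c *\<^sub>R S u" if "u \<in> E" for c u using that by (rule S_scale)
    show "\<exists>r x. strict_mono (r :: nat \<Rightarrow> nat) \<and> x \<in> E \<and> (u \<circ> r) \<longlonglongrightarrow> x \<and> (\<forall>v. (\<lambda>k. S (u (r k)) \<bullet> v) \<longlonglongrightarrow> S x \<bullet> v)"
      if "\<And>k. u k \<in> E" "\<And>k. norm (u k) \<le> C" "\<And>k. norm (S (u k)) \<le> C" for u C
      using compact_embedding_diagonal_op[OF m_lim, of u C] that by (simp add: E_def S_def)
    show "subspace V" by (auto simp: V_def subspace_def inner_add_left)
    show "V \<subseteq> E" by (rule VE)
    show "closed V" by (rule closedV)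
    show "(norm (S v))\<^sup>2 \<le> l n * (norm v)\<^sup>2" if v: "v \<in> V" for v
    proof (rule sums_le[OF _ S_norm sums_mult[OF parseval_norm]])
      show "l j * (v \<bullet> e j)\<^sup>2 \<le> l n * (v \<bullet> e j)\<^sup>2" for j
        using v monoD[OF mono, of j n] by (cases "j \<le> n") (auto simp: V_def intro!: mult_right_mono)
      show "v \<in> E" using v VE by blast
    qed
    show "l (Suc n) * (norm w)\<^sup>2 \<le> (norm (S w))\<^sup>2" if w: "w \<in> E" "\<And>v. v \<in> V \<Longrightarrow> w \<bullet> v = 0" for w
    proof (rule sums_le[OF _ sums_mult[OF parseval_norm] S_norm[OF w(1)]])
      show "l (Suc n) * (w \<bullet> e j)\<^sup>2 \<le> l j * (w \<bullet> e j)\<^sup>2" for j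
        using perp[OF w(2)] monoD[OF mono, of "Suc n" j] by (cases "j \<le> n") (auto intro!: mult_right_mono)
    qed
    show "S w \<bullet> S v = 0" if w: "w \<in> E" "\<And>v. v \<in> V \<Longrightarrow> w \<bullet> v = 0" and v: "v \<in> V" for w v
    proof -
      have "(S w \<bullet> e j) * (S v \<bullet> e j) = 0" for j
      proof (cases "j \<le> n")
        case True
        then show ?thesis using perp[OF w(2)] S_coeff[OF w(1)] by simp
      next
        case False
        then show ?thesis using v VE S_coeff[of v j] by (auto simp: V_def)
      qed
      then show ?thesis by (rule inner_eq_zeroI)
    qed
    show "\<exists>v\<in>V. \<forall>v'\<in>V. (u - v) \<bullet> v' = 0" for u
    proof
      define v where "v = (\<Sum>j\<in>{..n}. (u \<bullet> e j) *\<^sub>R e j)"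
      show "v \<in> V" by (auto simp: v_def V_def inner_partial_sum)
      show "\<forall>v'\<in>V. (u - v) \<bullet> v' = 0"
      proof
        fix v' assume v': "v' \<in> V"
        have "((u - v) \<bullet> e j) * (v' \<bullet> e j) = 0" for j
          using v' by (cases "j \<le> n") (auto simp: V_def v_def inner_diff_left inner_partial_sum)
        then show "(u - v) \<bullet> v' = 0" by (rule inner_eq_zeroI)
      qed
    qed
    show "\<exists>w\<in>E. w \<noteq> 0 \<and> (\<forall>v\<in>V. w \<bullet> v = 0) \<and> (norm (S w))\<^sup>2 = l (Suc n) * (norm w)\<^sup>2"
    proof (intro bexI conjI ballI)
      have in_op: "(e (Suc n), m (Suc n) *\<^sub>R e (Suc n)) \<in> diagonal_op m" by (rule basis_in_diagonal_op)
      then show "e (Suc n) \<in> E" by (auto simp: E_def)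
      show "e (Suc n) \<noteq> 0" using orthonormal[of "Suc n" "Suc n"] by auto
      show "e (Suc n) \<bullet> v = 0" if "v \<in> V" for v using that by (simp add: V_def inner_commute)
      show "(norm (S (e (Suc n))))\<^sup>2 = l (Suc n) * (norm (e (Suc n)))\<^sup>2"
        by (simp add: S_def op_app_diagonal_op[OF in_op] power_mult_distrib m2)
    qed
    show "0 \<le> l n" by (rule l0)
    show "l n < l (Suc n)" by (rule ln)
    show "(\<lambda>k. I (u k)) \<longlonglongrightarrow> I x"
      if "\<And>k. u k \<in> E" "x \<in> E" "u \<longlonglongrightarrow> x" "\<And>v. (\<lambda>k. S (u k) \<bullet> v) \<longlonglongrightarrow> S x \<bullet> v" for u x
    proof (intro i)
      have "(\<lambda>k. inner_E A (u k) v) \<longlonglongrightarrow> inner_E A x v" for v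
        unfolding inner_E by (intro tendsto_add tendsto_inner[OF that(3) tendsto_const] that(4))
      then show "weakly_converges_E A u x" using that(1,2) by (simp add: weakly_converges_E_def fE)
    qed
    show "I 0 = 0" by (rule I_0)
    show "0 < I u" if "u \<in> E" "u \<noteq> 0" for u using ii[of u] that by (simp add: fE)
    show "mono_on {0<..} (\<lambda>t. I (t *\<^sub>R u) / t\<^sup>2)" if "u \<in> E" "u \<noteq> 0" for u using iii[of u] that by (simp add: fE)
    show "((\<lambda>t. I (t *\<^sub>R u) / t\<^sup>2) \<longlongrightarrow> 0) (at_right 0)" if "u \<in> E" "u \<noteq> 0" for u using iii[of u] that by (simp add: fE)
    show "filterlim (\<lambda>t. I (t *\<^sub>R u) / t\<^sup>2) at_top at_top" if "u \<in> E" "u \<noteq> 0" for u using iii[of u] that by (simp add: fE)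
    show "I' u (v + w) = I' u v + I' u w" if "u \<in> E" "v \<in> E" "w \<in> E" for u v w
      using dual[OF that(1)] that by (auto simp: dual_E_def fE)
    show "I' u (c *\<^sub>R v) = c * I' u v" if "u \<in> E" "v \<in> E" for u v c
      using dual[OF that(1)] that by (auto simp: dual_E_def fE)
    show "((\<lambda>t. I (u + t *\<^sub>R h)) has_real_derivative I' (u + t *\<^sub>R h) h) (at t)" if uh: "u \<in> E" "h \<in> E" for u h t
    proof -
      have "u + t *\<^sub>R h \<in> E" using uh by (intro subspace_add subspace_scale subE)
      then have "frechet_deriv_E A I (I' (u + t *\<^sub>R h)) (u + t *\<^sub>R h)" using C1 by (simp add: C1_E_def fE)
      then have "((\<lambda>\<eta>. (I (u + t *\<^sub>R h + \<eta> *\<^sub>R h) - I (u + t *\<^sub>R h)) / \<eta>) \<longlongrightarrow> I' (u + t *\<^sub>R h) h) (at 0)"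
        using uh by (intro frechet_deriv_E_directional) (auto simp: fE scale_norm subspace_scale subE)
      then show ?thesis by (simp add: DERIV_def scaleR_add_left add.assoc)
    qed
    show "(\<lambda>k. I' (u k) h) \<longlonglongrightarrow> I' x h"
      if ux: "\<And>k. u k \<in> E" "x \<in> E" "u \<longlonglongrightarrow> x" "(\<lambda>k. S (u k)) \<longlonglongrightarrow> S x" "h \<in> E" for u x h
    proof (rule LIMSEQ_I)
      fix \<epsilon> :: real assume \<epsilon>: "0 < \<epsilon>"
      define q where "q = \<bar>norm_E A h\<bar> + 1"
      have q: "0 < q" "norm_E A h < q" by (auto simp: q_def)
      obtain \<delta> where \<delta>: "0 < \<delta>" "\<And>w. w \<in> E \<Longrightarrow> norm_E A (w - x) < \<delta> \<Longrightarrow> \<bar>I' w h - I' x h\<bar> \<le> \<epsilon> / q * norm_E A h"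
      proof -
        have "0 < \<epsilon> / q" using \<epsilon> q by simp
        moreover have "\<forall>\<epsilon>>0. \<exists>\<delta>>0. \<forall>w\<in>E. norm_E A (w - x) < \<delta> \<longrightarrow>
            (\<forall>v\<in>E. \<bar>I' w v - I' x v\<bar> \<le> \<epsilon> * norm_E A v)"
          using C1 ux(2) unfolding C1_E_def fE by blast
        ultimately obtain \<delta> where \<delta>: "0 < \<delta>" "\<forall>w\<in>E. norm_E A (w - x) < \<delta> \<longrightarrow>
            (\<forall>v\<in>E. \<bar>I' w v - I' x v\<bar> \<le> \<epsilon> / q * norm_E A v)" by metis
        show ?thesis by (rule that[OF \<delta>(1)]) (use \<delta>(2) ux(5) in blast)
      qed
      have Sd: "S (u k - x) = S (u k) - S x" for k
        using S_add[OF subspace_diff[OF subE ux(1,2)] ux(2), of k] by simp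
      have "(\<lambda>k. sqrt ((norm (u k - x))\<^sup>2 + (norm (S (u k) - S x))\<^sup>2)) \<longlonglongrightarrow> sqrt ((norm (x - x))\<^sup>2 + (norm (S x - S x))\<^sup>2)"
        by (intro tendsto_intros ux)
      then have "(\<lambda>k. norm_E A (u k - x)) \<longlonglongrightarrow> 0" by (simp add: norm_E Sd)
      then obtain N where N: "\<And>k. N \<le> k \<Longrightarrow> norm (norm_E A (u k - x) - 0) < \<delta>"
        using LIMSEQ_D[OF _ \<delta>(1)] by metis
      have "norm (I' (u k) h - I' x h) < \<epsilon>" if "N \<le> k" for k
      proof -
        have "norm_E A (u k - x) < \<delta>" using N[OF that] by simp
        then have "\<bar>I' (u k) h - I' x h\<bar> \<le> \<epsilon> / q * norm_E A h" using \<delta>(2) ux(1) by blast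
        also have "\<dots> < \<epsilon> / q * q" using \<epsilon> q by (intro mult_strict_left_mono) auto
        finally show ?thesis using q by simp
      qed
      then show "\<exists>N. \<forall>k\<ge>N. norm (I' (u k) h - I' x h) < \<epsilon>" by blast
    qed
    show "I u - I ((1 + s) *\<^sub>R u + v) + I' u ((s * (s / 2 + 1)) *\<^sub>R u + (1 + s) *\<^sub>R v) \<le> 0"
      if "u \<in> E" "u \<noteq> 0" "v \<in> E" "s \<ge> -1" for u v s using iv[of u v s] that by (simp add: fE)
    show "I u - I ((1 + s) *\<^sub>R u) + I' u ((s * (s / 2 + 1)) *\<^sub>R u) < 0"
      if "u \<in> E" "u \<noteq> 0" "s \<ge> -1" "s \<noteq> 0" for u s using iv_strict[of u s] that by (simp add: fE)
  qed
  have weak: "weak_solution A I' \<rho> u \<longleftrightarrow> u \<in> E \<and> (\<forall>v\<in>E. S u \<bullet> S v = \<rho> * (u \<bullet> v) + I' u v)" for \<rho> u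
    by (simp add: weak_solution_def fE sqrtA S_def)
  show ?thesis
    using normalized_solution_in_gap unfolding J weak by (simp add: Bex_def) metis
qed

theorem theorem1p9:
  fixes A :: "('h::{real_inner, complete_space} \<times> 'h) set"
    and I :: "'h \<Rightarrow> real"
    and I' :: "'h \<Rightarrow> 'h \<Rightarrow> real"
    and k :: nat
    and J :: "nat \<Rightarrow> real set"
  assumes separable: "separable_space (euclidean :: 'h topology)"
    and infinite_dim: "\<nexists>B :: 'h set. finite B \<and> span B = UNIV"
    and self_adjoint: "self_adjoint_op A"
    and nonneg: "nonneg_op A"
    and compact_res: "compact_resolvent A"
    and C1: "C1_E A I I'"
    and I_0: "I 0 = 0"
    and I'_0: "\<forall>v \<in> form_domain A. I' 0 v = 0"
    and i: "\<And>u w. weakly_converges_E A u w \<Longrightarrow> (\<lambda>n. I (u n)) \<longlonglongrightarrow> I w"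
    and ii: "\<And>u. u \<in> form_domain A - {0} \<Longrightarrow> I u > 0"
    and iii: "\<And>u. u \<in> form_domain A - {0} \<Longrightarrow>
        mono_on {0<..} (\<lambda>t::real. I (t *\<^sub>R u) / t\<^sup>2) \<and>
        ((\<lambda>t::real. I (t *\<^sub>R u) / t\<^sup>2) \<longlongrightarrow> 0) (at_right 0) \<and>
        filterlim (\<lambda>t::real. I (t *\<^sub>R u) / t\<^sup>2) at_top at_top"
    and iv: "\<And>u v (s::real). u \<in> form_domain A - {0} \<Longrightarrow> v \<in> form_domain A \<Longrightarrow> s \<ge> -1 \<Longrightarrow>
        I u - I ((1 + s) *\<^sub>R u + v) + I' u ((s * (s / 2 + 1)) *\<^sub>R u + (1 + s) *\<^sub>R v) \<le> 0"
    and iv_strict: "\<And>u (s::real). u \<in> form_domain A - {0} \<Longrightarrow> s \<ge> -1 \<Longrightarrow> s \<noteq> 0 \<Longrightarrow>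
        I u - I ((1 + s) *\<^sub>R u) + I' u ((s * (s / 2 + 1)) *\<^sub>R u) < 0"
    and k_pos: "0 < k"
    and gaps: "\<And>i. i \<in> {1..k} \<Longrightarrow> spectral_gap A (J i)"
    and gaps_disjoint: "disjoint_family_on J {1..k}"
  shows "\<exists>\<mu>\<^sub>k>0. \<forall>\<mu>. 0 < \<mu> \<and> \<mu> < \<mu>\<^sub>k \<longrightarrow>
      (\<exists>(\<Lambda> :: nat \<Rightarrow> real) (u :: nat \<Rightarrow> 'h). \<forall>i \<in> {1..k}.
          \<Lambda> i \<in> J i \<and> weak_solution A I' (\<Lambda> i) (u i) \<and> norm (u i) = \<mu>) \<and>
      (\<exists>T :: ('h \<times> real) set. finite T \<and> card T = k \<and>
          (\<forall>(u, r) \<in> T. weak_solution A I' r u \<and> norm u = \<mu>))"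
proof -
  have "\<forall>i\<in>{1..k}. \<exists>\<mu>\<^sub>0>0. \<forall>\<mu>. 0 < \<mu> \<and> \<mu> < \<mu>\<^sub>0 \<longrightarrow> (\<exists>\<rho>\<in>J i. \<exists>u. weak_solution A I' \<rho> u \<and> norm u = \<mu>)"
    by (intro ballI normalized_solution_in_spectral_gap[OF self_adjoint nonneg compact_res C1 I_0 i ii iii iv iv_strict gaps])
  from bchoice[OF this] obtain M where M: "\<forall>i\<in>{1..k}. 0 < M i \<and>
      (\<forall>\<mu>. 0 < \<mu> \<and> \<mu> < M i \<longrightarrow> (\<exists>\<rho>\<in>J i. \<exists>u. weak_solution A I' \<rho> u \<and> norm u = \<mu>))"
    by blast
  define \<mu>\<^sub>k where "\<mu>\<^sub>k = Min (M ` {1..k})"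
  have ne: "M ` {1..k} \<noteq> {}" using k_pos by auto
  have pos: "0 < \<mu>\<^sub>k" unfolding \<mu>\<^sub>k_def using ne M by (subst Min_gr_iff) auto
  have le: "\<mu>\<^sub>k \<le> M i" if "i \<in> {1..k}" for i unfolding \<mu>\<^sub>k_def using that by (intro Min_le) auto
  show ?thesis
  proof (rule exI[of _ "\<mu>\<^sub>k"], rule conjI[OF pos], intro allI impI)
    fix \<mu> assume \<mu>: "0 < \<mu> \<and> \<mu> < \<mu>\<^sub>k"
    have "\<forall>i\<in>{1..k}. \<exists>p. fst p \<in> J i \<and> weak_solution A I' (fst p) (snd p) \<and> norm (snd p) = \<mu>"
    proof
      fix i assume i: "i \<in> {1..k}"
      then have "0 < \<mu> \<and> \<mu> < M i" using \<mu> le[OF i] by simp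
      then obtain \<rho> u where "\<rho> \<in> J i" "weak_solution A I' \<rho> u" "norm u = \<mu>" using M i by blast
      then show "\<exists>p. fst p \<in> J i \<and> weak_solution A I' (fst p) (snd p) \<and> norm (snd p) = \<mu>"
        by (intro exI[of _ "(\<rho>, u)"]) simp
    qed
    from bchoice[OF this] obtain p where p: "\<forall>i\<in>{1..k}. fst (p i) \<in> J i \<and>
        weak_solution A I' (fst (p i)) (snd (p i)) \<and> norm (snd (p i)) = \<mu>"
      by blast
    define T where "T = (\<lambda>i. (snd (p i), fst (p i))) ` {1..k}"
    have "inj_on (\<lambda>i. (snd (p i), fst (p i))) {1..k}"
    proof (rule inj_onI, rule ccontr)
      fix i j assume ij: "i \<in> {1..k}" "j \<in> {1..k}" "(snd (p i), fst (p i)) = (snd (p j), fst (p j))" "i \<noteq> j"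
      have "fst (p i) \<in> J i" "fst (p j) \<in> J j" using p ij(1,2) by blast+
      then have "fst (p i) \<in> J i \<inter> J j" using ij(3) by simp
      moreover have "J i \<inter> J j = {}" using gaps_disjoint ij by (auto simp: disjoint_family_on_def)
      ultimately show False by blast
    qed
    then have "card T = k" by (simp add: T_def card_image)
    moreover have "\<forall>(u, r)\<in>T. weak_solution A I' r u \<and> norm u = \<mu>" using p by (auto simp: T_def)
    moreover have "finite T" by (simp add: T_def)
    ultimately show "(\<exists>(\<Lambda> :: nat \<Rightarrow> real) (u :: nat \<Rightarrow> 'h). \<forall>i \<in> {1..k}.
          \<Lambda> i \<in> J i \<and> weak_solution A I' (\<Lambda> i) (u i) \<and> norm (u i) = \<mu>) \<and>
      (\<exists>T :: ('h \<times> real) set. finite T \<and> card T = k \<and>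
          (\<forall>(u, r) \<in> T. weak_solution A I' r u \<and> norm u = \<mu>))"
      using p by (intro conjI exI[of _ "\<lambda>i. fst (p i)"] exI[of _ "\<lambda>i. snd (p i)"] exI[of _ T]) auto
  qed
qed

end
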